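(* Let $\pi$ be a $p$-perturbation of a locally regular supercritical cellular automaton $\mathcal T$, let $u\in S^1$, and let the initial set be $A_0=H_u^-\cap\mathbf Z^2$. Then there exists a deterministic number $w_\pi(u)>0$ such that for every $\varepsilon>0$ there is a constant $c_\varepsilon>0$ such that for every $t$, with probability at least $1-\exp(-c_\varepsilon t)$, the inclusions $$H_u^-+t(w_\pi(u)-\varepsilon)\cdot u\ \subset\ A_t\ \subset\ H_u^-+t(w_\pi(u)+\varepsilon)\cdot u$$ hold within the lattice ball of radius $t^2$ (that is, they hold after intersecting all three sets with $\{x\in\mathbf Z^2:\|x\|_2\le t^2\}$).
   Context: Rules. Let $\mathcal N\subset\mathbf Z^2$ be a finite neighborhood with $0\in\mathcal N$ and $-\mathcal N=\mathcal N$. A random growth rule is a map $\pi:2^{\mathcal N}\to[0,1]$ satisfying the standing assumptions: monotone ($\pi(S_1)\le\pi(S_2)$ whenever $S_1\subset S_2$); $\pi(\varnothing)=0$; symmetric ($\pi(-S)=\pi(S)$); solidification ($\pi(S)=1$ whenever $0\in S$). Given an initial set $A_0\subset\mathbf Z^2$, the random sets $A_1,A_2,\dots$ are generated as follows: given $A_t$, each $x\in\mathbf Z^2$ belongs to $A_{t+1}$ with probability $\pi\big(((x+\mathcal N)\cap A_t)-x\big)$, independently over all $x$ and $t$. Associated deterministic CA. Put $\pi_d(S)=1$ if $\pi(S)>0$ and $\pi_d(S)=0$ otherwise, and $\mathcal T(A)=A\cup\{x\in\mathbf Z^2:\pi_d((A-x)\cap\mathcal N)=1\}$ for $A\subset\mathbf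 Z^2$. With $p=\min\{\pi(S):\pi(S)>0\}$, $\pi$ is called a $p$-perturbation of the cellular automaton (CA) $\mathcal T$. A set $A$ fills space if $\bigcup_{t\ge0}\mathcal T^t(A)=\mathbf Z^2$. Half-spaces. $S^1\subset\mathbf R^2$ is the set of unit vectors and $H_u^-=\{x\in\mathbf R^2:\langle x,u\rangle\le0\}$. For closed $B\subset\mathbf R^2$ let $\bar{\mathcal T}(B)=\{x\in\mathbf R^2:0\in\mathcal T((B-x)\cap\mathbf Z^2)\}$. For each $u\in S^1$ there is $w(u)\in\mathbf R$ with $\bar{\mathcal T}(H_u^-)=H_u^-+w(u)u$. The CA is supercritical if $w(u)>0$ for every $u\in S^1$. Local regularity. $\mathcal T$ is locally regular if for every initial state $A_0$ (initial states are assumed to fill space) there is a constant $C$ such that for every possible way the random dynamics can evolve, i.e. for every sequence $A_0\subset A_1\subset\cdots$ with $A_t\subset A_{t+1}\subset\mathcal T(A_t)$, and every $t$: every $x\in A_t$ at distance at least $C$ from $A_0$ has a set $G\subset A_t$, entirely within distance $C$ of $x$, that fills space. *)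

theory Defs
  imports "HOL-Probability.Probability"
begin

type_synonym site = "int \<times> int"

definition to_plane :: "site \<Rightarrow> real \<times> real" where
  "to_plane x = (of_int (fst x), of_int (snd x))"

definition lattice_part :: "(real \<times> real) set \<Rightarrow> site set" where
  "lattice_part B = to_plane -` B"

definition lattice_ball :: "real \<Rightarrow> site set" where
  "lattice_ball r = {x. norm (to_plane x) \<le> r}"

(* The set ((x + N) \<inter> A) - x, which is also (A - x) \<inter> N. *)
definition local_config :: "site set \<Rightarrow> site set \<Rightarrow> site \<Rightarrow> site set" where
  "local_config N A x = {y \<in> N. x + y \<in> A}"

(* A map on the subsets of N is represented by a total function on sets of sites;
   only its values on subsets of N are constrained or used. *)
definition growth_rule :: "site set \<Rightarrow> (site set \<Rightarrow> real) \<Rightarrow> bool" where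
  "growth_rule N \<pi> \<longleftrightarrow>
     finite N \<and> 0 \<in> N \<and> uminus ` N = N \<and>
     (\<forall>S\<subseteq>N. 0 \<le> \<pi> S \<and> \<pi> S \<le> 1) \<and>
     (\<forall>S1 S2. S1 \<subseteq> S2 \<and> S2 \<subseteq> N \<longrightarrow> \<pi> S1 \<le> \<pi> S2) \<and>
     \<pi> {} = 0 \<and>
     (\<forall>S\<subseteq>N. \<pi> (uminus ` S) = \<pi> S) \<and>
     (\<forall>S\<subseteq>N. 0 \<in> S \<longrightarrow> \<pi> S = 1)"

definition det_rule :: "(site set \<Rightarrow> real) \<Rightarrow> site set \<Rightarrow> real" where
  "det_rule \<pi> S = (if \<pi> S > 0 then 1 else 0)"

definition det_CA :: "site set \<Rightarrow> (site set \<Rightarrow> real) \<Rightarrow> site set \<Rightarrow> site set" where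
  "det_CA N \<pi> A = A \<union> {x. det_rule \<pi> (local_config N A x) = 1}"

definition perturbation ::
  "site set \<Rightarrow> (site set \<Rightarrow> real) \<Rightarrow> real \<Rightarrow> (site set \<Rightarrow> site set) \<Rightarrow> bool" where
  "perturbation N \<pi> p T \<longleftrightarrow>
     growth_rule N \<pi> \<and> T = det_CA N \<pi> \<and> p = Min {\<pi> S | S. S \<subseteq> N \<and> \<pi> S > 0}"

definition fills_space :: "(site set \<Rightarrow> site set) \<Rightarrow> site set \<Rightarrow> bool" where
  "fills_space T A \<longleftrightarrow> (\<Union>t. (T ^^ t) A) = UNIV"

definition half_space :: "real \<times> real \<Rightarrow> (real \<times> real) set" where
  "half_space u = {x. x \<bullet> u \<le> 0}"

definition shifted_half_space :: "real \<times> real \<Rightarrow> real \<Rightarrow> (real \<times> real) set" where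
  "shifted_half_space u r = (\<lambda>x. x + r *\<^sub>R u) ` half_space u"

definition plane_CA ::
  "(site set \<Rightarrow> site set) \<Rightarrow> (real \<times> real) set \<Rightarrow> (real \<times> real) set" where
  "plane_CA T B = {x. 0 \<in> T (lattice_part ((\<lambda>b. b - x) ` B))}"

(* For T = det_CA N \<pi> with growth_rule N \<pi>, the speed w exists and is unique for each u. *)
definition supercritical :: "(site set \<Rightarrow> site set) \<Rightarrow> bool" where
  "supercritical T \<longleftrightarrow>
     (\<forall>u. norm u = 1 \<longrightarrow> (\<exists>w>0. plane_CA T (half_space u) = shifted_half_space u w))"

definition locally_regular :: "(site set \<Rightarrow> site set) \<Rightarrow> bool" where
  "locally_regular T \<longleftrightarrow>
     (\<forall>A0. fills_space T A0 \<longrightarrow>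
       (\<exists>C::real. \<forall>A :: nat \<Rightarrow> site set.
          A 0 = A0 \<and> (\<forall>t. A t \<subseteq> A (Suc t) \<and> A (Suc t) \<subseteq> T (A t)) \<longrightarrow>
          (\<forall>t. \<forall>x \<in> A t. infdist (to_plane x) (to_plane ` A0) \<ge> C \<longrightarrow>
             (\<exists>G \<subseteq> A t. (\<forall>g\<in>G. dist (to_plane g) (to_plane x) \<le> C) \<and> fills_space T G))))"

definition history :: "'w measure \<Rightarrow> (nat \<Rightarrow> 'w \<Rightarrow> site set) \<Rightarrow> nat \<Rightarrow> 'w measure" where
  "history M A t = sigma (space M) {{\<omega> \<in> space M. x \<in> A s \<omega>} | s x. s \<le> t}"

(* Conditionally on A 0, ..., A t, the events x \<in> A (Suc t) are independent over the sites x,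
   with probabilities \<pi> (local_config N (A t) x): the product formula over all finite sets F. *)
definition growth_process ::
  "site set \<Rightarrow> (site set \<Rightarrow> real) \<Rightarrow> site set \<Rightarrow> 'w measure \<Rightarrow> (nat \<Rightarrow> 'w \<Rightarrow> site set) \<Rightarrow> bool" where
  "growth_process N \<pi> A0 M A \<longleftrightarrow>
     prob_space M \<and>
     (\<forall>t x. {\<omega> \<in> space M. x \<in> A t \<omega>} \<in> sets M) \<and>
     (\<forall>\<omega> \<in> space M. A 0 \<omega> = A0) \<and>
     (\<forall>t F. finite F \<longrightarrow>
        (AE \<omega> in M.
           real_cond_exp M (history M A t) (indicat_real {\<omega> \<in> space M. F \<subseteq> A (Suc t) \<omega>}) \<omega>
             = (\<Prod>x\<in>F. \<pi> (local_config N (A t \<omega>) x))))"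

end

theory Submission
  imports Defs "HOL-Real_Asymp.Real_Asymp"
begin

text \<open>
  Write \<open>h x\<close> for the inner product of a site \<open>x\<close> with \<open>u\<close>. Local regularity makes growth spread from
  every occupied site at linear speed with exponentially small failure probability. Hence one extra
  step of the dynamics changes the expected occupation time of a fixed site only by a small amount,
  and a martingale argument concentrates that time: for blocks of slightly different lengths
  \<open>L < S\<close> and any \<open>z\<close>, either \<open>z\<close> is very unlikely to be occupied at time \<open>L\<close> or very unlikely to be
  vacant at time \<open>S\<close>. In either case, cutting time into blocks and using monotonicity and
  translation invariance gives a recursion for the occupation probabilities at block times; the
  weight \<open>exp (\<mu> * h x)\<close> shows that it decays exponentially. So for \<open>v' < v\<close>, either height \<open>v' * t\<close> is
  filled or height \<open>v * t\<close> is empty at time \<open>t\<close>, up to exponentially small probability, and the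
  velocity is the supremum of the speeds of the first kind. A single step advances the half-space by
  exactly the velocity on any finite window with positive probability, which covers the small times.
  All of this takes place in finite windows, where expectations are finite sums.
\<close>

section \<open>Random subsets of a finite set\<close>

text \<open>No subadditive limit theorem is used. Two speeds \<open>v' < v\<close> are compared at a
  single finite scale, and whichever alternative holds there is carried to all times by a recursion.
  The scale must let concentration beat entropy: revealing one step moves the expected time by order
  \<open>k\<close>, because seeds spread with an exponential tail, so blocks of order
  \<open>k^4\<close> steps whose lengths differ by \<open>k^4\<close> give an Azuma exponent of
  order \<open>k^8 / (k^4 * k^2) = k^2\<close>, against only a logarithm of \<open>k\<close> for the
  number of sites seen by a block. Two obstacles shape the rest. The direction \<open>u\<close> may
  be irrational, so half-spaces are only shifted by lattice vectors, and every block estimate is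
  tied to a reference site \<open>z\<close>. And the final bound carries no prefactor: at each small
  positive time, and for each \<open>\<epsilon>\<close>, the event must have positive probability.
  This requires that sites behind the moving front can be filled and that those ahead of it can stay
  vacant, which holds for a front moving at exactly the velocity.\<close>

definition subset_weight :: "'a set \<Rightarrow> ('a \<Rightarrow> real) \<Rightarrow> 'a set \<Rightarrow> real" where
  "subset_weight W p S = (\<Prod>x\<in>S. p x) * (\<Prod>x\<in>W - S. 1 - p x)"

text \<open>Expectation of \<open>f\<close> for a random subset of \<open>W\<close> that contains
  each \<open>x\<close> independently with probability \<open>p x\<close>. The finite sum replaces a
  product measure, so linearity, conditioning and reindexing are plain algebra.\<close>

definition subset_mean :: "'a set \<Rightarrow> ('a \<Rightarrow> real) \<Rightarrow> ('a set \<Rightarrow> real) \<Rightarrow> real" where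
  "subset_mean W p f = (\<Sum>S\<in>Pow W. subset_weight W p S * f S)"

lemma subset_mean_add: "subset_mean W p (\<lambda>S. f S + g S) = subset_mean W p f + subset_mean W p g"
  by (simp add: subset_mean_def distrib_left sum.distrib)

lemma subset_mean_diff: "subset_mean W p (\<lambda>S. f S - g S) = subset_mean W p f - subset_mean W p g"
  by (simp add: subset_mean_def right_diff_distrib sum_subtractf)

lemma subset_mean_cmult: "subset_mean W p (\<lambda>S. c * f S) = c * subset_mean W p f"
  by (simp add: subset_mean_def sum_distrib_left mult.left_commute)

lemma subset_mean_sum: "subset_mean W p (\<lambda>S. \<Sum>i\<in>I. f i S) = (\<Sum>i\<in>I. subset_mean W p (f i))"
  unfolding subset_mean_def sum_distrib_left by (rule sum.swap)

text \<open>The weights are the terms in the expansion of the product of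
  \<open>p x + (1 - p x)\<close> over \<open>W\<close>, hence sum to one.\<close>

lemma subset_mean_const: "finite W \<Longrightarrow> subset_mean W p (\<lambda>_. c) = c"
  using prod_add[of W p "\<lambda>x. 1 - p x"]
  by (simp add: subset_mean_def subset_weight_def flip: sum_distrib_right)

lemma subset_mean_cong:
  assumes "\<And>x. x \<in> W \<Longrightarrow> p x = q x" "\<And>S. S \<subseteq> W \<Longrightarrow> f S = g S"
  shows "subset_mean W p f = subset_mean W q g"
  unfolding subset_mean_def subset_weight_def
  using assms by (intro sum.cong refl arg_cong2[where f="(*)"] prod.cong) auto

lemma subset_weight_nonneg:
  assumes "S \<subseteq> W" "\<And>x. x \<in> W \<Longrightarrow> 0 \<le> p x \<and> p x \<le> 1"
  shows "0 \<le> subset_weight W p S"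
  unfolding subset_weight_def using assms by (intro mult_nonneg_nonneg prod_nonneg) auto

text \<open>A set that contains an impossible site or misses a sure one has weight zero, so only the
  other sets need comparing. Later this confines one update to configurations between
  \<open>B\<close> and \<open>T B\<close>.\<close>

lemma subset_mean_mono:
  assumes "finite W" "\<And>x. x \<in> W \<Longrightarrow> 0 \<le> p x \<and> p x \<le> 1"
    and le: "\<And>S. \<lbrakk>S \<subseteq> W; \<And>x. x \<in> S \<Longrightarrow> p x > 0; \<And>x. \<lbrakk>x \<in> W; p x = 1\<rbrakk> \<Longrightarrow> x \<in> S\<rbrakk> \<Longrightarrow> f S \<le> g S"
  shows "subset_mean W p f \<le> subset_mean W p g"
  unfolding subset_mean_def
proof (rule sum_mono)
  fix S assume S: "S \<in> Pow W"
  then have fin: "finite S" using assms(1) finite_subset by auto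
  show "subset_weight W p S * f S \<le> subset_weight W p S * g S"
  proof (cases "(\<forall>x\<in>S. p x > 0) \<and> (\<forall>x\<in>W. p x = 1 \<longrightarrow> x \<in> S)")
    case True
    then show ?thesis using S le[of S] subset_weight_nonneg[of S W p] assms(2)
      by (intro mult_left_mono) auto
  next
    case False
    then have "subset_weight W p S = 0"
      unfolding subset_weight_def using S fin assms(1,2)
      by (auto simp: order.order_iff_strict)
    then show ?thesis by simp
  qed
qed

lemma subset_mean_insert:
  assumes "finite W" "x \<notin> W"
  shows "subset_mean (insert x W) p f =
    p x * subset_mean W p (\<lambda>S. f (insert x S)) + (1 - p x) * subset_mean W p f"
proof -
  have 1: "subset_weight (insert x W) p S = (1 - p x) * subset_weight W p S" if "S \<in> Pow W" for S
  proof -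
    have "insert x W - S = insert x (W - S)" using that assms by auto
    then show ?thesis using assms by (simp add: subset_weight_def)
  qed
  have 2: "subset_weight (insert x W) p (insert x S) = p x * subset_weight W p S" if "S \<in> Pow W" for S
  proof -
    have "insert x W - insert x S = W - S" "x \<notin> S" "finite S"
      using that assms finite_subset by auto
    then show ?thesis using assms by (simp add: subset_weight_def)
  qed
  have inj: "inj_on (insert x) (Pow W)"
    using assms(2) by (auto simp: inj_on_def)
  have "subset_mean (insert x W) p f =
     (\<Sum>S\<in>Pow W. subset_weight (insert x W) p S * f S)
     + (\<Sum>S\<in>insert x ` Pow W. subset_weight (insert x W) p S * f S)"
    unfolding subset_mean_def Pow_insert using assms
    by (intro sum.union_disjoint) auto
  also have "(\<Sum>S\<in>insert x ` Pow W. subset_weight (insert x W) p S * f S)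
     = (\<Sum>S\<in>Pow W. subset_weight (insert x W) p (insert x S) * f (insert x S))"
    by (subst sum.reindex[OF inj]) simp
  finally show ?thesis
    by (simp add: 1 2 subset_mean_def sum_distrib_left mult.assoc)
qed

text \<open>Induction over the coins in place of a coupling: conditioning on the coin at
  \<open>x\<close>, both conditional means are ordered by induction, and raising \<open>p x\<close>
  to \<open>q x\<close> moves weight to the larger one.\<close>

lemma subset_mean_mono_prob:
  assumes "finite W" "\<And>x. x \<in> W \<Longrightarrow> 0 \<le> p x \<and> p x \<le> q x \<and> q x \<le> 1"
    and "\<And>S S'. S \<subseteq> S' \<Longrightarrow> f S \<le> f S'"
  shows "subset_mean W p f \<le> subset_mean W q f"
  using assms
proof (induction W arbitrary: f rule: finite_induct)
  case empty
  then show ?case by (simp add: subset_mean_def subset_weight_def)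
next
  case (insert x W)
  have a: "subset_mean W p (\<lambda>S. f (insert x S)) \<le> subset_mean W q (\<lambda>S. f (insert x S))"
    using insert by (intro insert.IH) (auto intro!: insert.prems(2))
  have b: "subset_mean W p f \<le> subset_mean W q f"
    using insert by (intro insert.IH) auto
  have c: "subset_mean W q f \<le> subset_mean W q (\<lambda>S. f (insert x S))"
  proof (intro subset_mean_mono)
    fix y assume "y \<in> W"
    then show "0 \<le> q y \<and> q y \<le> 1" using insert.prems(1)[of y] by auto
  qed (use insert in \<open>auto intro!: insert.prems(2)\<close>)
  have px: "0 \<le> p x" "p x \<le> q x" "q x \<le> 1" using insert.prems(1) by auto
  have "p x * subset_mean W p (\<lambda>S. f (insert x S)) + (1 - p x) * subset_mean W p f
     \<le> p x * subset_mean W q (\<lambda>S. f (insert x S)) + (1 - p x) * subset_mean W q f"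
    using a b px by (intro add_mono mult_left_mono) auto
  also have "\<dots> = subset_mean W q f + p x * (subset_mean W q (\<lambda>S. f (insert x S)) - subset_mean W q f)"
    by (simp add: algebra_simps)
  also have "\<dots> \<le> subset_mean W q f + q x * (subset_mean W q (\<lambda>S. f (insert x S)) - subset_mean W q f)"
    using c px by (intro add_left_mono mult_right_mono) auto
  finally show ?case
    using insert by (simp add: subset_mean_insert algebra_simps)
qed

text \<open>Coins outside \<open>F\<close> are averaged out one at a time, since flipping one of
  them does not change \<open>f\<close>. Locality of the growth rests on this.\<close>

lemma subset_mean_restrict:
  assumes "finite W" "F \<subseteq> W" "\<And>S. S \<subseteq> W \<Longrightarrow> f S = f (S \<inter> F)"
  shows "subset_mean W p f = subset_mean F p f"
proof -
  have "subset_mean (F \<union> D) p f = subset_mean F p f"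
    if "finite D" "D \<inter> F = {}" "\<And>S. S \<subseteq> F \<union> D \<Longrightarrow> f S = f (S \<inter> F)" for D
    using that
  proof (induction D rule: finite_induct)
    case (insert x D)
    have "subset_mean (F \<union> D) p (\<lambda>S. f (insert x S)) = subset_mean (F \<union> D) p f"
    proof (rule subset_mean_cong)
      fix S assume "S \<subseteq> F \<union> D"
      then have "f (insert x S) = f (insert x S \<inter> F)" "f S = f (S \<inter> F)"
        by (auto intro!: insert.prems(2))
      moreover have "insert x S \<inter> F = S \<inter> F" using insert.prems(1) by auto
      ultimately show "f (insert x S) = f S" by simp
    qed simp
    moreover have "finite (F \<union> D)" using insert assms finite_subset by auto
    moreover have "x \<notin> F \<union> D" using insert by auto
    ultimately have "subset_mean (insert x (F \<union> D)) p f = subset_mean (F \<union> D) p f"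
      by (simp add: subset_mean_insert algebra_simps)
    also have "\<dots> = subset_mean F p f"
      using insert.prems by (intro insert.IH) auto
    finally show ?case by simp
  qed simp
  moreover have "(W - F) \<inter> F = {}" "F \<union> (W - F) = W" using assms(2) by auto
  ultimately show ?thesis
    using assms(1,3) finite_Diff[OF assms(1), of F] by metis
qed

lemma subset_mean_point:
  assumes "finite W" "F \<subseteq> W" "S0 \<subseteq> F"
  shows "subset_mean W p (\<lambda>S. of_bool (S \<inter> F = S0)) = subset_weight F p S0"
proof -
  have "subset_mean W p (\<lambda>S. of_bool (S \<inter> F = S0)) = subset_mean F p (\<lambda>S. of_bool (S \<inter> F = S0))"
    using assms by (intro subset_mean_restrict) auto
  also have "\<dots> = (\<Sum>S\<in>Pow F. if S = S0 then subset_weight F p S else 0)"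
    unfolding subset_mean_def by (intro sum.cong refl) (auto simp: Int_absorb2)
  also have "\<dots> = subset_weight F p S0"
    using assms finite_subset by (subst sum.delta) auto
  finally show ?thesis .
qed

lemma subset_mean_superset:
  assumes "finite W" "Y \<subseteq> W"
  shows "subset_mean W p (\<lambda>S. of_bool (Y \<subseteq> S)) = (\<Prod>x\<in>Y. p x)"
proof -
  have "(\<lambda>S. of_bool (Y \<subseteq> S) :: real) = (\<lambda>S. of_bool (S \<inter> Y = Y))"
    by (auto intro!: ext)
  then show ?thesis
    using subset_mean_point[OF assms, of Y p] by (simp add: subset_weight_def)
qed

lemma subset_mean_image:
  assumes "inj \<tau>"
  shows "subset_mean (\<tau> ` W) p f = subset_mean W (p \<circ> \<tau>) (\<lambda>S. f (\<tau> ` S))"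
proof -
  have inj: "inj_on ((`) \<tau>) (Pow W)"
    using assms by (auto simp: inj_on_def inj_image_eq_iff)
  have "Pow (\<tau> ` W) = (`) \<tau> ` Pow W"
    by (auto simp: subset_image_iff)
  then have "subset_mean (\<tau> ` W) p f = (\<Sum>S\<in>Pow W. subset_weight (\<tau> ` W) p (\<tau> ` S) * f (\<tau> ` S))"
    by (simp add: subset_mean_def sum.reindex[OF inj])
  also have "\<dots> = subset_mean W (p \<circ> \<tau>) (\<lambda>S. f (\<tau> ` S))"
    unfolding subset_mean_def
  proof (rule sum.cong)
    fix S
    have "\<tau> ` W - \<tau> ` S = \<tau> ` (W - S)" using assms by (simp add: image_set_diff)
    then show "subset_weight (\<tau> ` W) p (\<tau> ` S) * f (\<tau> ` S) = subset_weight W (p \<circ> \<tau>) S * f (\<tau> ` S)"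
      using inj_on_subset[OF assms] by (simp add: subset_weight_def prod.reindex)
  qed simp
  finally show ?thesis .
qed

lemma exp_le_quadratic:
  fixes y :: real assumes "\<bar>y\<bar> \<le> 1" shows "exp y \<le> 1 + y + y\<^sup>2"
proof (cases "y \<ge> 0")
  case True
  then show ?thesis using exp_bound[of y] assms by simp
next
  case False
  obtain t where t: "\<bar>t\<bar> \<le> \<bar>y\<bar>" "exp y = (\<Sum>m<3. y ^ m / fact m) + exp t / fact 3 * y ^ 3"
    using Maclaurin_exp_le[of y 3] by blast
  have "y ^ 3 \<le> 0" using False by (simp add: power3_eq_cube mult_nonneg_nonpos mult_nonpos_nonpos)
  then have "exp t / fact 3 * y ^ 3 \<le> 0" by (intro mult_nonneg_nonpos) auto
  then have "exp y \<le> 1 + y + y\<^sup>2 / 2" using t(2) by (simp add: eval_nat_numeral)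
  also have "\<dots> \<le> 1 + y + y\<^sup>2" by simp
  finally show ?thesis .
qed

text \<open>Hoeffding-type bound: the mean \<open>m\<close> lies in the same interval of length
  \<open>D\<close>, so \<open>l * (f S - m)\<close> has modulus at most one and the exponential can
  be replaced by its second-order bound, whose linear term has mean zero.\<close>

lemma subset_mean_exp_le:
  assumes fin: "finite W" and p: "\<And>x. x \<in> W \<Longrightarrow> 0 \<le> p x \<and> p x \<le> 1"
    and range: "\<And>S. \<lbrakk>S \<subseteq> W; \<And>x. x \<in> S \<Longrightarrow> p x > 0; \<And>x. \<lbrakk>x \<in> W; p x = 1\<rbrakk> \<Longrightarrow> x \<in> S\<rbrakk> \<Longrightarrow> a \<le> f S \<and> f S \<le> a + D"
    and l: "\<bar>l\<bar> * D \<le> 1"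
  shows "subset_mean W p (\<lambda>S. exp (l * f S)) \<le> exp (l * subset_mean W p f + l\<^sup>2 * D\<^sup>2)"
proof -
  define m where "m = subset_mean W p f"
  have m: "a \<le> m" "m \<le> a + D"
    using subset_mean_mono[OF fin p, where f="\<lambda>_. a" and g=f] subset_mean_mono[OF fin p, where f=f and g="\<lambda>_. a + D"] range
    by (auto simp: subset_mean_const fin m_def)
  have "subset_mean W p (\<lambda>S. exp (l * f S)) \<le> 
    subset_mean W p (\<lambda>S. exp (l * m) * (1 + l\<^sup>2 * D\<^sup>2 - l * m + l * f S))"
  proof (rule subset_mean_mono[OF fin p])
    fix S assume "S \<subseteq> W" "\<And>x. x \<in> S \<Longrightarrow> p x > 0" "\<And>x. \<lbrakk>x \<in> W; p x = 1\<rbrakk> \<Longrightarrow> x \<in> S"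
    then have "a \<le> f S \<and> f S \<le> a + D" by (rule range)
    then have d: "\<bar>f S - m\<bar> \<le> D" using m by auto
    then have "\<bar>l * (f S - m)\<bar> \<le> \<bar>l\<bar> * D"
      by (simp add: abs_mult mult_left_mono)
    then have "exp (l * (f S - m)) \<le> 1 + l * (f S - m) + (l * (f S - m))\<^sup>2"
      using l by (intro exp_le_quadratic) auto
    moreover have "(l * (f S - m))\<^sup>2 \<le> l\<^sup>2 * D\<^sup>2"
      unfolding power_mult_distrib using d by (intro mult_left_mono) (auto simp: abs_le_square_iff[symmetric])
    ultimately have "exp (l * (f S - m)) \<le> 1 + l\<^sup>2 * D\<^sup>2 - l * m + l * f S"
      by (simp add: algebra_simps)
    then have "exp (l * m) * exp (l * (f S - m)) \<le> exp (l * m) * (1 + l\<^sup>2 * D\<^sup>2 - l * m + l * f S)"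
      by (intro mult_left_mono) auto
    then show "exp (l * f S) \<le> exp (l * m) * (1 + l\<^sup>2 * D\<^sup>2 - l * m + l * f S)"
      by (simp add: exp_add[symmetric] algebra_simps)
  qed
  also have "\<dots> = exp (l * m) * (1 + l\<^sup>2 * D\<^sup>2)"
    by (simp add: subset_mean_cmult subset_mean_add subset_mean_const fin m_def)
  also have "\<dots> \<le> exp (l * m) * exp (l\<^sup>2 * D\<^sup>2)"
    by (intro mult_left_mono) auto
  finally show ?thesis by (simp add: exp_add m_def)
qed

section \<open>Growth in finite windows\<close>

definition square :: "site \<Rightarrow> nat \<Rightarrow> site set" where
  "square x r = {y. \<bar>fst y - fst x\<bar> \<le> int r \<and> \<bar>snd y - snd x\<bar> \<le> int r}"

lemma square_eq: "square x r = {fst x - int r..fst x + int r} \<times> {snd x - int r..snd x + int r}"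
  by (auto simp: square_def)

lemma finite_square [simp]: "finite (square x r)"
  by (simp add: square_eq)

lemma card_square: "card (square x r) = (2 * r + 1)\<^sup>2"
proof -
  have "card {a - int r..a + int r} = 2 * r + 1" for a by simp
  then show ?thesis by (simp add: square_eq card_cartesian_product power2_eq_square)
qed

lemma centre_in_square [simp]: "x \<in> square x r"
  by (simp add: square_def)

lemma square_mono: "r \<le> s \<Longrightarrow> square x r \<subseteq> square x s"
  by (auto simp: square_def)

lemma square_shift: "square (z + x) r = (+) z ` square x r"
proof -
  have "y \<in> (+) z ` square x r" if "y \<in> square (z + x) r" for y
    using that by (intro image_eqI[of _ _ "y - z"]) (auto simp: square_def algebra_simps)
  then show ?thesis by (auto simp: square_def)
qed

lemma square_trans: "y \<in> square x r \<Longrightarrow> z \<in> square y s \<Longrightarrow> z \<in> square x (r + s)"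
  by (auto simp: square_def)

lemma square_subset: "y \<in> square x r \<Longrightarrow> square y s \<subseteq> square x (r + s)"
  using square_trans by blast

lemma finite_subset_square:
  assumes "finite F" obtains r where "F \<subseteq> square 0 r"
proof -
  define m :: "site \<Rightarrow> nat" where "m z = nat \<bar>fst z\<bar> + nat \<bar>snd z\<bar>" for z
  have "y \<in> square 0 (\<Sum>z\<in>F. m z)" if "y \<in> F" for y
  proof -
    have "m y \<le> (\<Sum>z\<in>F. m z)"
      using assms that by (intro member_le_sum) auto
    then have "int (m y) \<le> int (\<Sum>z\<in>F. m z)" by (rule of_nat_mono)
    then show ?thesis by (auto simp: square_def m_def)
  qed
  then show ?thesis using that by blast
qed

text \<open>Local (cylinder) functions of a configuration.\<close>

definition depends_on :: "(site set \<Rightarrow> 'a) \<Rightarrow> site set \<Rightarrow> bool" where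
  "depends_on f F \<longleftrightarrow> (\<forall>A B. A \<inter> F = B \<inter> F \<longrightarrow> f A = f B)"

lemma depends_onD: "depends_on f F \<Longrightarrow> A \<inter> F = B \<inter> F \<Longrightarrow> f A = f B"
  unfolding depends_on_def by (elim allE impE)

lemma depends_on_member: "x \<in> F \<Longrightarrow> depends_on (\<lambda>A. of_bool (x \<in> A)) F"
  by (auto simp: depends_on_def)

lemma subset_mean_indicator:
  assumes "finite F" shows "subset_mean F (\<lambda>x. of_bool (x \<in> A)) f = f (A \<inter> F)"
proof -
  have w: "subset_weight F (\<lambda>x. of_bool (x \<in> A)) S = of_bool (S = A \<inter> F)" if S: "S \<subseteq> F" for S
  proof (cases "S = A \<inter> F")
    case True
    then show ?thesis by (auto simp: subset_weight_def intro!: prod.neutral)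
  next
    case False
    then consider x where "x \<in> S" "x \<notin> A" | x where "x \<in> F - S" "x \<in> A" using S by blast
    then have "(\<Prod>x\<in>S. of_bool (x \<in> A) :: real) = 0 \<or> (\<Prod>x\<in>F - S. 1 - of_bool (x \<in> A) :: real) = 0"
      using assms S finite_subset[OF S assms] by cases (auto simp: prod_zero_iff)
    then show ?thesis using False by (auto simp: subset_weight_def)
  qed
  have "subset_mean F (\<lambda>x. of_bool (x \<in> A)) f = (\<Sum>S\<in>Pow F. if S = A \<inter> F then f S else 0)"
    unfolding subset_mean_def by (intro sum.cong refl) (auto simp: w)
  also have "\<dots> = f (A \<inter> F)" using assms by (subst sum.delta) auto
  finally show ?thesis .
qed

text \<open>With zero-one probabilities the random subset is \<open>A \<inter> F\<close> itself.
  This writes a local function as a polynomial in occupation indicators, so its measurability and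
  its expectation reduce to products over sites.\<close>

lemma depends_on_eq_subset_mean:
  assumes "finite F" "depends_on f F"
  shows "f A = subset_mean F (\<lambda>x. of_bool (x \<in> A)) f"
  unfolding subset_mean_indicator[OF assms(1)] by (rule depends_onD[OF assms(2)]) blast

lemma measurable_subset_mean:
  assumes "\<And>x. x \<in> F \<Longrightarrow> (\<lambda>\<omega>. p \<omega> x) \<in> borel_measurable M"
  shows "(\<lambda>\<omega>. subset_mean F (p \<omega>) f) \<in> borel_measurable M"
  unfolding subset_mean_def subset_weight_def
  using assms by (intro borel_measurable_sum borel_measurable_times borel_measurable_prod
      borel_measurable_diff borel_measurable_const) auto

section \<open>The monotone local rule, its deterministic skeleton and reachable
  configurations\<close>

locale random_growth =
  fixes N :: "site set" and \<pi> :: "site set \<Rightarrow> real"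
  assumes rule: "growth_rule N \<pi>"
begin

abbreviation T :: "site set \<Rightarrow> site set" where "T \<equiv> det_CA N \<pi>"

definition prob :: "site set \<Rightarrow> site \<Rightarrow> real" where
  "prob B x = \<pi> (local_config N B x)"

lemma zero_in_N: "0 \<in> N" and finite_N: "finite N" and uminus_N: "y \<in> N \<Longrightarrow> - y \<in> N"
  using rule by (auto simp: growth_rule_def)

lemma prob_bounds: "0 \<le> prob B x" "prob B x \<le> 1"
  using rule by (auto simp: growth_rule_def prob_def local_config_def)

lemma local_config_mono: "B \<subseteq> B' \<Longrightarrow> local_config N B x \<subseteq> local_config N B' x"
  by (auto simp: local_config_def)

lemma prob_mono: "B \<subseteq> B' \<Longrightarrow> prob B x \<le> prob B' x"
  using rule unfolding growth_rule_def prob_def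
  by (metis (no_types, lifting) local_config_mono local_config_def mem_Collect_eq subsetI)

lemma prob_occupied: "x \<in> B \<Longrightarrow> prob B x = 1"
  using rule by (auto simp: growth_rule_def prob_def local_config_def)

text \<open>Solidification absorbs the union in \<open>det_CA\<close>: occupied sites have
  probability one, so \<open>T B\<close> is the support of the random update.\<close>

lemma T_iff: "x \<in> T B \<longleftrightarrow> prob B x > 0"
  using prob_occupied[of x B] by (auto simp: det_CA_def det_rule_def prob_def)

lemma T_extensive: "B \<subseteq> T B"
  by (auto simp: det_CA_def)

lemma T_mono: "B \<subseteq> B' \<Longrightarrow> T B \<subseteq> T B'"
  unfolding subset_iff T_iff using prob_mono order.strict_trans2 by blast

lemma T_near:
  assumes "x \<in> T B" obtains y where "y \<in> N" "x + y \<in> B"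
proof -
  have "local_config N B x \<noteq> {}"
    using assms rule by (auto simp: T_iff prob_def growth_rule_def)
  then show ?thesis using that by (auto simp: local_config_def)
qed

lemma prob_shift: "prob ((+) z ` B) (z + x) = prob B x"
proof -
  have "z + x + y \<in> (+) z ` B \<longleftrightarrow> x + y \<in> B" for y
    by (auto simp: add.assoc)
  then show ?thesis by (simp add: prob_def local_config_def)
qed

lemma T_shift: "T ((+) z ` B) = (+) z ` T B"
proof -
  have "x \<in> T ((+) z ` B) \<longleftrightarrow> x - z \<in> T B" for x
    using prob_shift[of z B "x - z"] by (simp add: T_iff)
  moreover have "x \<in> (+) z ` T B \<longleftrightarrow> x - z \<in> T B" for x
    by (auto simp: image_iff intro!: bexI[of _ "x - z"])
  ultimately show ?thesis by blast
qed

lemma T_pow_shift: "(T ^^ t) ((+) z ` B) = (+) z ` (T ^^ t) B"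
  by (induction t) (simp_all add: T_shift)

lemma T_pow_mono: "B \<subseteq> B' \<Longrightarrow> (T ^^ t) B \<subseteq> (T ^^ t) B'"
  by (induction t) (simp_all add: T_mono)

lemma T_pow_time_mono: "s \<le> t \<Longrightarrow> (T ^^ s) B \<subseteq> (T ^^ t) B"
  by (induction t rule: dec_induct) (use T_extensive in auto)

lemma fills_space_mono: "fills_space T B \<Longrightarrow> B \<subseteq> B' \<Longrightarrow> fills_space T B'"
  unfolding fills_space_def
  by (rule top_le, erule subst, intro UN_mono T_pow_mono) auto

lemma fills_space_shift: "fills_space T B \<Longrightarrow> fills_space T ((+) z ` B)"
  unfolding fills_space_def T_pow_shift image_UN[symmetric] by simp

text \<open>Endpoints of the admissible sequences in the definition of local regularity. Growth that
  is frozen outside a window is admissible too, so regularity applies directly to the windowed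
  dynamics.\<close>

inductive reach :: "site set \<Rightarrow> site set \<Rightarrow> bool" for B0 where
  reach_refl: "reach B0 B0"
| reach_step: "reach B0 B \<Longrightarrow> B \<subseteq> B' \<Longrightarrow> B' \<subseteq> T B \<Longrightarrow> reach B0 B'"

lemma reach_trans: "reach A B \<Longrightarrow> reach B C \<Longrightarrow> reach A C"
  by (rotate_tac, induction rule: reach.induct) (auto intro: reach.intros)

lemma reach_superset: "reach A B \<Longrightarrow> A \<subseteq> B"
  by (induction rule: reach.induct) auto

lemma reach_sequence:
  assumes "reach B0 B"
  shows "\<exists>A t. A 0 = B0 \<and> (\<forall>s. A s \<subseteq> A (Suc s) \<and> A (Suc s) \<subseteq> T (A s)) \<and> A t = B"
  using assms
proof (induction rule: reach.induct)
  case reach_refl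
  then show ?case by (intro exI[of _ "\<lambda>_. B0"] exI[of _ 0]) (auto simp: T_extensive[THEN subsetD])
next
  case (reach_step B B')
  then obtain A t where A: "A 0 = B0" "\<And>s. A s \<subseteq> A (Suc s) \<and> A (Suc s) \<subseteq> T (A s)" "A t = B"
    by blast
  \<comment> \<open>Regularity speaks of infinite sequences; staying at \<open>B'\<close> forever is
    admissible because \<open>T\<close> is extensive.\<close>
  define A' where "A' s = (if s \<le> t then A s else B')" for s
  have "A' s \<subseteq> A' (Suc s) \<and> A' (Suc s) \<subseteq> T (A' s)" for s
  proof -
    consider "Suc s \<le> t" | "s = t" | "s > t" by linarith
    then show ?thesis
      using A reach_step.hyps T_extensive[of B'] by cases (auto simp: A'_def)
  qed
  then show ?case using A(1) by (intro exI[of _ A'] exI[of _ "Suc t"]) (auto simp: A'_def)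
qed

section \<open>Finite range and the transition operator of a window\<close>

definition radius :: nat where "radius = (SOME r. N \<subseteq> square 0 r)"

lemma N_subset_square: "N \<subseteq> square 0 radius"
  unfolding radius_def using finite_subset_square[OF finite_N] by (metis someI)

lemma neighbour_in_square:
  assumes "y \<in> N" shows "x + y \<in> square x radius"
  using N_subset_square assms by (auto simp: square_def)

lemma prob_local:
  assumes "B \<inter> square x radius = B' \<inter> square x radius"
  shows "prob B x = prob B' x"
proof -
  have "local_config N B x = local_config N B' x"
    unfolding local_config_def using assms neighbour_in_square[of _ x] by blast
  then show ?thesis by (simp add: prob_def)
qed

text \<open>One update of the random dynamics restricted to a finite window \<open>W\<close>; the configuration
  outside \<open>W\<close> is frozen, so that only finite sums occur.\<close>
definition step :: "site set \<Rightarrow> (site set \<Rightarrow> real) \<Rightarrow> site set \<Rightarrow> real" where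
  "step W f B = subset_mean W (prob B) (\<lambda>S. f ((B - W) \<union> S))"

text \<open>Backward form: \<open>steps W t f B\<close> is the mean of \<open>f\<close> after
  \<open>t\<close> updates started from \<open>B\<close>, the outermost \<open>step\<close> being
  the first in time.\<close>

abbreviation steps :: "site set \<Rightarrow> nat \<Rightarrow> (site set \<Rightarrow> real) \<Rightarrow> site set \<Rightarrow> real" where
  "steps W t \<equiv> step W ^^ t"

lemma step_const [simp]: "finite W \<Longrightarrow> step W (\<lambda>_. c) = (\<lambda>_. c)"
  by (rule ext) (simp add: step_def subset_mean_const)

lemma step_add: "step W (\<lambda>A. f A + g A) = (\<lambda>B. step W f B + step W g B)"
  by (rule ext) (simp add: step_def subset_mean_add)

lemma step_diff: "step W (\<lambda>A. f A - g A) = (\<lambda>B. step W f B - step W g B)"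
  by (rule ext) (simp add: step_def subset_mean_diff)

lemma step_cmult: "step W (\<lambda>A. c * f A) = (\<lambda>B. c * step W f B)"
  by (rule ext) (simp add: step_def subset_mean_cmult)

lemma step_sum: "step W (\<lambda>A. \<Sum>i\<in>I. f i A) = (\<lambda>B. \<Sum>i\<in>I. step W (f i) B)"
  by (rule ext) (simp add: step_def subset_mean_sum)

text \<open>Only successors of positive weight are compared. They contain \<open>B\<close> by
  solidification, stay inside \<open>T B\<close>, and contain every sure site of the window; the
  last fact later yields deterministic advance.\<close>

lemma step_mono:
  assumes "finite W"
    and "\<And>B'. \<lbrakk>B \<subseteq> B'; B' \<subseteq> T B; \<And>x. \<lbrakk>x \<in> W; prob B x = 1\<rbrakk> \<Longrightarrow> x \<in> B'\<rbrakk> \<Longrightarrow> f B' \<le> g B'"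
  shows "step W f B \<le> step W g B"
  unfolding step_def
proof (rule subset_mean_mono)
  fix S assume S: "S \<subseteq> W" "\<And>x. x \<in> S \<Longrightarrow> prob B x > 0" "\<And>x. \<lbrakk>x \<in> W; prob B x = 1\<rbrakk> \<Longrightarrow> x \<in> S"
  show "f ((B - W) \<union> S) \<le> g ((B - W) \<union> S)"
  proof (rule assms(2))
    show "B \<subseteq> B - W \<union> S" using S(3) prob_occupied by blast
    show "B - W \<union> S \<subseteq> T B" using S(2) T_extensive by (auto simp: T_iff[symmetric])
  qed (use S(3) in auto)
qed (use assms(1) prob_bounds in auto)

lemma step_mono_set:
  assumes "finite W" "mono f" "B \<subseteq> B'"
  shows "step W f B \<le> step W f B'"
proof -
  have "step W f B \<le> subset_mean W (prob B) (\<lambda>S. f ((B' - W) \<union> S))"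
    unfolding step_def
    by (intro subset_mean_mono) (use assms prob_bounds in \<open>auto intro!: monoD[OF assms(2)]\<close>)
  also have "\<dots> \<le> step W f B'"
    unfolding step_def
    by (intro subset_mean_mono_prob) (use assms prob_bounds prob_mono in \<open>auto intro!: monoD[OF assms(2)]\<close>)
  finally show ?thesis .
qed

lemma mono_step: "finite W \<Longrightarrow> mono f \<Longrightarrow> mono (step W f)"
  by (simp add: monoI step_mono_set)

lemma step_ge:
  assumes "finite W" "mono f" shows "f B \<le> step W f B"
proof -
  have "step W (\<lambda>_. f B) B \<le> step W f B"
    using assms by (intro step_mono) (auto dest: monoD)
  then show ?thesis using assms by simp
qed

lemma steps_Suc: "steps W (Suc t) f = step W (steps W t f)"
  by simp

lemma steps_add_time: "steps W (s + t) f = steps W s (steps W t f)"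
  by (simp add: funpow_add)

lemma steps_const [simp]: "finite W \<Longrightarrow> steps W t (\<lambda>_. c) = (\<lambda>_. c)"
  by (induction t) simp_all

lemma steps_add: "steps W t (\<lambda>A. f A + g A) = (\<lambda>B. steps W t f B + steps W t g B)"
  by (induction t) (simp_all add: step_add)

lemma steps_diff: "steps W t (\<lambda>A. f A - g A) = (\<lambda>B. steps W t f B - steps W t g B)"
  by (induction t) (simp_all add: step_diff)

lemma steps_cmult: "steps W t (\<lambda>A. c * f A) = (\<lambda>B. c * steps W t f B)"
  by (induction t) (simp_all add: step_cmult)

lemma steps_sum: "steps W t (\<lambda>A. \<Sum>i\<in>I. f i A) = (\<lambda>B. \<Sum>i\<in>I. steps W t (f i) B)"
  by (induction t) (simp_all add: step_sum)

text \<open>Pointwise bounds are needed only on reachable configurations, which is how the presence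
  of seeds enters probability estimates.\<close>

lemma steps_mono_reach:
  assumes "finite W" "\<And>B'. reach B B' \<Longrightarrow> f B' \<le> g B'"
  shows "steps W t f B \<le> steps W t g B"
  using assms(2)
proof (induction t arbitrary: B)
  case 0
  then show ?case by (simp add: reach_refl)
next
  case (Suc t)
  show ?case unfolding steps_Suc
  proof (rule step_mono[OF assms(1)])
    fix B' assume "B \<subseteq> B'" "B' \<subseteq> T B"
    then have "reach B B'" by (auto intro: reach.intros)
    then show "steps W t f B' \<le> steps W t g B'"
      using Suc.prems reach_trans by (intro Suc.IH) blast
  qed
qed

lemma steps_mono: "finite W \<Longrightarrow> (\<And>A. f A \<le> g A) \<Longrightarrow> steps W t f B \<le> steps W t g B"
  by (rule steps_mono_reach)

lemma mono_steps: "finite W \<Longrightarrow> mono f \<Longrightarrow> mono (steps W t f)"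
  by (induction t) (simp_all add: mono_step)

lemma steps_time_mono:
  assumes "finite W" "mono f" "s \<le> t"
  shows "steps W s f B \<le> steps W t f B"
  using assms(3)
proof (induction t rule: dec_induct)
  case (step t)
  have "steps W t f B \<le> step W (steps W t f) B"
    using assms by (intro step_ge mono_steps)
  then show ?case using step.IH by simp
qed simp

text \<open>A site of \<open>square x r\<close> looks only \<open>radius\<close> away when it is
  updated, and the coins of all other sites are averaged out.\<close>

lemma depends_on_step:
  assumes fin: "finite W" and f: "depends_on f (square x r)"
  shows "depends_on (step W f) (square x (r + radius))"
  unfolding depends_on_def
proof (intro allI impI)
  fix B B' assume eq: "B \<inter> square x (r + radius) = B' \<inter> square x (r + radius)"
  have *: "step W f A = subset_mean (W \<inter> square x r) (prob A) (\<lambda>S. f ((A - W) \<union> S))" for A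
    unfolding step_def using fin by (intro subset_mean_restrict depends_onD[OF f]) auto
  have "subset_mean (W \<inter> square x r) (prob B) (\<lambda>S. f ((B - W) \<union> S)) =
        subset_mean (W \<inter> square x r) (prob B') (\<lambda>S. f ((B' - W) \<union> S))"
  proof (rule subset_mean_cong)
    fix y assume "y \<in> W \<inter> square x r"
    then have "square y radius \<subseteq> square x (r + radius)" using square_subset by blast
    then show "prob B y = prob B' y" using eq by (intro prob_local) blast
  next
    fix S assume "S \<subseteq> W \<inter> square x r"
    show "f (B - W \<union> S) = f (B' - W \<union> S)"
      using eq square_mono[of r "r + radius" x] by (intro depends_onD[OF f]) auto
  qed
  then show "step W f B = step W f B'" by (simp add: *)
qed

lemma depends_on_steps:
  assumes "finite W" "depends_on f (square x r)"
  shows "depends_on (steps W t f) (square x (r + radius * t))"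
proof (induction t)
  case (Suc t)
  then show ?case using depends_on_step[OF assms(1) Suc] by (simp add: algebra_simps)
qed (use assms in simp)

lemma step_local:
  assumes fin: "finite W" and f: "depends_on f F" and F: "F \<subseteq> W"
  shows "step W f B = subset_mean F (prob B) f"
proof -
  have "step W f B = subset_mean F (prob B) (\<lambda>S. f ((B - W) \<union> S))"
    unfolding step_def using fin F by (intro subset_mean_restrict depends_onD[OF f]) auto
  also have "\<dots> = subset_mean F (prob B) f"
    using F by (intro subset_mean_cong refl depends_onD[OF f]) auto
  finally show ?thesis .
qed

text \<open>Finite propagation speed: in \<open>t\<close> steps \<open>f\<close> sees only the
  square of radius \<open>r + radius * t\<close>, so the window beyond it is immaterial.\<close>

lemma steps_window:
  assumes "finite W" "finite W'" "depends_on f (square x r)"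
    and "square x (r + radius * t) \<subseteq> W" "square x (r + radius * t) \<subseteq> W'"
  shows "steps W t f = steps W' t f"
  using assms(4,5)
proof (induction t)
  case (Suc t)
  have sub: "square x (r + radius * t) \<subseteq> square x (r + radius * Suc t)"
    by (intro square_mono) simp
  then have IH: "steps W t f = steps W' t f" using Suc by (intro Suc.IH) auto
  have dep: "depends_on (steps W' t f) (square x (r + radius * t))"
    using assms by (intro depends_on_steps)
  have "step W (steps W' t f) B = step W' (steps W' t f) B" for B
    using step_local[OF _ dep, of W B] step_local[OF _ dep, of W' B] assms(1,2) sub Suc.prems by auto
  then have "step W (steps W' t f) = step W' (steps W' t f)" by (rule ext)
  then show ?case unfolding steps_Suc IH .
qed simp

lemma step_shift:
  "step ((+) z ` W) f ((+) z ` B) = step W (\<lambda>A. f ((+) z ` A)) B"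
proof -
  have 1: "(+) z ` B - (+) z ` W = (+) z ` (B - W)"
    by (rule image_set_diff[symmetric]) simp
  have 2: "prob ((+) z ` B) \<circ> (+) z = prob B"
    by (rule ext) (simp only: o_apply prob_shift)
  have 3: "inj ((+) z)" by simp
  show ?thesis
    unfolding step_def subset_mean_image[OF 3] 1 2 image_Un ..
qed

lemma steps_shift:
  "steps ((+) z ` W) t f ((+) z ` B) = steps W t (\<lambda>A. f ((+) z ` A)) B"
proof (induction t arbitrary: B)
  case (Suc t)
  show ?case unfolding steps_Suc step_shift Suc.IH ..
qed (simp only: funpow_0)

text \<open>The probability that \<open>x\<close> is occupied at time \<open>t\<close> by the growth started from \<open>B\<close>.\<close>
definition occ :: "nat \<Rightarrow> site \<Rightarrow> site set \<Rightarrow> real" where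
  "occ t x B = steps (square x (radius * t)) t (\<lambda>A. of_bool (x \<in> A)) B"

lemma mono_of_bool_member: "mono (\<lambda>A. of_bool (x \<in> A) :: real)"
  by (auto simp: mono_def)

lemma steps_occ:
  assumes "finite W" "square x (radius * t) \<subseteq> W"
  shows "steps W t (\<lambda>A. of_bool (x \<in> A)) = occ t x"
proof -
  have "steps W t (\<lambda>A. of_bool (x \<in> A) :: real) = steps (square x (radius * t)) t (\<lambda>A. of_bool (x \<in> A))"
    by (rule steps_window[of _ _ _ x 0]) (use assms in \<open>auto intro: depends_on_member\<close>)
  then show ?thesis unfolding occ_def by (rule trans) (rule ext, rule refl)
qed

lemma occ_bounds: "0 \<le> occ t x B" "occ t x B \<le> 1"
  using steps_mono[of "square x (radius * t)" "\<lambda>_. 0" "\<lambda>A. of_bool (x \<in> A)" t B]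
    steps_mono[of "square x (radius * t)" "\<lambda>A. of_bool (x \<in> A)" "\<lambda>_. 1" t B]
  by (auto simp: occ_def)

lemma occ_mono: "B \<subseteq> B' \<Longrightarrow> occ t x B \<le> occ t x B'"
  unfolding occ_def by (rule monoD[OF mono_steps]) (auto intro: mono_of_bool_member)

lemma occ_time_mono:
  assumes "s \<le> t" shows "occ s x B \<le> occ t x B"
proof -
  have "steps (square x (radius * t)) s (\<lambda>A. of_bool (x \<in> A)) = occ s x"
    by (rule steps_occ[OF finite_square]) (intro square_mono mult_le_mono2 assms)
  moreover have "steps (square x (radius * t)) s (\<lambda>A. of_bool (x \<in> A)) B
      \<le> steps (square x (radius * t)) t (\<lambda>A. of_bool (x \<in> A)) B"
    by (rule steps_time_mono[OF finite_square mono_of_bool_member assms])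
  ultimately show ?thesis
    unfolding occ_def[of t] by simp
qed

lemma occ_local: "depends_on (occ t x) (square x (radius * t))"
  using depends_on_steps[where W = "square x (radius * t)" and t = t,
      OF finite_square depends_on_member[OF centre_in_square, of x 0]]
  by (simp add: steps_occ[OF finite_square order_refl])

lemma occ_shift: "occ t (z + x) ((+) z ` B) = occ t x B"
proof -
  have "(\<lambda>A. of_bool (z + x \<in> (+) z ` A) :: real) = (\<lambda>A. of_bool (x \<in> A))"
    by (auto intro!: ext)
  then show ?thesis by (simp add: occ_def square_shift steps_shift)
qed

lemma occ_occupied: "x \<in> B \<Longrightarrow> occ t x B = 1"
  using occ_time_mono[of 0 t x B] occ_bounds(2)[of t x B] by (simp add: occ_def)

text \<open>Markov property at time \<open>s\<close>.\<close>

lemma occ_add: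
  assumes "finite W" "square x (radius * (s + t)) \<subseteq> W"
  shows "occ (s + t) x B = steps W s (occ t x) B"
proof -
  have "square x (radius * t) \<subseteq> square x (radius * (s + t))"
    by (intro square_mono) simp
  then have "square x (radius * t) \<subseteq> W" using assms(2) by blast
  then have "steps W t (\<lambda>A. of_bool (x \<in> A)) = occ t x"
    using assms by (intro steps_occ)
  then show ?thesis
    unfolding steps_occ[OF assms, symmetric] steps_add_time by metis
qed

section \<open>Spreading and concentration\<close>

lemma prob_lower_bound:
  obtains q where "0 < q" "q \<le> 1" "\<And>B x. prob B x > 0 \<Longrightarrow> q \<le> prob B x"
proof
  \<comment> \<open>Inserting \<open>1\<close> keeps the set nonempty and forces its minimum to be
    at most one.\<close>
  define P where "P = insert 1 {p \<in> \<pi> ` Pow N. p > 0}"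
  have fin: "finite P" "P \<noteq> {}" using finite_N by (auto simp: P_def)
  show "0 < Min P" using fin by (auto simp: P_def)
  show "Min P \<le> 1" using fin by (auto simp: P_def)
  fix B x assume "prob B x > 0"
  then have "prob B x \<in> P" by (auto simp: P_def prob_def local_config_def)
  then show "Min P \<le> prob B x" using fin by simp
qed

lemma T_subset: "T G \<subseteq> (\<lambda>(g, y). g - y) ` (G \<times> N)"
proof
  fix x assume "x \<in> T G"
  then obtain y where "y \<in> N" "x + y \<in> G" by (rule T_near)
  then show "x \<in> (\<lambda>(g, y). g - y) ` (G \<times> N)" by (intro image_eqI[of _ _ "(x + y, y)"]) auto
qed

lemma T_in_square:
  assumes "x \<in> T G" obtains g where "g \<in> G" "x \<in> square g radius"
proof -
  obtain y where y: "y \<in> N" "x + y \<in> G" using assms by (rule T_near)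
  have "(x + y) + - y \<in> square (x + y) radius"
    using uminus_N[OF y(1)] by (rule neighbour_in_square)
  then show ?thesis using that y by simp
qed

lemma finite_T: "finite G \<Longrightarrow> finite (T G)"
  using finite_subset[OF T_subset] finite_N by simp

lemma finite_T_pow: "finite G \<Longrightarrow> finite ((T ^^ i) G)"
  by (induction i) (simp_all add: finite_T)

lemma card_T_pow: "finite G \<Longrightarrow> card ((T ^^ i) G) \<le> card G * card N ^ i"
proof (induction i)
  case (Suc i)
  have fin: "finite ((T ^^ i) G)" using Suc.prems by (rule finite_T_pow)
  have "card ((T ^^ Suc i) G) \<le> card ((\<lambda>(g, y). g - y) ` ((T ^^ i) G \<times> N))"
    using T_subset[of "(T ^^ i) G"] fin finite_N by (intro card_mono) auto
  also have "\<dots> \<le> card ((T ^^ i) G \<times> N)"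
    using fin finite_N by (intro card_image_le) auto
  also have "\<dots> \<le> (card G * card N ^ i) * card N"
    using Suc by (simp add: card_cartesian_product)
  finally show ?case by (simp add: mult_ac)
qed simp

lemma T_pow_square: "G \<subseteq> square x r \<Longrightarrow> (T ^^ i) G \<subseteq> square x (r + i * radius)"
proof (induction i)
  case (Suc i)
  show ?case
  proof
    fix y assume "y \<in> (T ^^ Suc i) G"
    then have "y \<in> T ((T ^^ i) G)" by simp
    then obtain g where g: "g \<in> (T ^^ i) G" "y \<in> square g radius" by (rule T_in_square)
    then have "g \<in> square x (r + i * radius)" using Suc by blast
    then have "y \<in> square x (r + i * radius + radius)" using g(2) by (rule square_trans)
    then show "y \<in> square x (r + Suc i * radius)" by (simp add: algebra_simps)
  qed
qed simp

lemma finite_subset_T_pow: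
  assumes "finite F" "F \<subseteq> (\<Union>t. (T ^^ t) G)"
  shows "\<exists>t. F \<subseteq> (T ^^ t) G"
  using assms
proof (induction F rule: finite_induct)
  case (insert x F)
  then obtain s t where "F \<subseteq> (T ^^ s) G" "x \<in> (T ^^ t) G" by auto
  then have "insert x F \<subseteq> (T ^^ max s t) G"
    using T_pow_time_mono[of s "max s t" G] T_pow_time_mono[of t "max s t" G] by auto
  then show ?case ..
qed simp

section \<open>Seeds and their propagation\<close>

definition seeded :: "nat \<Rightarrow> site \<Rightarrow> site set \<Rightarrow> bool" where
  "seeded r x B \<longleftrightarrow> (\<exists>G \<subseteq> B. G \<subseteq> square x r \<and> fills_space T G)"

lemma seeded_mono: "seeded r x B \<Longrightarrow> B \<subseteq> B' \<Longrightarrow> seeded r x B'"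
  unfolding seeded_def by (meson order_trans)

text \<open>Up to translation a square has finitely many space-filling subsets, and each covers the
  target after finitely many steps; \<open>m\<close> exceeds the sum of these times. The target is a
  square of the same radius around a neighbour \<open>z\<close>, so that it can serve as the next
  seed.\<close>

lemma covering_time:
  obtains m where "m > 0"
    "\<And>x z G. G \<subseteq> square x r \<Longrightarrow> fills_space T G \<Longrightarrow> z \<in> square x 1 \<Longrightarrow> square z r \<subseteq> (T ^^ m) G"
proof -
  define \<G> where "\<G> = {G. G \<subseteq> square 0 r \<and> fills_space T G}"
  have fin: "finite \<G>"
    by (rule finite_subset[of _ "Pow (square 0 r)"]) (auto simp: \<G>_def)
  have "\<forall>G\<in>\<G>. \<exists>t. square 0 (1 + r) \<subseteq> (T ^^ t) G"
    by (auto simp: \<G>_def fills_space_def intro!: finite_subset_T_pow)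
  then obtain \<tau> where \<tau>: "\<And>G. G \<in> \<G> \<Longrightarrow> square 0 (1 + r) \<subseteq> (T ^^ \<tau> G) G"
    by metis
  define m where "m = Suc (\<Sum>G\<in>\<G>. \<tau> G)"
  have "square z r \<subseteq> (T ^^ m) G" if G: "G \<subseteq> square x r" "fills_space T G" and z: "z \<in> square x 1" for x z G
  proof -
    define G' where "G' = (+) (- x) ` G"
    have "G' \<subseteq> (+) (- x) ` square x r" using G(1) by (auto simp: G'_def)
    also have "\<dots> = square 0 r" using square_shift[of "- x" x r] by simp
    finally have G': "G' \<in> \<G>" using fills_space_shift[OF G(2), of "- x"] by (simp add: \<G>_def G'_def del: add_uminus_conv_diff)
    have "\<tau> G' \<le> m" unfolding m_def using fin G' by (intro le_SucI member_le_sum) auto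
    then have "square 0 (1 + r) \<subseteq> (T ^^ m) G'"
      using \<tau>[OF G'] T_pow_time_mono[of "\<tau> G'" m G'] by blast
    then have "(+) x ` square 0 (1 + r) \<subseteq> (+) x ` (T ^^ m) G'" by (rule image_mono)
    also have "\<dots> = (T ^^ m) G"
      unfolding T_pow_shift[symmetric] G'_def by (simp add: image_image)
    finally have "square x (1 + r) \<subseteq> (T ^^ m) G" by (simp flip: square_shift)
    then show ?thesis using square_subset[OF z, of r] by blast
  qed
  then show ?thesis using that[of m] by (auto simp: m_def)
qed

lemma depends_on_superset: "depends_on (\<lambda>A. of_bool (Y \<subseteq> A) :: real) Y"
proof -
  have "Y \<subseteq> A \<longleftrightarrow> A \<inter> Y = Y" for A by blast
  then show ?thesis unfolding depends_on_def by simp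
qed

lemma step_superset:
  assumes "finite W" "Y \<subseteq> W"
  shows "step W (\<lambda>A. of_bool (Y \<subseteq> A)) B = (\<Prod>x\<in>Y. prob B x)"
  unfolding step_local[OF assms(1) depends_on_superset assms(2)]
  using assms finite_subset by (intro subset_mean_superset) auto

text \<open>The random growth keeps up with \<open>T\<close> for \<open>m\<close> steps: once an
  iterate is occupied, the at most \<open>M\<close> sites of the next one are all occupied with
  probability at least \<open>q ^ M\<close>, by independence.\<close>

lemma steps_T_pow_lower_bound:
  assumes q: "0 < q" "q \<le> 1" "\<And>B x. prob B x > 0 \<Longrightarrow> q \<le> prob B x"
    and W: "finite W" "\<And>i. i \<le> m \<Longrightarrow> (T ^^ i) G \<subseteq> W \<and> card ((T ^^ i) G) \<le> M"
    and G: "G \<subseteq> B"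
  shows "(q ^ M) ^ m \<le> steps W m (\<lambda>A. of_bool ((T ^^ m) G \<subseteq> A)) B"
  using W(2) G
proof (induction m arbitrary: G B)
  case (Suc m)
  define f :: "site set \<Rightarrow> real" where "f = (\<lambda>A. of_bool ((T ^^ m) (T G) \<subseteq> A))"
  have TG: "T G \<subseteq> W" "card (T G) \<le> M" using Suc.prems(1)[of 1] by auto
  have IH: "(q ^ M) ^ m \<le> steps W m f B'" if "T G \<subseteq> B'" for B'
    unfolding f_def
  proof (rule Suc.IH[OF _ that])
    fix i assume "i \<le> m"
    then show "(T ^^ i) (T G) \<subseteq> W \<and> card ((T ^^ i) (T G)) \<le> M"
      using Suc.prems(1)[of "Suc i"] by (simp add: funpow_swap1)
  qed
  have f0: "0 \<le> steps W m f A" for A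
    using steps_mono[OF W(1), of "\<lambda>_. 0" f m A] W(1) by (auto simp: f_def)
  have "q ^ M \<le> q ^ card (T G)" using q TG by (intro power_decreasing) auto
  also have "\<dots> = (\<Prod>x\<in>T G. q)" by simp
  also have "\<dots> \<le> (\<Prod>x\<in>T G. prob B x)"
  proof (rule prod_mono)
    fix x assume "x \<in> T G"
    then have "x \<in> T B" using T_mono[OF Suc.prems(2)] by blast
    then show "0 \<le> q \<and> q \<le> prob B x" using q by (auto simp: T_iff)
  qed
  also have "\<dots> = step W (\<lambda>A. of_bool (T G \<subseteq> A)) B"
    using step_superset[OF W(1) TG(1)] by simp
  finally have "(q ^ M) ^ m * q ^ M \<le> (q ^ M) ^ m * step W (\<lambda>A. of_bool (T G \<subseteq> A)) B"
    using q by (intro mult_left_mono) auto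
  also have "\<dots> = step W (\<lambda>A. (q ^ M) ^ m * of_bool (T G \<subseteq> A)) B"
    by (simp only: step_cmult)
  also have "\<dots> \<le> step W (steps W m f) B"
    using W(1) IH f0 by (intro step_mono) auto
  finally show ?case by (simp add: f_def funpow_swap1 mult_ac)
qed simp

text \<open>Passes a seed to a neighbouring site in a fixed time with a fixed probability, uniformly
  in \<open>B\<close>, \<open>x\<close> and the window. The margin \<open>D\<close> leaves room for
  all iterates of \<open>T\<close> involved.\<close>

lemma seed_step:
  obtains m :: nat and q :: real and D :: nat where "m > 0" "0 < q" "q < 1"
    "\<And>W B x z. \<lbrakk>finite W; seeded r x B; z \<in> square x 1; square z D \<subseteq> W\<rbrakk>
      \<Longrightarrow> q \<le> steps W m (\<lambda>A. of_bool (square z r \<subseteq> A)) B"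
proof -
  obtain m where m: "m > 0"
    "\<And>x z G. G \<subseteq> square x r \<Longrightarrow> fills_space T G \<Longrightarrow> z \<in> square x 1 \<Longrightarrow> square z r \<subseteq> (T ^^ m) G"
    using covering_time[of r] by blast
  obtain q where q: "0 < q" "q \<le> 1" "\<And>B x. prob B x > 0 \<Longrightarrow> q \<le> prob B x"
    using prob_lower_bound by blast
  define M where "M = card (square (0::site) r) * card N ^ m"
  have cardN: "card N \<ge> 1" using zero_in_N finite_N by (metis One_nat_def Suc_leI card_gt_0_iff empty_iff)
  have main: "(q ^ M) ^ m \<le> steps W m (\<lambda>A. of_bool (square z r \<subseteq> A)) B"
    if W: "finite W" "seeded r x B" "z \<in> square x 1" "square z (1 + (r + m * radius)) \<subseteq> W" for W B x z
  proof -
    obtain G where G: "G \<subseteq> B" "G \<subseteq> square x r" "fills_space T G"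
      using W(2) unfolding seeded_def by blast
    have fin: "finite G" using G(2) finite_square by (rule finite_subset)
    have xz: "x \<in> square z 1" using W(3) by (auto simp: square_def)
    have "(q ^ M) ^ m \<le> steps W m (\<lambda>A. of_bool ((T ^^ m) G \<subseteq> A)) B"
    proof (rule steps_T_pow_lower_bound[OF q W(1) _ G(1)])
      fix i assume i: "i \<le> m"
      have "(T ^^ i) G \<subseteq> square x (r + i * radius)" by (rule T_pow_square[OF G(2)])
      also have "\<dots> \<subseteq> square x (r + m * radius)" using i by (intro square_mono) simp
      also have "\<dots> \<subseteq> W" using square_subset[OF xz] W(4) by blast
      finally have 1: "(T ^^ i) G \<subseteq> W" .
      have "card ((T ^^ i) G) \<le> card G * card N ^ i" by (rule card_T_pow[OF fin])
      also have "\<dots> \<le> card (square (0::site) r) * card N ^ m"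
      proof (rule mult_mono)
        have "card G \<le> card (square x r)" by (intro card_mono G(2) finite_square)
        then show "card G \<le> card (square (0::site) r)" by (simp add: card_square)
      qed (use i cardN in \<open>auto intro: power_increasing\<close>)
      finally show "(T ^^ i) G \<subseteq> W \<and> card ((T ^^ i) G) \<le> M" using 1 by (simp add: M_def)
    qed
    also have "\<dots> \<le> steps W m (\<lambda>A. of_bool (square z r \<subseteq> A)) B"
      using m(2)[OF G(2,3) W(3)] W(1) by (intro steps_mono) auto
    finally show ?thesis .
  qed
  \<comment> \<open>Halving yields a success probability strictly below one.\<close>
  have half: "(q ^ M) ^ m / 2 \<le> (q ^ M) ^ m" "(q ^ M) ^ m / 2 < 1" "0 < (q ^ M) ^ m / 2"
    using q power_le_one[of "q ^ M" m] power_le_one[of q M] by auto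
  show ?thesis
    by (rule that[OF m(1) half(3) half(2), of "1 + (r + m * radius)"], rule order_trans[OF half(1)], rule main)
qed

text \<open>Along a path of length \<open>n\<close> towards \<open>z\<close> seeds are passed on after geometric waiting times;
  the weight \<open>exp n\<close> turns this into a one-step contraction.\<close>
lemma spread:
  obtains m :: nat and \<rho> :: real where "m > 0" "0 < \<rho>" "\<rho> < 1"
    "\<And>B x z n k. \<lbrakk>seeded r x B; z \<in> square x n\<rbrakk>
      \<Longrightarrow> 1 - occ (m * k) z B \<le> exp (real n + 1) * \<rho> ^ k"
proof -
  obtain m q D where m: "m > 0" and q: "0 < q" "q < 1"
    and seed: "\<And>W B x z. \<lbrakk>finite W; seeded r x B; z \<in> square x 1; square z D \<subseteq> W\<rbrakk>
      \<Longrightarrow> q \<le> steps W m (\<lambda>A. of_bool (square z r \<subseteq> A)) B"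
    using seed_step[of r] by blast
  \<comment> \<open>An attempt succeeds with probability \<open>q\<close> and then shortens the path
    by one, dividing the weight by \<open>e\<close>; otherwise the weight is kept. The average
    factor is \<open>\<rho>\<close>.\<close>
  define \<rho> where "\<rho> = 1 - q + q * exp (- 1)"
  have \<rho>0: "0 < \<rho>" using q by (auto simp: \<rho>_def intro: add_pos_pos)
  have "q * exp (- 1) < q * 1" using q by (intro mult_strict_left_mono) auto
  then have \<rho>1: "\<rho> < 1" by (simp add: \<rho>_def)
  have main: "steps W (m * k) (\<lambda>A. of_bool (\<not> square z r \<subseteq> A)) B \<le> exp (real n + 1) * \<rho> ^ k"
    if "finite W" "seeded r x B" "z \<in> square x n" "square z (n + D) \<subseteq> W" for W B x z n k
    using that
  proof (induction k arbitrary: B x n)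
    case 0
    then show ?case by (auto simp: of_bool_def)
  next
    case (Suc k)
    define f :: "site set \<Rightarrow> real" where "f = (\<lambda>A. of_bool (\<not> square z r \<subseteq> A))"
    \<comment> \<open>One king's move towards \<open>z\<close>, or no move if \<open>x\<close> is
      already \<open>z\<close>.\<close>
    define x' where "x' = (fst x + sgn (fst z - fst x), snd x + sgn (snd z - snd x))"
    have x': "x' \<in> square x 1" "z \<in> square x' (n - 1)" "n = 0 \<Longrightarrow> x' = z"
      using Suc.prems(3) by (auto simp: square_def x'_def sgn_if prod_eq_iff split: if_splits)
    define a where "a = exp (real n + 1) * \<rho> ^ k"
    define b where "b = exp (real n) * \<rho> ^ k"
    have ba: "b = exp (- 1) * a" by (simp add: a_def b_def exp_add exp_minus)
    have ab: "0 \<le> b" "b \<le> a" using \<rho>0 by (auto simp: a_def b_def intro!: mult_right_mono)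
    \<comment> \<open>A failed attempt leaves the seed near \<open>x\<close> intact, as
      configurations only grow, so the bound \<open>a\<close> persists; a successful one improves it
      to \<open>b\<close>.\<close>
    have pw: "steps W (m * k) f B' \<le> a - (a - b) * of_bool (square x' r \<subseteq> B')" if "reach B B'" for B'
    proof (cases "square x' r \<subseteq> B'")
      case False
      have "seeded r x B'" using Suc.prems(2) reach_superset[OF that] by (rule seeded_mono)
      then show ?thesis using Suc.IH[of x B' n] Suc.prems False by (simp add: a_def f_def)
    next
      case True
      show ?thesis
      proof (cases "n = 0")
        \<comment> \<open>The final square is full and stays full, so failure has become
          impossible.\<close>
        case n: True
        have "steps W (m * k) f B' \<le> steps W (m * k) (\<lambda>_. 0) B'"
          unfolding f_def using True x'(3)[OF n] reach_superset
          by (intro steps_mono_reach[OF Suc.prems(1)]) auto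
        then show ?thesis using True ab Suc.prems(1) by simp
      next
        case n: False
        obtain G where "G \<subseteq> square x r" "fills_space T G" using Suc.prems(2) by (auto simp: seeded_def)
        then have "fills_space T (square x r)" using fills_space_mono by blast
        then have "fills_space T ((+) (x' - x) ` square x r)" by (rule fills_space_shift)
        then have "fills_space T (square x' r)" by (simp flip: square_shift)
        then have "seeded r x' B'" using True by (auto simp: seeded_def)
        moreover have "square z (n - 1 + D) \<subseteq> W"
          using Suc.prems(4) square_mono[of "n - 1 + D" "n + D" z] by auto
        ultimately have "steps W (m * k) f B' \<le> exp (real (n - 1) + 1) * \<rho> ^ k"
          unfolding f_def using x'(2) Suc.prems(1) by (intro Suc.IH)
        also have "\<dots> = b" using n by (simp add: b_def of_nat_diff)
        finally show ?thesis using True by simp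
      qed
    qed
    have "x' \<in> square z n" using x'(2,3) Suc.prems(3)
      by (cases "n = 0") (auto simp: square_def)
    then have "square x' D \<subseteq> W" using Suc.prems(4) square_subset by blast
    then have s: "q \<le> steps W m (\<lambda>A. of_bool (square x' r \<subseteq> A)) B"
      using Suc.prems x'(1) by (intro seed)
    have "steps W (m * Suc k) f B = steps W m (steps W (m * k) f) B"
      using steps_add_time[of m "m * k" W f] by simp
    also have "\<dots> \<le> steps W m (\<lambda>A. a - (a - b) * of_bool (square x' r \<subseteq> A)) B"
      using Suc.prems(1) pw by (intro steps_mono_reach)
    also have "\<dots> = a - (a - b) * steps W m (\<lambda>A. of_bool (square x' r \<subseteq> A)) B"
      using Suc.prems(1) by (simp only: steps_diff steps_cmult steps_const)
    also have "\<dots> \<le> a - (a - b) * q" using s ab by (simp add: mult_left_mono)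
    also have "\<dots> = exp (real n + 1) * \<rho> ^ Suc k"
      by (simp add: ba) (simp add: a_def \<rho>_def algebra_simps)
    finally show ?case by (simp add: f_def)
  qed
  have "1 - occ (m * k) z B \<le> exp (real n + 1) * \<rho> ^ k"
    if "seeded r x B" "z \<in> square x n" for B x z n k
  proof -
    define W where "W = square z (n + D + radius * (m * k))"
    have W: "finite W" "square z (n + D) \<subseteq> W" "square z (radius * (m * k)) \<subseteq> W"
      unfolding W_def by (rule finite_square, (rule square_mono, simp)+)
    have "1 - occ (m * k) z B = steps W (m * k) (\<lambda>A. 1 - of_bool (z \<in> A)) B"
      using W by (simp only: steps_diff steps_const steps_occ)
    also have "\<dots> \<le> steps W (m * k) (\<lambda>A. of_bool (\<not> square z r \<subseteq> A)) B"
    proof (rule steps_mono[OF W(1)])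
      fix A
      have "square z r \<subseteq> A \<Longrightarrow> z \<in> A" by (erule subsetD) simp
      then show "1 - of_bool (z \<in> A) \<le> (of_bool (\<not> square z r \<subseteq> A) :: real)" by auto
    qed
    also have "\<dots> \<le> exp (real n + 1) * \<rho> ^ k"
      using W that by (intro main)
    finally show ?thesis .
  qed
  then show ?thesis using that m \<rho>0 \<rho>1 by blast
qed

text \<open>Mean and exponential moment of \<open>min \<tau> s\<close>, where \<open>\<tau>\<close> is the time at which \<open>z\<close> gets occupied.\<close>
primrec mean_time :: "site set \<Rightarrow> site \<Rightarrow> nat \<Rightarrow> site set \<Rightarrow> real" where
  "mean_time W z 0 = (\<lambda>B. 0)"
| "mean_time W z (Suc s) = (\<lambda>B. if z \<in> B then 0 else 1 + step W (mean_time W z s) B)"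

primrec exp_time :: "real \<Rightarrow> site set \<Rightarrow> site \<Rightarrow> nat \<Rightarrow> site set \<Rightarrow> real" where
  "exp_time l W z 0 = (\<lambda>B. 1)"
| "exp_time l W z (Suc s) = (\<lambda>B. if z \<in> B then 1 else exp l * step W (exp_time l W z s) B)"

context
  fixes W :: "site set" and z :: site
  assumes W: "finite W"
begin

lemma mean_time_bounds: "0 \<le> mean_time W z s B" "mean_time W z s B \<le> real s"
proof -
  have "0 \<le> mean_time W z s B \<and> mean_time W z s B \<le> real s"
  proof (induction s arbitrary: B)
    case (Suc s)
    have "step W (\<lambda>_. 0) B \<le> step W (mean_time W z s) B"
      "step W (mean_time W z s) B \<le> step W (\<lambda>_. real s) B"
      using W Suc by (intro step_mono; simp)+
    then show ?case using W by simp
  qed simp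
  then show "0 \<le> mean_time W z s B" "mean_time W z s B \<le> real s" by simp_all
qed

lemma mean_time_occupied: "z \<in> B \<Longrightarrow> mean_time W z s B = 0"
  by (cases s) simp_all

lemma mean_time_antimono: "B \<subseteq> B' \<Longrightarrow> mean_time W z s B' \<le> mean_time W z s B"
proof (induction s arbitrary: B B')
  case (Suc s)
  show ?case
  proof (cases "z \<in> B'")
    case True
    then show ?thesis using mean_time_occupied[OF True] mean_time_bounds(1)[of "Suc s" B] by metis
  next
    case False
    have "mono (\<lambda>A. - mean_time W z s A)" using Suc.IH by (auto intro!: monoI)
    from step_mono_set[OF W this Suc.prems]
    have "step W (mean_time W z s) B' \<le> step W (mean_time W z s) B"
      using step_cmult[of W "- 1" "mean_time W z s"] by simp
    then show ?thesis using False Suc.prems by auto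
  qed
qed simp

lemma mean_time_Suc: "mean_time W z s B \<le> mean_time W z (Suc s) B"
proof (induction s arbitrary: B)
  case 0
  then show ?case using mean_time_bounds(1)[of "Suc 0" B] by simp
next
  case (Suc s)
  have "step W (mean_time W z s) B \<le> step W (mean_time W z (Suc s)) B"
    using W Suc by (intro step_mono)
  then show ?case by simp
qed

lemma mean_time_mono: "s \<le> t \<Longrightarrow> mean_time W z s B \<le> mean_time W z t B"
  by (rule lift_Suc_mono_le[of "\<lambda>s. mean_time W z s B"]) (rule mean_time_Suc)

text \<open>Letting \<open>d\<close> steps pass before looking costs at most \<open>d\<close>; this
  gives a configuration time to catch up with a larger one.\<close>

lemma mean_time_restart: "mean_time W z (d + s) B \<le> real d + steps W d (mean_time W z s) B"
proof (induction d arbitrary: B)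
  case (Suc d)
  have "step W (mean_time W z (d + s)) B \<le> step W (\<lambda>A. real d + steps W d (mean_time W z s) A) B"
    using W Suc by (intro step_mono)
  also have "\<dots> = real d + step W (steps W d (mean_time W z s)) B"
    using W by (simp only: step_add step_const)
  finally have 1: "step W (mean_time W z (d + s)) B \<le> real d + steps W (Suc d) (mean_time W z s) B"
    by simp
  have "steps W (Suc d) (\<lambda>_. 0) B \<le> steps W (Suc d) (mean_time W z s) B"
    using W mean_time_bounds by (intro steps_mono)
  then have "0 \<le> steps W (Suc d) (mean_time W z s) B" by (simp only: steps_const[OF W])
  then show ?case using 1 by (simp del: funpow.simps)
qed simp

lemma depends_on_mean_time: "depends_on (mean_time W z s) (square z (radius * s))"
proof (induction s)
  case (Suc s)
  have d: "depends_on (step W (mean_time W z s)) (square z (radius * Suc s))"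
    using depends_on_step[OF W Suc] by (simp add: algebra_simps)
  show ?case unfolding depends_on_def
  proof (intro allI impI)
    fix A B assume e: "A \<inter> square z (radius * Suc s) = B \<inter> square z (radius * Suc s)"
    have "z \<in> A \<longleftrightarrow> z \<in> B" using e centre_in_square[of z "radius * Suc s"] by blast
    then show "mean_time W z (Suc s) A = mean_time W z (Suc s) B"
      using depends_onD[OF d e] by simp
  qed
qed (simp add: depends_on_def)

text \<open>Exponential Chebyshev for the upper tail: if \<open>z\<close> is vacant after
  \<open>s\<close> steps, the truncated time equals \<open>s\<close>.\<close>

lemma exp_time_ge_pos:
  assumes "0 \<le> l"
  shows "exp (l * real s) * (1 - steps W s (\<lambda>A. of_bool (z \<in> A)) B) \<le> exp_time l W z s B"
proof (induction s arbitrary: B)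
  case (Suc s)
  define f :: "site set \<Rightarrow> real" where "f = (\<lambda>A. of_bool (z \<in> A))"
  have "step W (\<lambda>A. exp (l * real s) * (1 - steps W s f A)) B \<le> step W (exp_time l W z s) B"
    by (intro step_mono) (use W Suc in \<open>auto simp: f_def\<close>)
  also have "step W (\<lambda>A. exp (l * real s) * (1 - steps W s f A)) B
      = exp (l * real s) * (1 - steps W (Suc s) f B)"
    using W by (simp only: step_cmult step_diff step_const steps_Suc)
  finally have 1: "exp l * (exp (l * real s) * (1 - steps W (Suc s) f B)) \<le> exp l * step W (exp_time l W z s) B"
    by (intro mult_left_mono) auto
  show ?case
  proof (cases "z \<in> B")
    case True
    have "f B \<le> steps W (Suc s) f B"
      using steps_time_mono[OF W, of f 0 "Suc s" B] by (simp add: f_def mono_of_bool_member)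
    then have "exp (l * real (Suc s)) * (1 - steps W (Suc s) f B) \<le> 0"
      using True by (intro mult_nonneg_nonpos) (auto simp: f_def)
    moreover have "exp_time l W z (Suc s) B = 1" using True by simp
    ultimately show ?thesis unfolding f_def by linarith
  next
    case False
    then show ?thesis using 1
      by (simp add: f_def exp_add algebra_simps del: funpow.simps)
  qed
qed (auto simp: of_bool_def)

text \<open>Lower tail, with a nonpositive parameter: if \<open>z\<close> is occupied by time
  \<open>k\<close>, the truncated time is at most \<open>k\<close>.\<close>

lemma exp_time_ge_neg:
  assumes "l \<le> 0" "k \<le> s"
  shows "exp (l * real k) * steps W k (\<lambda>A. of_bool (z \<in> A)) B \<le> exp_time l W z s B"
  using assms(2)
proof (induction s arbitrary: k B)
  case (Suc s)
  define f :: "site set \<Rightarrow> real" where "f = (\<lambda>A. of_bool (z \<in> A))"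
  have f1: "steps W j f A \<le> 1" for j A
    using steps_mono[OF W, of f "\<lambda>_. 1" j A] W by (simp add: f_def)
  have f0: "0 \<le> steps W j f A" for j A
    using steps_mono[OF W, of "\<lambda>_. 0" f j A] W by (simp add: f_def)
  have exp1: "exp (l * real k) \<le> 1" using assms(1) by (simp add: mult_nonpos_nonneg)
  have e0: "0 \<le> exp_time l W z s A" for A
    using Suc.IH[of 0 A] by (rule order_trans[rotated]) auto
  show ?case
  proof (cases "z \<in> B")
    case True
    then show ?thesis using mult_le_one[OF exp1 f0 f1, of k B] by (simp add: f_def)
  next
    case z: False
    have "step W (\<lambda>_. 0) B \<le> step W (exp_time l W z s) B" using W e0 by (intro step_mono)
    then have s0: "0 \<le> step W (exp_time l W z s) B" using W by simp
    show ?thesis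
    proof (cases k)
      case 0
      then show ?thesis using z s0 by simp
    next
      case (Suc j)
      then have "step W (\<lambda>A. exp (l * real j) * steps W j f A) B \<le> step W (exp_time l W z s) B"
        using W Suc.prems Suc.IH[of j] by (intro step_mono) (auto simp: f_def)
      then have "exp (l * real j) * steps W k f B \<le> step W (exp_time l W z s) B"
        unfolding Suc by (simp add: step_cmult)
      then have "exp l * (exp (l * real j) * steps W k f B) \<le> exp l * step W (exp_time l W z s) B"
        by (intro mult_left_mono) auto
      then show ?thesis using z Suc
        by (simp add: f_def exp_add algebra_simps del: funpow.simps)
    qed
  qed
qed auto

lemma step_exp_le:
  assumes "\<And>B'. B \<subseteq> B' \<Longrightarrow> B' \<subseteq> T B \<Longrightarrow> a \<le> f B' \<and> f B' \<le> a + D" and l: "\<bar>l\<bar> * D \<le> 1"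
  shows "step W (\<lambda>A. exp (l * f A)) B \<le> exp (l * step W f B + l\<^sup>2 * D\<^sup>2)"
  unfolding step_def
proof (rule subset_mean_exp_le[OF W])
  fix S assume S: "S \<subseteq> W" "\<And>x. x \<in> S \<Longrightarrow> prob B x > 0" "\<And>x. \<lbrakk>x \<in> W; prob B x = 1\<rbrakk> \<Longrightarrow> x \<in> S"
  show "a \<le> f (B - W \<union> S) \<and> f (B - W \<union> S) \<le> a + D"
  proof (rule assms(1))
    show "B \<subseteq> B - W \<union> S" using S(3) prob_occupied by blast
    show "B - W \<union> S \<subseteq> T B" using S(2) T_extensive by (auto simp: T_iff[symmetric])
  qed
qed (use prob_bounds l in auto)

text \<open>Azuma's induction in backward form: elapsed time plus expected remaining time is a
  martingale whose increments lie in an interval of length \<open>D\<close>, so each step costs a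
  factor \<open>exp (l^2 * D^2)\<close>.\<close>

lemma exp_time_le:
  assumes range: "\<And>s B B'. \<lbrakk>s \<le> S; reach B0 B; B \<subseteq> B'; B' \<subseteq> T B\<rbrakk>
      \<Longrightarrow> mean_time W z s B \<le> mean_time W z s B' + D"
    and l: "\<bar>l\<bar> * D \<le> 1"
    and "s \<le> S" "reach B0 B"
  shows "exp_time l W z s B \<le> exp (l * mean_time W z s B + real s * (l\<^sup>2 * D\<^sup>2))"
  using assms(3,4)
proof (induction s arbitrary: B)
  case (Suc s)
  define c where "c = l\<^sup>2 * D\<^sup>2"
  have c: "0 \<le> c" by (simp add: c_def)
  show ?case
  proof (cases "z \<in> B")
    case True
    then show ?thesis using c by (simp flip: c_def)
  next
    case False
    have "step W (exp_time l W z s) B \<le> step W (\<lambda>A. exp (real s * c) * exp (l * mean_time W z s A)) B"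
    proof (rule step_mono[OF W])
      fix B' assume "B \<subseteq> B'" "B' \<subseteq> T B"
      then have "reach B0 B'" using Suc.prems reach_step by blast
      then show "exp_time l W z s B' \<le> exp (real s * c) * exp (l * mean_time W z s B')"
        using Suc.IH[of B'] Suc.prems by (simp add: c_def exp_add mult.commute)
    qed
    also have "\<dots> = exp (real s * c) * step W (\<lambda>A. exp (l * mean_time W z s A)) B"
      by (simp only: step_cmult)
    also have "\<dots> \<le> exp (real s * c) * exp (l * step W (mean_time W z s) B + c)"
      unfolding c_def
    \<comment> \<open>Antimonotonicity bounds the remaining time after the update from above,
      \<open>range\<close> bounds it from below.\<close>
    proof (intro mult_left_mono step_exp_le[where a = "mean_time W z s B - D"] l conjI)
      fix B' assume B': "B \<subseteq> B'" "B' \<subseteq> T B"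
      show "mean_time W z s B - D \<le> mean_time W z s B'"
        using range[of s B B'] Suc.prems B' by simp
      show "mean_time W z s B' \<le> mean_time W z s B - D + D"
        using mean_time_antimono[OF B'(1)] by simp
    qed simp
    finally have "exp l * step W (exp_time l W z s) B
        \<le> exp l * (exp (real s * c) * exp (l * step W (mean_time W z s) B + c))"
      by (intro mult_left_mono) auto
    also have "\<dots> = exp (l * (1 + step W (mean_time W z s) B) + real (Suc s) * c)"
      by (simp add: algebra_simps flip: exp_add)
    finally show ?thesis using False by (simp add: c_def)
  qed
qed simp

end

text \<open>Azuma's inequality for the occupation time of \<open>z\<close>. Revealing one more step of the dynamics
  changes the expected time by at most \<open>D\<close>: by spreading, after \<open>d = m * k\<close> steps everything
  that could have been added at once is occupied. Multiplying the bounds on the two tails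
  eliminates the unknown mean.\<close>
lemma concentration:
  assumes seeded: "\<And>B x. reach B0 B \<Longrightarrow> x \<in> B \<Longrightarrow> seeded r x B"
    and spread: "\<And>B x z n k. \<lbrakk>seeded r x B; z \<in> square x n\<rbrakk>
      \<Longrightarrow> 1 - occ (m * k) z B \<le> exp (real n + 1) * \<rho> ^ k"
    and \<rho>: "0 \<le> \<rho>"
    and D: "real (m * k) + real S * (2 * real (radius * S) + 1)\<^sup>2 * (exp (real radius + 1) * \<rho> ^ k) \<le> D"
    and l: "0 \<le> l" "l * D \<le> 1" and "L \<le> S"
  shows "occ L z B0 * (1 - occ S z B0) \<le> exp (2 * real S * l\<^sup>2 * D\<^sup>2 - l * (real S - real L))"
proof -
  define d where "d = m * k"
  define W where "W = square z (radius * (S + d))"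
  have W: "finite W" by (simp add: W_def)
  define \<eta> where "\<eta> = exp (real radius + 1) * \<rho> ^ k"
  have \<eta>0: "0 \<le> \<eta>" using \<rho> by (simp add: \<eta>_def)
  \<comment> \<open>Growth from \<open>B\<close> gets \<open>d\<close> steps to catch up. If it then
    covers the part of \<open>B'\<close> visible from \<open>z\<close> within \<open>s\<close>
    steps, it does at least as well as \<open>B'\<close>; otherwise the remaining time is at most
    \<open>s\<close>, and a union bound over missing sites weights this loss.\<close>
  have diff: "mean_time W z s B \<le> mean_time W z s B' + D"
    if s: "s \<le> S" and B: "reach B0 B" "B \<subseteq> B'" "B' \<subseteq> T B" for s B B'
  proof -
    define Q where "Q = square z (radius * s)"
    have finQ: "finite (Q \<inter> B')" by (simp add: Q_def)
    have "mean_time W z s B \<le> mean_time W z (d + s) B" using W by (intro mean_time_mono) auto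
    also have "\<dots> \<le> real d + steps W d (mean_time W z s) B" using W by (rule mean_time_restart)
    also have "steps W d (mean_time W z s) B
        \<le> steps W d (\<lambda>A. mean_time W z s B' + real s * (\<Sum>y\<in>Q \<inter> B'. 1 - of_bool (y \<in> A))) B"
    proof (rule steps_mono_reach[OF W])
      fix A assume "reach B A"
      show "mean_time W z s A \<le> mean_time W z s B' + real s * (\<Sum>y\<in>Q \<inter> B'. 1 - of_bool (y \<in> A))"
      proof (cases "Q \<inter> B' \<subseteq> A")
        case True
        then have "A \<inter> Q = (A \<union> B') \<inter> Q" by blast
        then have "mean_time W z s A = mean_time W z s (A \<union> B')"
          unfolding Q_def by (rule depends_onD[OF depends_on_mean_time[OF W]])
        also have "\<dots> \<le> mean_time W z s B'" using W by (intro mean_time_antimono) auto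
        also have "\<dots> \<le> mean_time W z s B' + real s * (\<Sum>y\<in>Q \<inter> B'. 1 - of_bool (y \<in> A))"
          by (simp add: sum_nonneg)
        finally show ?thesis .
      next
        case False
        then obtain y where y: "y \<in> Q \<inter> B'" "y \<notin> A" by blast
        have "(1::real) = 1 - of_bool (y \<in> A)" using y by simp
        also have "\<dots> \<le> (\<Sum>y\<in>Q \<inter> B'. 1 - of_bool (y \<in> A))"
          using finQ y by (intro member_le_sum[where f = "\<lambda>y. 1 - of_bool (y \<in> A)"]) auto
        finally have "real s * 1 \<le> real s * (\<Sum>y\<in>Q \<inter> B'. 1 - of_bool (y \<in> A))"
          by (intro mult_left_mono) auto
        then show ?thesis using mean_time_bounds[OF W, where z=z and s=s] by (smt (verit))
      qed
    qed
    also have "\<dots> = mean_time W z s B' + real s * (\<Sum>y\<in>Q \<inter> B'. 1 - steps W d (\<lambda>A. of_bool (y \<in> A)) B)"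
      by (simp only: steps_add steps_cmult steps_sum steps_diff steps_const[OF W])
    also have "(\<Sum>y\<in>Q \<inter> B'. 1 - steps W d (\<lambda>A. of_bool (y \<in> A)) B) \<le> (\<Sum>y\<in>Q \<inter> B'. \<eta>)"
    proof (rule sum_mono)
      fix y assume y: "y \<in> Q \<inter> B'"
      then have "square y (radius * d) \<subseteq> square z (radius * s + radius * d)"
        unfolding Q_def by (intro square_subset) auto
      also have "\<dots> \<subseteq> W" unfolding W_def using s by (intro square_mono) (simp add: algebra_simps)
      finally have "steps W d (\<lambda>A. of_bool (y \<in> A)) = occ d y" by (rule steps_occ[OF W])
      \<comment> \<open>Every site of \<open>B'\<close> lies within range of an occupied site of
        \<open>B\<close>, and that site is seeded.\<close>
      moreover have "y \<in> T B" using y B(3) by blast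
      then obtain g where "g \<in> B" "y \<in> square g radius" by (rule T_in_square)
      then have "1 - occ d y B \<le> \<eta>" unfolding d_def \<eta>_def using seeded[OF B(1)] by (intro spread)
      ultimately show "1 - steps W d (\<lambda>A. of_bool (y \<in> A)) B \<le> \<eta>" by simp
    qed
    also have "(\<Sum>y\<in>Q \<inter> B'. \<eta>) \<le> (2 * real (radius * S) + 1)\<^sup>2 * \<eta>"
    proof -
      have "card (Q \<inter> B') \<le> card (square z (radius * S))"
        using s by (intro card_mono finite_square) (auto simp: Q_def intro: square_mono[THEN subsetD, rotated])
      then have "real (card (Q \<inter> B')) \<le> real ((2 * (radius * S) + 1)\<^sup>2)"
        by (simp only: card_square of_nat_le_iff)
      then have "real (card (Q \<inter> B')) \<le> (2 * real (radius * S) + 1)\<^sup>2" by (simp add: add.commute)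
      from mult_right_mono[OF this \<eta>0] show ?thesis by simp
    qed
    finally have "mean_time W z s B
        \<le> real d + (mean_time W z s B' + real s * ((2 * real (radius * S) + 1)\<^sup>2 * \<eta>))"
      by (simp add: mult_left_mono)
    also have "real s * ((2 * real (radius * S) + 1)\<^sup>2 * \<eta>) \<le> real S * ((2 * real (radius * S) + 1)\<^sup>2 * \<eta>)"
      using s \<eta>0 by (intro mult_right_mono) auto
    finally show ?thesis using D by (simp add: d_def \<eta>_def mult.assoc)
  qed
  have sub: "square z (radius * t) \<subseteq> W" if "t \<le> S + d" for t
    unfolding W_def by (rule square_mono[OF mult_le_mono2[OF that]])
  have occS: "steps W S (\<lambda>A. of_bool (z \<in> A)) = occ S z"
    by (rule steps_occ[OF W sub]) simp
  have occL: "steps W L (\<lambda>A. of_bool (z \<in> A)) = occ L z"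
    by (rule steps_occ[OF W sub]) (use \<open>L \<le> S\<close> in simp)
  have le: "exp_time l' W z S B0 \<le> exp (l' * mean_time W z S B0 + real S * (l\<^sup>2 * D\<^sup>2))"
    if "\<bar>l'\<bar> = l" for l'
  proof -
    have "\<bar>l'\<bar> * D \<le> 1" using that l(2) by simp
    then have "exp_time l' W z S B0 \<le> exp (l' * mean_time W z S B0 + real S * (l'\<^sup>2 * D\<^sup>2))"
      by (intro exp_time_le[OF W diff _ order_refl reach_refl])
    moreover have "l'\<^sup>2 = l\<^sup>2" using that by (metis power2_abs)
    ultimately show ?thesis by simp
  qed
  have up: "exp (l * real S) * (1 - occ S z B0) \<le> exp (l * mean_time W z S B0 + real S * (l\<^sup>2 * D\<^sup>2))"
    using exp_time_ge_pos[OF W l(1), of S z B0] le[of l] l by (simp add: occS)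
  have lo: "exp (- l * real L) * occ L z B0 \<le> exp (- l * mean_time W z S B0 + real S * (l\<^sup>2 * D\<^sup>2))"
    using exp_time_ge_neg[OF W, of "- l" L S z B0] le[of "- l"] l \<open>L \<le> S\<close> by (simp add: occL)
  have "(exp (- l * real L) * occ L z B0) * (exp (l * real S) * (1 - occ S z B0))
    \<le> exp (- l * mean_time W z S B0 + real S * (l\<^sup>2 * D\<^sup>2)) * exp (l * mean_time W z S B0 + real S * (l\<^sup>2 * D\<^sup>2))"
    using up lo occ_bounds[of L z B0] occ_bounds[of S z B0] by (intro mult_mono) auto
  also have "\<dots> = exp (2 * real S * l\<^sup>2 * D\<^sup>2)"
    by (simp flip: exp_add)
  also have "(exp (- l * real L) * occ L z B0) * (exp (l * real S) * (1 - occ S z B0))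
      = (exp (- l * real L) * exp (l * real S)) * (occ L z B0 * (1 - occ S z B0))"
    by (simp only: mult_ac)
  also have "exp (- l * real L) * exp (l * real S) = exp (l * (real S - real L))"
    by (simp add: algebra_simps flip: exp_add)
  finally have "exp (l * (real S - real L)) * (occ L z B0 * (1 - occ S z B0)) \<le> exp (2 * real S * l\<^sup>2 * D\<^sup>2)" .
  then show ?thesis
    by (simp add: exp_diff pos_le_divide_eq mult.commute)
qed

section \<open>The law of a growth process\<close>

context
  fixes A0 :: "site set" and M :: "'w measure" and A :: "nat \<Rightarrow> 'w \<Rightarrow> site set"
  assumes process: "growth_process N \<pi> A0 M A"
begin

lemma process_prob_space: "prob_space M"
  using process by (simp add: growth_process_def)

lemma process_events: "{\<omega> \<in> space M. x \<in> A t \<omega>} \<in> sets M"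
  using process unfolding growth_process_def by blast

lemma measurable_process:
  assumes "finite F" "depends_on f F"
  shows "(\<lambda>\<omega>. f (A t \<omega>) :: real) \<in> borel_measurable M"
proof -
  have "(\<lambda>\<omega>. of_bool (x \<in> A t \<omega>) :: real) \<in> borel_measurable M" for x
  proof -
    have "(\<lambda>\<omega>. indicator {\<omega> \<in> space M. x \<in> A t \<omega>} \<omega> :: real) \<in> borel_measurable M"
      using process_events by simp
    then show ?thesis
      by (rule measurable_cong[THEN iffD1, rotated]) (simp add: indicator_def)
  qed
  then have "(\<lambda>\<omega>. subset_mean F (\<lambda>x. of_bool (x \<in> A t \<omega>)) f) \<in> borel_measurable M"
    by (rule measurable_subset_mean)
  then show ?thesis unfolding depends_on_eq_subset_mean[OF assms, symmetric] .
qed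

lemma integrable_process:
  assumes "finite F" "depends_on f F"
  shows "integrable M (\<lambda>\<omega>. f (A t \<omega>) :: real)"
proof -
  interpret P: prob_space M by (rule process_prob_space)
  have "\<bar>f B\<bar> \<le> Max ((\<lambda>S. \<bar>f S\<bar>) ` Pow F)" for B
  proof -
    have "f B = f (B \<inter> F)" by (rule depends_onD[OF assms(2)]) blast
    then show ?thesis using assms(1) by (intro Max_ge) auto
  qed
  then show ?thesis
    by (intro P.integrable_const_bound[where B = "Max ((\<lambda>S. \<bar>f S\<bar>) ` Pow F)"] measurable_process[OF assms]) auto
qed

text \<open>The expectation of the conditional product formula, which removes the history.\<close>

lemma process_superset:
  assumes "finite F"
  shows "(\<integral>\<omega>. of_bool (F \<subseteq> A (Suc t) \<omega>) \<partial>M) = (\<integral>\<omega>. (\<Prod>x\<in>F. prob (A t \<omega>) x) \<partial>M)"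
proof -
  interpret P: prob_space M by (rule process_prob_space)
  define E where "E = {\<omega> \<in> space M. F \<subseteq> A (Suc t) \<omega>}"
  have E: "E \<in> sets M"
  proof -
    have "E = {\<omega> \<in> space M. \<forall>x\<in>F. \<omega> \<in> {\<omega> \<in> space M. x \<in> A (Suc t) \<omega>}}" by (auto simp: E_def)
    also have "\<dots> \<in> sets M" using assms process_events by (intro sets.sets_Collect_finite_All) auto
    finally show ?thesis .
  qed
  have sub: "subalgebra M (history M A t)"
  proof -
    have "{{\<omega> \<in> space M. x \<in> A s \<omega>} |s x. s \<le> t} \<subseteq> sets M" using process_events by auto
    moreover from this have "{{\<omega> \<in> space M. x \<in> A s \<omega>} |s x. s \<le> t} \<subseteq> Pow (space M)"
      using sets.space_closed by blast
    ultimately show ?thesis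
      unfolding subalgebra_def history_def by (simp add: sets.sigma_sets_subset)
  qed
  interpret C: finite_measure_subalgebra M "history M A t" by standard (rule sub)
  have "(\<integral>\<omega>. of_bool (F \<subseteq> A (Suc t) \<omega>) \<partial>M) = (\<integral>\<omega>. indicat_real E \<omega> \<partial>M)"
    by (rule Bochner_Integration.integral_cong) (auto simp: E_def indicator_def)
  also have "\<dots> = (\<integral>\<omega>. real_cond_exp M (history M A t) (indicat_real E) \<omega> \<partial>M)"
    by (rule C.real_cond_exp_int(2)[symmetric]) (use E in \<open>simp add: integrable_real_indicator P.emeasure_eq_measure\<close>)
  also have "\<dots> = (\<integral>\<omega>. (\<Prod>x\<in>F. prob (A t \<omega>) x) \<partial>M)"
  proof (rule integral_cong_AE)
    show "AE \<omega> in M. real_cond_exp M (history M A t) (indicat_real E) \<omega> = (\<Prod>x\<in>F. prob (A t \<omega>) x)"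
      using process assms unfolding growth_process_def E_def prob_def by blast
    have "depends_on (\<lambda>B. prob B x) (square x radius)" for x
      unfolding depends_on_def using prob_local by blast
    then show "(\<lambda>\<omega>. \<Prod>x\<in>F. prob (A t \<omega>) x) \<in> borel_measurable M"
      by (intro borel_measurable_prod measurable_process[where F = "square x radius" for x]) auto
  qed (rule borel_measurable_cond_exp2)
  finally show ?thesis .
qed

lemma depends_on_prod_prob:
  "depends_on (\<lambda>B. (\<Prod>x\<in>P. prob B x) * (\<Prod>x\<in>Q. 1 - prob B x)) (\<Union>x\<in>P \<union> Q. square x radius)"
  unfolding depends_on_def
proof (intro allI impI)
  fix B B' assume e: "B \<inter> (\<Union>x\<in>P \<union> Q. square x radius) = B' \<inter> (\<Union>x\<in>P \<union> Q. square x radius)"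
  have "prob B x = prob B' x" if "x \<in> P \<union> Q" for x
    by (rule prob_local) (use e that in blast)
  then show "(\<Prod>x\<in>P. prob B x) * (\<Prod>x\<in>Q. 1 - prob B x) = (\<Prod>x\<in>P. prob B' x) * (\<Prod>x\<in>Q. 1 - prob B' x)"
    by (intro arg_cong2[where f = "(*)"] prod.cong) auto
qed

lemma depends_on_prod_member:
  "depends_on (\<lambda>B. (\<Prod>x\<in>P. of_bool (x \<in> B)) * (\<Prod>x\<in>Q. 1 - of_bool (x \<in> B)) :: real) (P \<union> Q)"
  unfolding depends_on_def
proof (intro allI impI)
  fix B B' :: "site set" assume e: "B \<inter> (P \<union> Q) = B' \<inter> (P \<union> Q)"
  have "x \<in> B \<longleftrightarrow> x \<in> B'" if "x \<in> P \<union> Q" for x using e that by blast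
  then show "(\<Prod>x\<in>P. of_bool (x \<in> B)) * (\<Prod>x\<in>Q. 1 - of_bool (x \<in> B))
      = (\<Prod>x\<in>P. of_bool (x \<in> B')) * (\<Prod>x\<in>Q. 1 - of_bool (x \<in> B') :: real)"
    by (intro arg_cong2[where f = "(*)"] prod.cong) auto
qed

text \<open>The definition of the process prescribes only joint occupation. Vacancies are added one
  site at a time, by inclusion-exclusion: a vacancy indicator is one minus an occupation
  indicator.\<close>

lemma process_weight:
  assumes "finite P" "finite Q" "P \<inter> Q = {}"
  shows "(\<integral>\<omega>. (\<Prod>x\<in>P. of_bool (x \<in> A (Suc t) \<omega>)) * (\<Prod>x\<in>Q. 1 - of_bool (x \<in> A (Suc t) \<omega>)) \<partial>M)
    = (\<integral>\<omega>. (\<Prod>x\<in>P. prob (A t \<omega>) x) * (\<Prod>x\<in>Q. 1 - prob (A t \<omega>) x) \<partial>M)"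
  using assms(2,1,3)
proof (induction Q arbitrary: P rule: finite_induct)
  case empty
  have "(\<Prod>x\<in>P. of_bool (x \<in> B) :: real) = of_bool (P \<subseteq> B)" for B :: "site set"
    using empty(1) by (induction P rule: finite_induct) auto
  then show ?case using process_superset[OF empty(1), of t] by simp
next
  case (insert q Q)
  let ?a = "\<lambda>P \<omega>. (\<Prod>x\<in>P. of_bool (x \<in> A (Suc t) \<omega>)) * (\<Prod>x\<in>Q. 1 - of_bool (x \<in> A (Suc t) \<omega>)) :: real"
  let ?b = "\<lambda>P \<omega>. (\<Prod>x\<in>P. prob (A t \<omega>) x) * (\<Prod>x\<in>Q. 1 - prob (A t \<omega>) x)"
  have q: "q \<notin> P" using insert by blast
  have ia: "integrable M (?a P)" if "finite P" for P
    by (rule integrable_process[OF _ depends_on_prod_member]) (use that insert in auto)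
  have ib: "integrable M (?b P)" if "finite P" for P
    by (rule integrable_process[OF _ depends_on_prod_prob]) (use that insert in auto)
  have "(\<integral>\<omega>. (\<Prod>x\<in>P. of_bool (x \<in> A (Suc t) \<omega>)) * (\<Prod>x\<in>insert q Q. 1 - of_bool (x \<in> A (Suc t) \<omega>)) \<partial>M)
    = (\<integral>\<omega>. ?a P \<omega> - ?a (insert q P) \<omega> \<partial>M)"
    using insert q by (intro Bochner_Integration.integral_cong) (auto simp: algebra_simps)
  also have "\<dots> = (\<integral>\<omega>. ?a P \<omega> \<partial>M) - (\<integral>\<omega>. ?a (insert q P) \<omega> \<partial>M)"
    using insert by (intro Bochner_Integration.integral_diff ia) auto
  also have "\<dots> = (\<integral>\<omega>. ?b P \<omega> \<partial>M) - (\<integral>\<omega>. ?b (insert q P) \<omega> \<partial>M)"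
    using insert by (intro arg_cong2[where f = "(-)"] insert.IH) auto
  also have "\<dots> = (\<integral>\<omega>. ?b P \<omega> - ?b (insert q P) \<omega> \<partial>M)"
    using insert by (intro Bochner_Integration.integral_diff[symmetric] ib) auto
  also have "\<dots> = (\<integral>\<omega>. (\<Prod>x\<in>P. prob (A t \<omega>) x) * (\<Prod>x\<in>insert q Q. 1 - prob (A t \<omega>) x) \<partial>M)"
    using insert q by (intro Bochner_Integration.integral_cong) (auto simp: algebra_simps)
  finally show ?case .
qed

lemma process_step:
  assumes W: "finite W" "F \<subseteq> W" and f: "depends_on f F"
  shows "(\<integral>\<omega>. f (A (Suc t) \<omega>) \<partial>M) = (\<integral>\<omega>. step W f (A t \<omega>) \<partial>M)"
proof -
  have F: "finite F" using W finite_subset by blast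
  have int: "integrable M (\<lambda>\<omega>. subset_weight F (\<lambda>x. of_bool (x \<in> A (Suc t) \<omega>)) S * f S)"
    "integrable M (\<lambda>\<omega>. subset_weight F (prob (A t \<omega>)) S * f S)" if "S \<subseteq> F" for S
  proof -
    have "finite S" "finite (F - S)" using F that finite_subset by auto
    then show "integrable M (\<lambda>\<omega>. subset_weight F (\<lambda>x. of_bool (x \<in> A (Suc t) \<omega>)) S * f S)"
      unfolding subset_weight_def
      by (intro integrable_mult_left integrable_process[OF _ depends_on_prod_member]) auto
    show "integrable M (\<lambda>\<omega>. subset_weight F (prob (A t \<omega>)) S * f S)"
      unfolding subset_weight_def using \<open>finite S\<close> \<open>finite (F - S)\<close>
      by (intro integrable_mult_left integrable_process[OF _ depends_on_prod_prob]) auto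
  qed
  have "(\<integral>\<omega>. f (A (Suc t) \<omega>) \<partial>M)
      = (\<integral>\<omega>. (\<Sum>S\<in>Pow F. subset_weight F (\<lambda>x. of_bool (x \<in> A (Suc t) \<omega>)) S * f S) \<partial>M)"
    by (subst depends_on_eq_subset_mean[OF F f]) (simp add: subset_mean_def)
  also have "\<dots> = (\<Sum>S\<in>Pow F. (\<integral>\<omega>. subset_weight F (\<lambda>x. of_bool (x \<in> A (Suc t) \<omega>)) S \<partial>M) * f S)"
    using int(1) by (subst Bochner_Integration.integral_sum) auto
  also have "\<dots> = (\<Sum>S\<in>Pow F. (\<integral>\<omega>. subset_weight F (prob (A t \<omega>)) S \<partial>M) * f S)"
  proof (intro sum.cong refl arg_cong2[where f = "(*)"])
    fix S assume "S \<in> Pow F"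
    then have "finite S" "finite (F - S)" "S \<inter> (F - S) = {}" using F finite_subset by auto
    then show "(\<integral>\<omega>. subset_weight F (\<lambda>x. of_bool (x \<in> A (Suc t) \<omega>)) S \<partial>M)
        = (\<integral>\<omega>. subset_weight F (prob (A t \<omega>)) S \<partial>M)"
      unfolding subset_weight_def by (rule process_weight)
  qed
  also have "\<dots> = (\<integral>\<omega>. (\<Sum>S\<in>Pow F. subset_weight F (prob (A t \<omega>)) S * f S) \<partial>M)"
    using int(2) by (subst Bochner_Integration.integral_sum) auto
  also have "\<dots> = (\<integral>\<omega>. step W f (A t \<omega>) \<partial>M)"
    unfolding step_local[OF W(1) f W(2)] by (simp add: subset_mean_def)
  finally show ?thesis .
qed

text \<open>Peels off the last update: \<open>f\<close> turns into \<open>step W f\<close>, which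
  looks \<open>radius\<close> further, until the deterministic initial set is reached. From here on
  the probability space disappears.\<close>

lemma process_steps:
  assumes "finite W" "square x (r + radius * t) \<subseteq> W" "depends_on f (square x r)"
  shows "(\<integral>\<omega>. f (A t \<omega>) \<partial>M) = steps W t f A0"
  using assms(2,3)
proof (induction t arbitrary: f r)
  case 0
  interpret P: prob_space M by (rule process_prob_space)
  have "(\<integral>\<omega>. f (A 0 \<omega>) \<partial>M) = (\<integral>\<omega>. f A0 \<partial>M)"
    using process by (intro Bochner_Integration.integral_cong) (auto simp: growth_process_def)
  then show ?case by (simp add: P.prob_space)
next
  case (Suc t)
  have "square x r \<subseteq> square x (r + radius * Suc t)" by (rule square_mono) simp
  then have "(\<integral>\<omega>. f (A (Suc t) \<omega>) \<partial>M) = (\<integral>\<omega>. step W f (A t \<omega>) \<partial>M)"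
    using Suc.prems assms(1) by (intro process_step) auto
  also have "\<dots> = steps W t (step W f) A0"
    using Suc.prems depends_on_step[OF assms(1)] by (intro Suc.IH[of "r + radius"]) (auto simp: algebra_simps)
  finally show ?case by (simp add: funpow_swap1)
qed

end

end

section \<open>Growth from a half-space\<close>

lemma shifted_half_space_iff:
  assumes "norm u = 1" shows "x \<in> shifted_half_space u r \<longleftrightarrow> x \<bullet> u \<le> r"
proof
  assume "x \<in> shifted_half_space u r"
  then show "x \<bullet> u \<le> r"
    using assms by (auto simp: shifted_half_space_def half_space_def inner_add_left norm_eq_1)
next
  assume "x \<bullet> u \<le> r"
  then have "x - r *\<^sub>R u \<in> half_space u"
    using assms by (simp add: half_space_def inner_diff_left norm_eq_1)
  then show "x \<in> shifted_half_space u r"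
    unfolding shifted_half_space_def by (intro image_eqI[of _ _ "x - r *\<^sub>R u"]) auto
qed

lemma to_plane_add: "to_plane (x + y) = to_plane x + to_plane y"
  by (simp add: to_plane_def)

lemma to_plane_diff: "to_plane (x - y) = to_plane x - to_plane y"
  by (simp add: to_plane_def)

lemma in_square_if_dist:
  assumes "dist (to_plane y) (to_plane x) \<le> C" shows "y \<in> square x (nat \<lceil>C\<rceil>)"
proof -
  have "dist (real_of_int (fst y)) (real_of_int (fst x)) \<le> C" "dist (real_of_int (snd y)) (real_of_int (snd x)) \<le> C"
    using dist_fst_le[of "to_plane y" "to_plane x"] dist_snd_le[of "to_plane y" "to_plane x"] assms
    by (auto simp: to_plane_def)
  then have "real_of_int \<bar>fst y - fst x\<bar> \<le> C" "real_of_int \<bar>snd y - snd x\<bar> \<le> C"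
    by (auto simp: dist_real_def)
  then show ?thesis unfolding square_def by (auto; linarith)
qed

text \<open>Block length and block area are polynomial in \<open>k\<close>, while the chance that
  spreading fails within order \<open>k\<close> steps is exponentially small.\<close>

lemma eventually_spread_error_small:
  fixes a b \<kappa> :: real assumes "a > 0" "b > 0" "\<kappa> > 0"
  shows "eventually (\<lambda>k::nat. b * real k ^ 4 * (a * real k ^ 4 + 1)\<^sup>2 * exp (- \<kappa> * real k) \<le> 1) at_top"
proof -
  have "((\<lambda>k::nat. b * real k ^ 4 * (a * real k ^ 4 + 1)\<^sup>2 * exp (- \<kappa> * real k)) \<longlongrightarrow> 0) at_top"
    using assms by real_asymp
  then have "eventually (\<lambda>k::nat. b * real k ^ 4 * (a * real k ^ 4 + 1)\<^sup>2 * exp (- \<kappa> * real k) < 1) at_top"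
    by (rule order_tendstoD) simp
  then show ?thesis by (rule eventually_mono) simp
qed

text \<open>The logarithm of the number of sites in a block is negligible against the concentration
  exponent of order \<open>k^2\<close>.\<close>

lemma eventually_entropy_small:
  fixes a b c :: real assumes "a > 0" "b > 0" "c > 0"
  shows "eventually (\<lambda>k::nat. b * ln (4 * (a * real k ^ 4 + 1)\<^sup>2) \<le> c * real k ^ 2) at_top"
proof -
  have "((\<lambda>k::nat. b * ln (4 * (a * real k ^ 4 + 1)\<^sup>2) / real k ^ 2) \<longlongrightarrow> 0) at_top"
    using assms by real_asymp
  then have "eventually (\<lambda>k::nat. b * ln (4 * (a * real k ^ 4 + 1)\<^sup>2) / real k ^ 2 < c) at_top"
    by (rule order_tendstoD) (rule assms)
  then show ?thesis
    using eventually_gt_at_top[of 0] by eventually_elim (simp add: pos_divide_less_eq)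
qed

locale half_space_growth = random_growth +
  fixes u :: "real \<times> real"
  assumes norm_u: "norm u = 1"
    and regular: "locally_regular (det_CA N \<pi>)"
    and supercritical: "supercritical (det_CA N \<pi>)"
begin

section \<open>Half-spaces on the lattice and seeds near them\<close>

definition height :: "site \<Rightarrow> real" where "height x = to_plane x \<bullet> u"

definition H :: "real \<Rightarrow> site set" where "H a = {x. height x \<le> a}"

lemma H_iff [simp]: "x \<in> H a \<longleftrightarrow> height x \<le> a"
  by (simp add: H_def)

lemma H_mono: "a \<le> b \<Longrightarrow> H a \<subseteq> H b"
  by auto

lemma height_add: "height (x + y) = height x + height y"
  by (simp add: height_def to_plane_add inner_add_left)

lemma height_diff: "height (x - y) = height x - height y"
  by (simp add: height_def to_plane_diff inner_diff_left)

lemma height_0 [simp]: "height 0 = 0"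
  using height_diff[of 0 0] by simp

lemma H_shift: "(+) z ` H a = H (a + height z)"
proof -
  have "x \<in> (+) z ` H a" if "x \<in> H (a + height z)" for x
    using that by (intro image_eqI[of _ _ "x - z"]) (auto simp: height_diff)
  then show ?thesis by (auto simp: height_add)
qed

lemma lattice_part_shifted: "lattice_part (shifted_half_space u r) = H r"
  by (auto simp: lattice_part_def shifted_half_space_iff[OF norm_u] height_def)

lemma lattice_part_half_space: "lattice_part (half_space u) = H 0"
  by (auto simp: lattice_part_def half_space_def height_def)

lemma abs_u: "\<bar>fst u\<bar> \<le> 1" "\<bar>snd u\<bar> \<le> 1"
  using norm_fst_le[of "fst u" "snd u"] norm_snd_le[of "snd u" "fst u"] norm_u by auto

lemma height_square:
  assumes "y \<in> square x r" shows "\<bar>height y - height x\<bar> \<le> 2 * real r"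
proof -
  have 1: "\<bar>real_of_int (fst y - fst x)\<bar> \<le> real r" "\<bar>real_of_int (snd y - snd x)\<bar> \<le> real r"
    using assms unfolding square_def by (auto simp flip: of_int_diff of_int_abs)
  have "height y - height x = real_of_int (fst y - fst x) * fst u + real_of_int (snd y - snd x) * snd u"
    by (simp add: height_def to_plane_def inner_prod_def algebra_simps)
  also have "\<bar>\<dots>\<bar> \<le> \<bar>real_of_int (fst y - fst x)\<bar> * \<bar>fst u\<bar> + \<bar>real_of_int (snd y - snd x)\<bar> * \<bar>snd u\<bar>"
    by (rule order_trans[OF abs_triangle_ineq]) (simp add: abs_mult)
  also have "\<dots> \<le> real r * 1 + real r * 1"
    using 1 abs_u by (intro add_mono mult_mono) auto
  finally show ?thesis by simp
qed

text \<open>Rounds the point \<open>(a + 1) * u\<close> of the plane: each coordinate moves by at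
  most one half and those of \<open>u\<close> are at most one in modulus, so the height moves by at
  most one.\<close>

lemma site_at_height:
  obtains z where "a \<le> height z" "height z \<le> a + 2" "z \<in> square 0 (nat \<lceil>\<bar>a\<bar>\<rceil> + 2)"
proof -
  define z where "z = (round ((a + 1) * fst u), round ((a + 1) * snd u))"
  have r: "\<bar>real_of_int (round y) - y\<bar> \<le> 1 / 2" for y :: real
    using of_int_round_abs_le by (simp add: abs_minus_commute)
  have uu: "fst u * fst u + snd u * snd u = 1"
    using norm_u by (simp add: norm_eq_1 inner_prod_def)
  have "height z - (a + 1) * (fst u * fst u + snd u * snd u)
      = (real_of_int (round ((a + 1) * fst u)) - (a + 1) * fst u) * fst u
      + (real_of_int (round ((a + 1) * snd u)) - (a + 1) * snd u) * snd u"
    by (simp add: height_def to_plane_def inner_prod_def z_def algebra_simps)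
  also have "\<bar>\<dots>\<bar> \<le> 1 / 2 * 1 + 1 / 2 * 1"
    by (rule order_trans[OF abs_triangle_ineq], unfold abs_mult, intro add_mono mult_mono r abs_u) auto
  finally have "\<bar>height z - (a + 1)\<bar> \<le> 1" by (simp add: uu)
  then have 1: "a \<le> height z" "height z \<le> a + 2" by linarith+
  have tri: "\<bar>q\<bar> \<le> \<bar>a\<bar> + 3 / 2" if "\<bar>p\<bar> \<le> \<bar>a + 1\<bar>" "\<bar>q - p\<bar> \<le> 1 / 2" for p q :: real
    using that by linarith
  have "\<bar>round ((a + 1) * y)\<bar> \<le> int (nat \<lceil>\<bar>a\<bar>\<rceil> + 2)" if "\<bar>y\<bar> \<le> 1" for y
  proof -
    have "\<bar>(a + 1) * y\<bar> \<le> \<bar>a + 1\<bar> * 1" unfolding abs_mult using that by (intro mult_left_mono) auto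
    then have "\<bar>real_of_int (round ((a + 1) * y))\<bar> \<le> \<bar>a\<bar> + 3 / 2"
      using r[of "(a + 1) * y"] by (elim tri[rotated]) simp
    then show ?thesis by linarith
  qed
  then have "z \<in> square 0 (nat \<lceil>\<bar>a\<bar>\<rceil> + 2)"
    using abs_u unfolding z_def square_def by simp
  then show ?thesis using that 1 by blast
qed

lemma CA_speed:
  obtains s where "s > 0" "\<And>a. T (H a) = H (a + s)"
proof -
  obtain s where s: "s > 0" "plane_CA T (half_space u) = shifted_half_space u s"
    using supercritical norm_u unfolding supercritical_def by blast
  have "T (H a) = H (a + s)" for a
  proof -
    have "x \<in> T (H a) \<longleftrightarrow> x \<in> H (a + s)" for x
    proof -
      \<comment> \<open>The real point from which the half-space through the origin has the same
        lattice part as \<open>H a\<close> seen from \<open>x\<close>; it transfers the planar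
        identity to the site \<open>x\<close>.\<close>
      define y where "y = (height x - a) *\<^sub>R u"
      have yu: "y \<bullet> u = height x - a" using norm_u by (simp add: y_def norm_eq_1)
      have "lattice_part ((\<lambda>b. b - y) ` half_space u) = H (a - height x)"
      proof -
        have mem: "v \<in> (\<lambda>b. b - y) ` half_space u \<longleftrightarrow> v \<bullet> u \<le> a - height x" for v
        proof
          assume "v \<bullet> u \<le> a - height x"
          then have "v + y \<in> half_space u" by (simp add: half_space_def inner_add_left yu)
          then show "v \<in> (\<lambda>b. b - y) ` half_space u" by (intro image_eqI[of _ _ "v + y"]) auto
        qed (auto simp: half_space_def inner_diff_left yu)
        show ?thesis by (simp only: lattice_part_def vimage_def mem H_def height_def)
      qed
      then have "0 \<in> T (H (a - height x)) \<longleftrightarrow> y \<in> plane_CA T (half_space u)"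
        by (simp add: plane_CA_def)
      also have "\<dots> \<longleftrightarrow> height x \<le> a + s"
        unfolding s(2) shifted_half_space_iff[OF norm_u] yu by linarith
      also have "0 \<in> T (H (a - height x)) \<longleftrightarrow> x \<in> (+) x ` T (H (a - height x))"
        by auto
      also have "(+) x ` T (H (a - height x)) = T (H a)"
        unfolding T_shift[symmetric] H_shift by simp
      finally show ?thesis by simp
    qed
    then show ?thesis by blast
  qed
  then show ?thesis using that s(1) by blast
qed

definition CA_velocity :: real where
  "CA_velocity = (SOME s. s > 0 \<and> (\<forall>a. T (H a) = H (a + s)))"

lemma CA_velocity: "CA_velocity > 0" "T (H a) = H (a + CA_velocity)"
proof -
  have "\<exists>s. s > 0 \<and> (\<forall>a. T (H a) = H (a + s))" using CA_speed by metis
  then have "CA_velocity > 0 \<and> (\<forall>a. T (H a) = H (a + CA_velocity))"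
    unfolding CA_velocity_def by (rule someI_ex)
  then show "CA_velocity > 0" "T (H a) = H (a + CA_velocity)" by blast+
qed

lemma T_pow_H: "(T ^^ t) (H a) = H (a + real t * CA_velocity)"
  by (induction t) (simp_all add: CA_velocity(2) algebra_simps)

lemma H_fills_space: "fills_space T (H a)"
proof -
  have "\<exists>t. x \<in> (T ^^ t) (H a)" for x
  proof -
    obtain t :: nat where "height x - a < real t * CA_velocity"
      using ex_less_of_nat_mult[OF CA_velocity(1)] by blast
    then show ?thesis unfolding T_pow_H by (intro exI[of _ t]) simp
  qed
  then show ?thesis unfolding fills_space_def by blast
qed

text \<open>Regularity provides seeds only at distance at least \<open>C\<close> from
  \<open>H 0\<close>. Near \<open>H 0\<close> a full square inside the half-space does the job, once
  squares of radius \<open>R\<close> are known to fill space.\<close>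

lemma seeds_exist:
  obtains r where "\<And>B x. reach (H 0) B \<Longrightarrow> x \<in> B \<Longrightarrow> seeded r x B"
proof -
  obtain C :: real where C: "\<And>A t x. \<lbrakk>A 0 = H 0; \<And>t. A t \<subseteq> A (Suc t) \<and> A (Suc t) \<subseteq> T (A t); x \<in> A t;
      C \<le> infdist (to_plane x) (to_plane ` H 0)\<rbrakk> \<Longrightarrow>
      \<exists>G \<subseteq> A t. (\<forall>g\<in>G. dist (to_plane g) (to_plane x) \<le> C) \<and> fills_space T G"
    using regular H_fills_space[of 0] unfolding locally_regular_def by meson
  define R where "R = nat \<lceil>C\<rceil>"
  have far: "seeded R x B" if B: "reach (H 0) B" "x \<in> B" and x: "C \<le> infdist (to_plane x) (to_plane ` H 0)" for B x
  proof -
    obtain A t where A: "A 0 = H 0" "\<And>s. A s \<subseteq> A (Suc s) \<and> A (Suc s) \<subseteq> T (A s)" "A t = B"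
      using reach_sequence[OF B(1)] by blast
    obtain G where G: "G \<subseteq> B" "\<And>g. g \<in> G \<Longrightarrow> dist (to_plane g) (to_plane x) \<le> C" "fills_space T G"
      using C[OF A(1,2) _ x, of t] B(2) A(3) by blast
    have "G \<subseteq> square x R" using G(2) in_square_if_dist unfolding R_def by blast
    then show ?thesis using G unfolding seeded_def by blast
  qed
  have ne: "to_plane ` H 0 \<noteq> {}" using H_iff[of 0 0] by (metis empty_iff height_0 image_is_empty order_refl)
  have dist: "C \<le> infdist (to_plane x) (to_plane ` H 0)" if "\<And>y. y \<in> H 0 \<Longrightarrow> C \<le> dist (to_plane x) (to_plane y)" for x
    unfolding infdist_notempty[OF ne] using that ne by (intro cINF_greatest) auto
  obtain x0 where x0: "C \<le> height x0" by (rule site_at_height[of C])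
  have "C \<le> infdist (to_plane x0) (to_plane ` H 0)"
  proof (rule dist)
    fix y assume "y \<in> H 0"
    then have "C \<le> height x0 - height y" using x0 by simp
    also have "\<dots> = (to_plane x0 - to_plane y) \<bullet> u" by (simp add: height_def inner_diff_left)
    also have "\<dots> \<le> norm (to_plane x0 - to_plane y) * norm u" by (rule norm_cauchy_schwarz)
    finally show "C \<le> dist (to_plane x0) (to_plane y)" by (simp add: norm_u dist_norm)
  qed
  moreover obtain t where "x0 \<in> (T ^^ t) (H 0)"
    using H_fills_space[of 0] unfolding fills_space_def by blast
  moreover have "reach (H 0) ((T ^^ t) (H 0))" for t
  proof (induction t)
    case (Suc t)
    then show ?case by (rule reach_step) (simp_all add: T_extensive)
  qed (simp add: reach_refl)
  ultimately have "seeded R x0 ((T ^^ t) (H 0))" using far by blast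
  \<comment> \<open>A single far site suffices: translation makes the square around any site
    space-filling.\<close>
  then have "fills_space T (square x0 R)" unfolding seeded_def using fills_space_mono by blast
  from fills_space_shift[OF this] have "fills_space T (square (z + x0) R)" for z
    by (simp add: square_shift)
  from this[of "z - x0" for z] have fill: "fills_space T (square z R)" for z by simp
  \<comment> \<open>Heights in a square of radius \<open>R\<close> differ from that of its centre by
    at most \<open>2 * R\<close>, so shifting a site of \<open>H 0\<close> by \<open>v\<close> puts
    its whole square into \<open>H 0\<close>.\<close>
  obtain v where v: "height v \<le> - 2 * real R" "v \<in> square 0 (nat \<lceil>\<bar>- 2 * real R - 2\<bar>\<rceil> + 2)"
    by (rule site_at_height[of "- 2 * real R - 2"]) auto
  define V where "V = nat \<lceil>\<bar>- 2 * real R - 2\<bar>\<rceil> + 2"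
  have "seeded (R + V + R) x B" if B: "reach (H 0) B" "x \<in> B" for B x
  proof (cases "C \<le> infdist (to_plane x) (to_plane ` H 0)")
    case True
    have "square x R \<subseteq> square x (R + V + R)" by (rule square_mono) simp
    then show ?thesis using far[OF B True] unfolding seeded_def by (meson order_trans)
  next
    case False
    then obtain y where y: "y \<in> H 0" "dist (to_plane x) (to_plane y) < C" using dist[of x] by force
    have "square (y + v) R \<subseteq> H 0"
    proof
      fix g assume "g \<in> square (y + v) R"
      from height_square[OF this] show "g \<in> H 0" using y(1) v(1) by (simp add: height_add)
    qed
    also have "\<dots> \<subseteq> B" using B(1) by (rule reach_superset)
    finally have 1: "square (y + v) R \<subseteq> B" .
    have "y \<in> square x R" unfolding R_def using y(2) by (intro in_square_if_dist) (simp add: dist_commute)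
    moreover have "y + v \<in> square y V" using v(2) by (auto simp: square_def V_def)
    ultimately have "y + v \<in> square x (R + V)" by (rule square_trans)
    then have "square (y + v) R \<subseteq> square x (R + V + R)" by (rule square_subset)
    then show ?thesis using 1 fill unfolding seeded_def by blast
  qed
  then show ?thesis using that by blast
qed

text \<open>Transfers an estimate at the reference site \<open>z\<close> to every \<open>x\<close>,
  using the lattice shift by \<open>x - z\<close> only.\<close>

lemma occ_H_shift: "occ t x (H (height x - height z)) = occ t z (H 0)"
  using occ_shift[of t "x - z" z "H 0"] by (simp add: H_shift height_diff)

lemma occ_empty: "occ t x {} = 0"
proof -
  have "reach {} B \<Longrightarrow> B = {}" for B
  proof (induction rule: reach.induct)
    case (reach_step B B')
    then show ?case using T_near[of _ "{}"] by (metis empty_iff subset_empty subsetI)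
  qed simp
  then have "occ t x {} \<le> steps (square x (radius * t)) t (\<lambda>_. 0) {}"
    unfolding occ_def by (intro steps_mono_reach) auto
  then show ?thesis using occ_bounds[of t x "{}"] by simp
qed

text \<open>The random growth never leaves the deterministic light cone.\<close>

lemma occ_le_T_pow: "occ t x B \<le> of_bool (x \<in> (T ^^ t) B)"
proof -
  have "steps W t (\<lambda>A. of_bool (x \<in> A)) B \<le> of_bool (x \<in> (T ^^ t) B)" if W: "finite W" for W
  proof (induction t arbitrary: B)
    case (Suc t)
    have "step W (steps W t (\<lambda>A. of_bool (x \<in> A))) B \<le> step W (\<lambda>_. of_bool (x \<in> (T ^^ t) (T B))) B"
    proof (rule step_mono[OF W])
      fix B' assume "B' \<subseteq> T B"
      then have "(T ^^ t) B' \<subseteq> (T ^^ t) (T B)" by (rule T_pow_mono)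
      then have "of_bool (x \<in> (T ^^ t) B') \<le> (of_bool (x \<in> (T ^^ t) (T B)) :: real)" by auto
      with Suc.IH[of B'] show "steps W t (\<lambda>A. of_bool (x \<in> A)) B' \<le> of_bool (x \<in> (T ^^ t) (T B))"
        by (rule order_trans)
    qed
    then show ?case using W by (simp add: funpow_swap1)
  qed simp
  then show ?thesis unfolding occ_def by simp
qed

text \<open>If \<open>x\<close> is vacant at the end of a block of length \<open>S\<close>, then either some site of height at most
  \<open>height x - height z\<close> near \<open>x\<close> was vacant at the beginning of the block, or \<open>x\<close> was vacant and
  the independent block failed. The exponential weight sums this recursion over all histories.\<close>
lemma block_lower:
  assumes \<delta>: "1 - occ S z (H 0) \<le> \<delta>" and \<mu>: "\<mu> > 0"
    and K: "(2 * real (radius * S) + 1)\<^sup>2 \<le> K"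
    and small: "K * exp (- \<mu> * (height z - v * real S)) + \<delta> * exp (\<mu> * v * real S) \<le> 1"
  shows "1 - occ (n * S) x (H 0) \<le> exp (\<mu> * (height x - v * real (n * S)))"
proof (induction n arbitrary: x)
  case 0
  then show ?case using \<mu> by (auto simp: occ_def)
next
  case (Suc n)
  define W where "W = square x (radius * (n * S + S))"
  define Q where "Q = square x (radius * S)"
  define Y where "Y = {y \<in> Q. height y \<le> height x - height z}"
  have W: "finite W" and finY: "finite Y" by (simp_all add: W_def Y_def Q_def)
  have \<delta>0: "0 \<le> \<delta>" using \<delta> occ_bounds[of S z "H 0"] by simp
  \<comment> \<open>If \<open>Y\<close> is full, then seen from \<open>x\<close> the set
    \<open>B\<close> contains a translated half-space, and the block fails with probability at most
    \<open>\<delta>\<close>. Keeping the factor that vanishes for occupied \<open>x\<close> is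
    essential: a bare \<open>\<delta>\<close> would not decay with \<open>n\<close>.\<close>
  have pointwise: "1 - occ S x B \<le> (\<Sum>y\<in>Y. 1 - of_bool (y \<in> B)) + \<delta> * (1 - of_bool (x \<in> B))" for B
  proof (cases "Y \<subseteq> B")
    case False
    then obtain y where y: "y \<in> Y" "y \<notin> B" by blast
    have "(1::real) = 1 - of_bool (y \<in> B)" using y by simp
    also have "\<dots> \<le> (\<Sum>y\<in>Y. 1 - of_bool (y \<in> B))"
      using finY y by (intro member_le_sum[where f = "\<lambda>y. 1 - of_bool (y \<in> B)"]) auto
    also have "\<dots> \<le> (\<Sum>y\<in>Y. 1 - of_bool (y \<in> B)) + \<delta> * (1 - of_bool (x \<in> B))"
      using \<delta>0 by simp
    finally show ?thesis using occ_bounds[of S x B] by linarith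
  next
    case sub: True
    show ?thesis
    proof (cases "x \<in> B")
      case True
      then show ?thesis using occ_occupied[OF True] by (simp add: sum_nonneg)
    next
      case False
      have "(B \<union> H (height x - height z)) \<inter> Q = B \<inter> Q" using sub by (auto simp: Y_def)
      then have "occ S x (B \<union> H (height x - height z)) = occ S x B"
        unfolding Q_def by (rule depends_onD[OF occ_local])
      moreover have "occ S x (H (height x - height z)) \<le> occ S x (B \<union> H (height x - height z))"
        by (rule occ_mono) simp
      ultimately have "1 - occ S x B \<le> \<delta>" using \<delta> by (simp add: occ_H_shift)
      moreover have "0 \<le> (\<Sum>y\<in>Y. 1 - of_bool (y \<in> B) :: real)" by (rule sum_nonneg) simp
      ultimately show ?thesis using False by simp
    qed
  qed
  have occ_n: "steps W (n * S) (\<lambda>A. of_bool (y \<in> A)) = occ (n * S) y" if "y \<in> Q" for y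
  proof -
    have "square y (radius * (n * S)) \<subseteq> square x (radius * S + radius * (n * S))"
      using that unfolding Q_def by (rule square_subset)
    also have "\<dots> = W" by (simp add: W_def algebra_simps)
    finally show ?thesis by (rule steps_occ[OF W])
  qed
  have "1 - occ (Suc n * S) x (H 0) = 1 - steps W (n * S) (occ S x) (H 0)"
    using occ_add[OF W, of x "n * S" S "H 0"] by (simp add: W_def add.commute)
  also have "\<dots> = steps W (n * S) (\<lambda>B. 1 - occ S x B) (H 0)"
    using W by (simp only: steps_diff steps_const)
  also have "\<dots> \<le> steps W (n * S) (\<lambda>B. (\<Sum>y\<in>Y. 1 - of_bool (y \<in> B)) + \<delta> * (1 - of_bool (x \<in> B))) (H 0)"
    using W pointwise by (rule steps_mono)
  also have "\<dots> = (\<Sum>y\<in>Y. 1 - steps W (n * S) (\<lambda>A. of_bool (y \<in> A)) (H 0))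
      + \<delta> * (1 - steps W (n * S) (\<lambda>A. of_bool (x \<in> A)) (H 0))"
    by (simp only: steps_add steps_cmult steps_sum steps_diff steps_const[OF W])
  also have "\<dots> = (\<Sum>y\<in>Y. 1 - occ (n * S) y (H 0)) + \<delta> * (1 - occ (n * S) x (H 0))"
    using occ_n by (simp add: Y_def Q_def)
  also have "\<dots> \<le> (\<Sum>y\<in>Y. exp (\<mu> * (height x - height z - v * real (n * S))))
      + \<delta> * exp (\<mu> * (height x - v * real (n * S)))"
  proof (intro add_mono sum_mono mult_left_mono Suc.IH \<delta>0)
    fix y assume "y \<in> Y"
    then have "height y - v * real (n * S) \<le> height x - height z - v * real (n * S)" by (simp add: Y_def)
    then have "exp (\<mu> * (height y - v * real (n * S))) \<le> exp (\<mu> * (height x - height z - v * real (n * S)))"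
      using \<mu> by simp
    with Suc.IH[of y] show "1 - occ (n * S) y (H 0) \<le> exp (\<mu> * (height x - height z - v * real (n * S)))"
      by (rule order_trans)
  qed
  also have "(\<Sum>y\<in>Y. exp (\<mu> * (height x - height z - v * real (n * S))))
      \<le> K * exp (\<mu> * (height x - height z - v * real (n * S)))"
  proof -
    have "card Y \<le> card (square x (radius * S))" by (intro card_mono) (auto simp: Y_def Q_def)
    then have "real (card Y) \<le> real ((2 * (radius * S) + 1)\<^sup>2)" by (simp only: card_square of_nat_le_iff)
    then have "real (card Y) \<le> K" using K by (simp add: add.commute)
    from mult_right_mono[OF this exp_ge_zero] show ?thesis by simp
  qed
  also have "K * exp (\<mu> * (height x - height z - v * real (n * S))) + \<delta> * exp (\<mu> * (height x - v * real (n * S)))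
     = exp (\<mu> * (height x - v * real (Suc n * S))) *
       (K * exp (- \<mu> * (height z - v * real S)) + \<delta> * exp (\<mu> * v * real S))"
  proof -
    have 1: "\<mu> * (height x - height z - v * real (n * S))
        = \<mu> * (height x - v * real (Suc n * S)) + (- \<mu> * (height z - v * real S))"
      by (simp add: algebra_simps)
    have 2: "\<mu> * (height x - v * real (n * S)) = \<mu> * (height x - v * real (Suc n * S)) + \<mu> * v * real S"
      by (simp add: algebra_simps)
    show ?thesis unfolding 1 2 exp_add by (simp only: distrib_left mult_ac)
  qed
  also have "\<dots> \<le> exp (\<mu> * (height x - v * real (Suc n * S))) * 1"
    using small by (intro mult_left_mono) auto
  finally show ?case by simp
qed

text \<open>Mirror image of \<open>block_lower\<close>: occupation of \<open>x\<close> needs an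
  occupied site of large relative height at the start of the block, or an exceptionally fast block
  started from some occupied site in range. The latter may lie lower by
  \<open>2 * radius * L\<close>, whence the second exponent.\<close>

lemma block_upper:
  assumes \<delta>: "occ L z (H 0) \<le> \<delta>" and \<mu>: "\<mu> > 0"
    and K: "(2 * real (radius * L) + 1)\<^sup>2 \<le> K"
    and small: "K * exp (- \<mu> * (v * real L - height z))
      + \<delta> * K * exp (\<mu> * (2 * real (radius * L) - v * real L)) \<le> 1"
  shows "occ (n * L) x (H 0) \<le> exp (- \<mu> * (height x - v * real (n * L)))"
proof (induction n arbitrary: x)
  case 0
  have "of_bool (x \<in> H 0) \<le> exp (- \<mu> * height x)"
    using \<mu> by (auto simp: mult_nonneg_nonpos)
  then show ?case by (simp add: occ_def)
next
  case (Suc n)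
  define W where "W = square x (radius * (n * L + L))"
  define Q where "Q = square x (radius * L)"
  define Y where "Y = {y \<in> Q. height y > height x - height z}"
  have W: "finite W" and finY: "finite Y" and finQ: "finite Q" by (simp_all add: W_def Y_def Q_def)
  have \<delta>0: "0 \<le> \<delta>" using \<delta> occ_bounds[of L z "H 0"] by simp
  have pointwise: "occ L x B \<le> (\<Sum>y\<in>Y. of_bool (y \<in> B)) + \<delta> * (\<Sum>y\<in>Q. of_bool (y \<in> B))" for B
  proof (cases "Y \<inter> B = {}")
    case False
    then obtain y where y: "y \<in> Y" "y \<in> B" by blast
    have "(1::real) = of_bool (y \<in> B)" using y by simp
    also have "\<dots> \<le> (\<Sum>y\<in>Y. of_bool (y \<in> B))"
      using finY y by (intro member_le_sum[where f = "\<lambda>y. of_bool (y \<in> B)"]) auto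
    also have "\<dots> \<le> (\<Sum>y\<in>Y. of_bool (y \<in> B)) + \<delta> * (\<Sum>y\<in>Q. of_bool (y \<in> B))"
      using \<delta>0 by (simp add: sum_nonneg)
    finally show ?thesis using occ_bounds[of L x B] by linarith
  next
    case disj: True
    have "(B \<inter> Q) \<inter> Q = B \<inter> Q" by blast
    then have eq: "occ L x (B \<inter> Q) = occ L x B"
      unfolding Q_def by (rule depends_onD[OF occ_local])
    have Y0: "0 \<le> (\<Sum>y\<in>Y. of_bool (y \<in> B) :: real)" by (rule sum_nonneg) simp
    show ?thesis
    \<comment> \<open>Growth cannot start from nothing, so some site of \<open>Q\<close> is occupied
      and the term multiplied by \<open>\<delta>\<close> is at least one.\<close>
    proof (cases "B \<inter> Q = {}")
      case True
      then have "occ L x B = 0" using eq occ_empty by simp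
      moreover have "0 \<le> \<delta> * (\<Sum>y\<in>Q. of_bool (y \<in> B) :: real)" using \<delta>0 by (intro mult_nonneg_nonneg sum_nonneg) auto
      ultimately show ?thesis using Y0 by simp
    next
      case False
      then obtain y where y: "y \<in> Q" "y \<in> B" by blast
      have "B \<inter> Q \<subseteq> H (height x - height z)" using disj by (force simp: Y_def)
      then have "occ L x (B \<inter> Q) \<le> occ L x (H (height x - height z))" by (rule occ_mono)
      then have 1: "occ L x B \<le> \<delta> * 1" using \<delta> by (simp add: occ_H_shift eq)
      have "(1::real) = of_bool (y \<in> B)" using y by simp
      also have "\<dots> \<le> (\<Sum>y\<in>Q. of_bool (y \<in> B))"
        using finQ y by (intro member_le_sum[where f = "\<lambda>y. of_bool (y \<in> B)"]) auto
      finally have "\<delta> * 1 \<le> \<delta> * (\<Sum>y\<in>Q. of_bool (y \<in> B))" using \<delta>0 by (rule mult_left_mono)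
      then show ?thesis using 1 Y0 by linarith
    qed
  qed
  have occ_n: "steps W (n * L) (\<lambda>A. of_bool (y \<in> A)) = occ (n * L) y" if "y \<in> Q" for y
  proof -
    have "square y (radius * (n * L)) \<subseteq> square x (radius * L + radius * (n * L))"
      using that unfolding Q_def by (rule square_subset)
    also have "\<dots> = W" by (simp add: W_def algebra_simps)
    finally show ?thesis by (rule steps_occ[OF W])
  qed
  have "occ (Suc n * L) x (H 0) = steps W (n * L) (occ L x) (H 0)"
    using occ_add[OF W, of x "n * L" L "H 0"] by (simp add: W_def add.commute)
  also have "\<dots> \<le> steps W (n * L) (\<lambda>B. (\<Sum>y\<in>Y. of_bool (y \<in> B)) + \<delta> * (\<Sum>y\<in>Q. of_bool (y \<in> B))) (H 0)"
    using W pointwise by (rule steps_mono)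
  also have "\<dots> = (\<Sum>y\<in>Y. steps W (n * L) (\<lambda>A. of_bool (y \<in> A)) (H 0))
      + \<delta> * (\<Sum>y\<in>Q. steps W (n * L) (\<lambda>A. of_bool (y \<in> A)) (H 0))"
    by (simp only: steps_add steps_cmult steps_sum)
  also have "\<dots> = (\<Sum>y\<in>Y. occ (n * L) y (H 0)) + \<delta> * (\<Sum>y\<in>Q. occ (n * L) y (H 0))"
    using occ_n by (simp add: Y_def)
  also have "\<dots> \<le> (\<Sum>y\<in>Y. exp (- \<mu> * (height x - height z - v * real (n * L))))
      + \<delta> * (\<Sum>y\<in>Q. exp (- \<mu> * (height x - 2 * real (radius * L) - v * real (n * L))))"
  proof (intro add_mono sum_mono mult_left_mono \<delta>0)
    have mono: "occ (n * L) y (H 0) \<le> exp (- \<mu> * (b - v * real (n * L)))" if "b \<le> height y" for y b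
    proof -
      have "exp (- \<mu> * (height y - v * real (n * L))) \<le> exp (- \<mu> * (b - v * real (n * L)))"
        using \<mu> that by simp
      with Suc.IH[of y] show ?thesis by (rule order_trans)
    qed
    show "occ (n * L) y (H 0) \<le> exp (- \<mu> * (height x - height z - v * real (n * L)))" if "y \<in> Y" for y
      using that by (intro mono) (simp add: Y_def)
    show "occ (n * L) y (H 0) \<le> exp (- \<mu> * (height x - 2 * real (radius * L) - v * real (n * L)))"
      if "y \<in> Q" for y
      using height_square[of y x "radius * L"] that by (intro mono) (simp add: Q_def)
  qed
  also have "\<dots> = real (card Y) * exp (- \<mu> * (height x - height z - v * real (n * L)))
      + \<delta> * (real (card Q) * exp (- \<mu> * (height x - 2 * real (radius * L) - v * real (n * L))))"
    by simp
  also have "\<dots> \<le> K * exp (- \<mu> * (height x - height z - v * real (n * L)))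
      + \<delta> * (K * exp (- \<mu> * (height x - 2 * real (radius * L) - v * real (n * L))))"
  proof -
    have "real (card Q) = real ((2 * (radius * L) + 1)\<^sup>2)" by (simp only: card_square Q_def)
    then have "real (card Q) \<le> K" using K by (simp add: add.commute)
    moreover have "card Y \<le> card Q" using finQ by (intro card_mono) (auto simp: Y_def)
    ultimately show ?thesis using \<delta>0 by (intro add_mono mult_left_mono mult_right_mono) auto
  qed
  also have "\<dots> = exp (- \<mu> * (height x - v * real (Suc n * L))) *
       (K * exp (- \<mu> * (v * real L - height z)) + \<delta> * K * exp (\<mu> * (2 * real (radius * L) - v * real L)))"
  proof -
    have 1: "- \<mu> * (height x - height z - v * real (n * L))
        = - \<mu> * (height x - v * real (Suc n * L)) + (- \<mu> * (v * real L - height z))"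
      by (simp add: algebra_simps)
    have 2: "- \<mu> * (height x - 2 * real (radius * L) - v * real (n * L))
        = - \<mu> * (height x - v * real (Suc n * L)) + \<mu> * (2 * real (radius * L) - v * real L)"
      by (simp add: algebra_simps)
    show ?thesis unfolding 1 2 exp_add by (simp only: distrib_left mult_ac)
  qed
  also have "\<dots> \<le> exp (- \<mu> * (height x - v * real (Suc n * L))) * 1"
    using small by (intro mult_left_mono) auto
  finally show ?case by simp
qed

section \<open>Linear speeds with exponential error bounds\<close>

definition lower_speed :: "real \<Rightarrow> bool" where
  "lower_speed v \<longleftrightarrow> (\<exists>C. \<exists>c>0. \<forall>t x. height x \<le> v * real t \<longrightarrow> 1 - occ t x (H 0) \<le> C * exp (- c * real t))"

definition upper_speed :: "real \<Rightarrow> bool" where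
  "upper_speed v \<longleftrightarrow> (\<exists>C. \<exists>c>0. \<forall>t x. v * real t \<le> height x \<longrightarrow> occ t x (H 0) \<le> C * exp (- c * real t))"

text \<open>Rounding \<open>t\<close> down to a multiple of \<open>S\<close> is harmless as
  \<open>occ\<close> increases in time. The lost steps go into the prefactor, and the drop from
  \<open>v2\<close> to \<open>v1\<close> gives the decay.\<close>

lemma lower_speedI_blocks:
  assumes S: "S > 0" and \<mu>: "\<mu> > 0" and v: "0 \<le> v2" "v1 < v2"
    and blocks: "\<And>n x. 1 - occ (n * S) x (H 0) \<le> exp (\<mu> * (height x - v2 * real (n * S)))"
  shows "lower_speed v1"
  unfolding lower_speed_def
proof (intro exI conjI allI impI)
  show "0 < \<mu> * (v2 - v1)" using \<mu> v by simp
  fix t :: nat and x assume x: "height x \<le> v1 * real t"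
  define n where "n = t div S"
  have n: "n * S \<le> t" "t \<le> n * S + S"
    using S by (simp_all add: n_def) (metis add.commute dividend_less_div_times less_imp_le)
  have "v2 * (real t - real S) \<le> v2 * real (n * S)"
    using n(2) v by (intro mult_left_mono) (auto simp flip: of_nat_add of_nat_mult)
  then have "height x - v2 * real (n * S) \<le> v2 * real S + - (v2 - v1) * real t"
    using x by (simp add: algebra_simps)
  then have le: "\<mu> * (height x - v2 * real (n * S)) \<le> \<mu> * v2 * real S + - (\<mu> * (v2 - v1)) * real t"
    using \<mu> mult_left_mono[of _ _ \<mu>] by (fastforce simp: algebra_simps)
  have "1 - occ t x (H 0) \<le> 1 - occ (n * S) x (H 0)" using n(1) occ_time_mono by simp
  also have "\<dots> \<le> exp (\<mu> * (height x - v2 * real (n * S)))" by (rule blocks)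
  also have "\<dots> \<le> exp (\<mu> * v2 * real S + - (\<mu> * (v2 - v1)) * real t)" using le by simp
  finally show "1 - occ t x (H 0) \<le> exp (\<mu> * v2 * real S) * exp (- (\<mu> * (v2 - v1)) * real t)"
    by (simp only: exp_add)
qed

lemma upper_speedI_blocks:
  assumes L: "L > 0" and \<mu>: "\<mu> > 0" and v: "0 \<le> v3" "v3 < v4"
    and blocks: "\<And>n x. occ (n * L) x (H 0) \<le> exp (- \<mu> * (height x - v3 * real (n * L)))"
  shows "upper_speed v4"
  unfolding upper_speed_def
proof (intro exI conjI allI impI)
  show "0 < \<mu> * (v4 - v3)" using \<mu> v by simp
  fix t :: nat and x assume x: "v4 * real t \<le> height x"
  \<comment> \<open>Rounded up, since here \<open>occ\<close> is bounded from above.\<close>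
  define n where "n = Suc (t div L)"
  have n: "t \<le> n * L" "n * L \<le> t + L"
    using L by (simp_all add: n_def add.commute) (metis dividend_less_div_times less_imp_le)
  have "v3 * real (n * L) \<le> v3 * (real t + real L)"
    using n(2) v by (intro mult_left_mono) (auto simp flip: of_nat_add of_nat_mult)
  then have "(v4 - v3) * real t - v3 * real L \<le> height x - v3 * real (n * L)"
    using x by (simp add: algebra_simps)
  then have "\<mu> * ((v4 - v3) * real t - v3 * real L) \<le> \<mu> * (height x - v3 * real (n * L))"
    using \<mu> by (intro mult_left_mono) auto
  then have le: "- \<mu> * (height x - v3 * real (n * L)) \<le> \<mu> * v3 * real L + - (\<mu> * (v4 - v3)) * real t"
    by (simp add: algebra_simps)
  have "occ t x (H 0) \<le> occ (n * L) x (H 0)" using n(1) by (rule occ_time_mono)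
  also have "\<dots> \<le> exp (- \<mu> * (height x - v3 * real (n * L)))" by (rule blocks)
  also have "\<dots> \<le> exp (\<mu> * v3 * real L + - (\<mu> * (v4 - v3)) * real t)" using le by simp
  finally show "occ t x (H 0) \<le> exp (\<mu> * v3 * real L) * exp (- (\<mu> * (v4 - v3)) * real t)"
    by (simp only: exp_add)
qed

text \<open>One good block suffices: take blocks of \<open>L = j * k ^ 4\<close> and \<open>S = (j + 1) * k ^ 4\<close> steps.
  Concentration decides at scale \<open>exp (- c * k\<^sup>2)\<close> between the two alternatives, which
  beats any power of the polynomial number of sites in a block.\<close>
lemma speed_dichotomy:
  assumes v: "0 \<le> v'" "v' < v"
  shows "lower_speed v' \<or> upper_speed v"
proof -
  \<comment> \<open>Intermediate speeds \<open>v' < v2 < v1 < v3 < v\<close>: the reference site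
    sits at height about \<open>v1 * L\<close>, and the recursions run at speed \<open>v2\<close>
    from below and \<open>v3\<close> from above.\<close>
  define g where "g = (v - v') / 4"
  define v2 where "v2 = v' + g"
  define v1 where "v1 = v' + 2 * g"
  define v3 where "v3 = v' + 3 * g"
  have g: "g > 0" using v by (simp add: g_def)
  have g4: "4 * g = v - v'" by (simp add: g_def)
  have vs: "v' < v2" "0 < v2" "0 < v3" "v3 < v" unfolding v2_def v3_def using v g g4 by linarith+
  \<comment> \<open>With \<open>j\<close> this large, the \<open>k ^ 4\<close> extra steps of the
    longer block cost at speed \<open>v2\<close> at most half of the margin \<open>g * L\<close>;
    the other half is \<open>\<theta> * k ^ 4\<close>.\<close>
  obtain j :: nat where j: "2 * v2 / g < real j" using reals_Archimedean2 by blast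
  have "0 < 2 * v2 / g" using vs g by simp
  then have j0: "real j > 0" using j by linarith
  define \<theta> where "\<theta> = real j * g / 2"
  have \<theta>: "\<theta> > 0" "v2 \<le> \<theta>" using j j0 g by (simp_all add: \<theta>_def pos_divide_less_eq)
  obtain r where seeds: "\<And>B x. reach (H 0) B \<Longrightarrow> x \<in> B \<Longrightarrow> seeded r x B"
    using seeds_exist by blast
  obtain m \<rho> where m: "m > 0" and \<rho>: "0 < \<rho>" "\<rho> < 1"
    and spread: "\<And>B x z n k. \<lbrakk>seeded r x B; z \<in> square x n\<rbrakk>
      \<Longrightarrow> 1 - occ (m * k) z B \<le> exp (real n + 1) * \<rho> ^ k"
    using spread[of r] by blast
  define \<kappa> where "\<kappa> = - ln \<rho>"
  have \<kappa>: "\<kappa> > 0" using \<rho> by (simp add: \<kappa>_def)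
  have \<rho>_pow: "\<rho> ^ k = exp (- \<kappa> * real k)" for k
    using \<rho> by (simp add: \<kappa>_def exp_of_nat2_mult)
  define a where "a = 2 * real radius * (real j + 1) + 1"
  have a: "a > 0" using j0 by (simp add: a_def add_nonneg_pos)
  define c where "c = 1 / (32 * (real j + 1) * (real m)\<^sup>2)"
  have c: "c > 0" using m by (simp add: c_def)
  \<comment> \<open>\<open>c0 * k ^ 4\<close> dominates the growth exponents, per unit of
    \<open>\<mu>\<close>, of the \<open>\<delta>\<close> terms in both recursions.\<close>
  define c0 where "c0 = v2 * (real j + 1) + 2 * real radius * real j"
  have c0: "c0 > 0" using vs j0 by (simp add: c0_def add_pos_nonneg)
  have "eventually (\<lambda>k::nat. (real j + 1) * exp (real radius + 1) * real k ^ 4 * (a * real k ^ 4 + 1)\<^sup>2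
      * exp (- \<kappa> * real k) \<le> 1) at_top"
    using a \<kappa> j0 by (intro eventually_spread_error_small) auto
  moreover have "eventually (\<lambda>k::nat. (1 + c0 / \<theta>) * ln (4 * (a * real k ^ 4 + 1)\<^sup>2) \<le> c / 2 * real k ^ 2) at_top"
    using a c c0 \<theta> by (intro eventually_entropy_small) (auto intro: add_pos_nonneg)
  moreover have "eventually (\<lambda>k::nat. 2 \<le> \<theta> * real k ^ 4) at_top"
    using \<theta>(1) by real_asymp
  ultimately have "eventually (\<lambda>k::nat. k > 0 \<and> 2 \<le> \<theta> * real k ^ 4 \<and>
      (1 + c0 / \<theta>) * ln (4 * (a * real k ^ 4 + 1)\<^sup>2) \<le> c / 2 * real k ^ 2 \<and>
      (real j + 1) * exp (real radius + 1) * real k ^ 4 * (a * real k ^ 4 + 1)\<^sup>2 * exp (- \<kappa> * real k) \<le> 1) at_top"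
    using eventually_gt_at_top[of "0::nat"] by eventually_elim auto
  then obtain k :: nat where k: "k > 0" "2 \<le> \<theta> * real k ^ 4"
    and entropy: "(1 + c0 / \<theta>) * ln (4 * (a * real k ^ 4 + 1)\<^sup>2) \<le> c / 2 * real k ^ 2"
    and err: "(real j + 1) * exp (real radius + 1) * real k ^ 4 * (a * real k ^ 4 + 1)\<^sup>2 * exp (- \<kappa> * real k) \<le> 1"
    using eventually_happens'[OF sequentially_bot] by blast
  define L where "L = j * k ^ 4"
  define S where "S = (j + 1) * k ^ 4"
  define K where "K = (a * real k ^ 4 + 1)\<^sup>2"
  \<comment> \<open>Twice the catch-up time \<open>m * k\<close>; the second half absorbs the
    spreading error, which is at most one.\<close>
  define D where "D = 2 * real m * real k"
  \<comment> \<open>Chosen so that a margin of \<open>\<theta> * k ^ 4\<close> yields the factor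
    \<open>1 / (4 * K)\<close>, paying for the number of sites.\<close>
  define \<mu> where "\<mu> = ln (4 * K) / (\<theta> * real k ^ 4)"
  \<comment> \<open>Square root of the concentration bound, so that one of the two factors in the
    product is at most \<open>\<delta>\<close>.\<close>
  define \<delta> where "\<delta> = exp (- (c / 2 * real k ^ 2))"
  have k4: "real k ^ 4 > 0" using k by simp
  have LS: "real L = real j * real k ^ 4" "real S = (real j + 1) * real k ^ 4" "L \<le> S" "L > 0" "S > 0"
    using j0 k by (simp_all add: L_def S_def algebra_simps)
  have K1: "1 \<le> K" using a unfolding K_def by (intro one_le_power) simp
  have \<mu>: "\<mu> > 0" using K1 \<theta> k4 by (simp add: \<mu>_def)
  have \<mu>k: "\<mu> * (\<theta> * real k ^ 4) = ln (4 * K)" using \<theta> k4 by (simp add: \<mu>_def)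
  have S_le: "2 * real (radius * S) + 1 \<le> a * real k ^ 4 + 1"
    using k4 by (simp add: a_def LS algebra_simps)
  have KS: "(2 * real (radius * S) + 1)\<^sup>2 \<le> K" unfolding K_def using S_le by (intro power_mono) auto
  have "2 * real (radius * L) + 1 \<le> 2 * real (radius * S) + 1"
    using LS(3) by (simp add: mult_left_mono del: of_nat_mult flip: of_nat_mult)
  then have "(2 * real (radius * L) + 1)\<^sup>2 \<le> (2 * real (radius * S) + 1)\<^sup>2" by (intro power_mono) auto
  then have KL: "(2 * real (radius * L) + 1)\<^sup>2 \<le> K" using KS by (rule order_trans)
  have cost: "exp (\<mu> * (c0 * real k ^ 4)) * \<delta> \<le> 1 / (4 * K)"
  proof -
    have "\<mu> * (c0 * real k ^ 4) = c0 / \<theta> * ln (4 * K)"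
      using \<theta> k4 by (simp add: \<mu>_def)
    then have "\<mu> * (c0 * real k ^ 4) + - (c / 2 * real k ^ 2) \<le> - ln (4 * K)"
      using entropy by (simp add: K_def algebra_simps)
    then have "exp (\<mu> * (c0 * real k ^ 4) + - (c / 2 * real k ^ 2)) \<le> exp (- ln (4 * K))" by simp
    also have "exp (- ln (4 * K)) = 1 / (4 * K)" using K1 by (simp add: exp_minus field_simps)
    finally show ?thesis by (simp only: exp_add \<delta>_def)
  qed
  have gain: "K * exp (- \<mu> * b) \<le> 1 / 4" if "\<theta> * real k ^ 4 \<le> b" for b
  proof -
    have "- \<mu> * b \<le> - ln (4 * K)" using mult_left_mono[OF that, of \<mu>] \<mu> by (simp add: \<mu>k)
    then have "exp (- \<mu> * b) \<le> exp (- ln (4 * K))" by simp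
    also have "exp (- ln (4 * K)) = 1 / (4 * K)" using K1 by (simp add: exp_minus field_simps)
    finally have "K * exp (- \<mu> * b) \<le> K * (1 / (4 * K))" using K1 by (intro mult_left_mono) auto
    then show ?thesis using K1 by simp
  qed
  have quarter: "1 / (4 * K) \<le> 1 / 4" using K1 by (simp add: field_simps)
  obtain z where z: "v1 * real L \<le> height z" "height z \<le> v1 * real L + 2"
    by (rule site_at_height)
  \<comment> \<open>Minimiser of the exponent \<open>2 * S * l^2 * D^2 - l * (S - L)\<close> for
    \<open>S - L = k^4\<close> and \<open>D = 2 * m * k\<close>; the minimum is
    \<open>- c * k^2\<close>.\<close>
  define l where "l = 1 / (16 * (real j + 1) * (real m)\<^sup>2 * (real k)\<^sup>2)"
  have l0: "0 \<le> l" by (simp add: l_def)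
  have mk: "1 \<le> real m * real k" using m k by (metis One_nat_def Suc_leI nat_0_less_mult_iff of_nat_1 of_nat_le_iff of_nat_mult)
  have lD: "l * D \<le> 1"
  proof -
    have alg: "1 / (16 * J * M\<^sup>2 * X\<^sup>2) * (2 * M * X) = 1 / (8 * J * (M * X))"
      if "J > 0" "M > 0" "X > 0" for J M X :: real
      using that by (simp add: power2_eq_square field_simps)
    have "l * D = 1 / (8 * (real j + 1) * (real m * real k))"
      unfolding l_def D_def by (rule alg) (use m k j0 in auto)
    also have "\<dots> \<le> 1" using mk j0 mult_mono[of 1 "8 * (real j + 1)" 1 "real m * real k"]
      by (simp add: divide_le_eq)
    finally show ?thesis .
  qed
  have Dbound: "real (m * k) + real S * (2 * real (radius * S) + 1)\<^sup>2 * (exp (real radius + 1) * \<rho> ^ k) \<le> D"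
  proof -
    have "real S * (2 * real (radius * S) + 1)\<^sup>2 * (exp (real radius + 1) * \<rho> ^ k)
      \<le> real S * K * (exp (real radius + 1) * \<rho> ^ k)"
      using KS \<rho> by (intro mult_right_mono mult_left_mono) auto
    also have "\<dots> \<le> 1" using err by (simp only: \<rho>_pow K_def LS(2) mult_ac)
    finally show ?thesis using mk unfolding D_def of_nat_mult by linarith
  qed
  have expo: "2 * real S * l\<^sup>2 * D\<^sup>2 - l * (real S - real L) = - (c * real k ^ 2)"
  proof -
    define A where "A = (real j + 1) * (real m)\<^sup>2 * (real k)\<^sup>2"
    have A: "A > 0" using m k j0 by (simp add: A_def)
    have lA: "l = 1 / (16 * A)" by (simp add: l_def A_def mult.assoc)
    have "real S * D\<^sup>2 = 4 * A * real k ^ 4"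
      by (simp add: LS D_def A_def power_mult_distrib mult_ac)
    then have "2 * real S * l\<^sup>2 * D\<^sup>2 = 8 * A * real k ^ 4 * l\<^sup>2" by simp
    also have "\<dots> = real k ^ 4 / (32 * A)" using A by (simp add: lA power2_eq_square field_simps)
    finally have 1: "2 * real S * l\<^sup>2 * D\<^sup>2 = real k ^ 4 / (32 * A)" .
    have 2: "l * (real S - real L) = 2 * (real k ^ 4 / (32 * A))"
      using A by (simp add: LS lA field_simps)
    have "X ^ 4 / (32 * (J * M\<^sup>2 * X\<^sup>2)) = 1 / (32 * J * M\<^sup>2) * X ^ 2"
      if "J > 0" "M > 0" "X > 0" for J M X :: real
      using that by (simp add: power2_eq_square power4_eq_xxxx field_simps)
    then have "real k ^ 4 / (32 * A) = c * real k ^ 2"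
      unfolding c_def A_def using m k j0 by simp
    then show ?thesis using 1 2 by simp
  qed
  have "occ L z (H 0) * (1 - occ S z (H 0)) \<le> exp (- (c * real k ^ 2))"
    using concentration[OF seeds spread _ Dbound l0 lD LS(3), where z = z] \<rho> expo by simp
  also have "\<dots> = \<delta> * \<delta>" by (simp add: \<delta>_def flip: exp_add)
  finally have prod: "occ L z (H 0) * (1 - occ S z (H 0)) \<le> \<delta> * \<delta>" .
  have \<delta>0: "\<delta> > 0" by (simp add: \<delta>_def)
  consider "1 - occ S z (H 0) \<le> \<delta>" | "occ L z (H 0) \<le> \<delta>"
    using prod mult_strict_mono[of \<delta> "occ L z (H 0)" \<delta> "1 - occ S z (H 0)"] \<delta>0 by fastforce
  then show ?thesis
  proof cases
    case 1
    have "v2 * real S = v2 * real L + v2 * real k ^ 4" by (simp add: LS algebra_simps)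
    also have "\<dots> \<le> v2 * real L + \<theta> * real k ^ 4" using \<theta>(2) k4 by (simp add: mult_right_mono)
    also have "\<dots> = v1 * real L - \<theta> * real k ^ 4" by (simp add: LS \<theta>_def v1_def v2_def algebra_simps)
    finally have h: "\<theta> * real k ^ 4 \<le> height z - v2 * real S" using z by linarith
    have "v2 * real S \<le> c0 * real k ^ 4" using k4 by (simp add: LS c0_def algebra_simps)
    then have "exp (\<mu> * (v2 * real S)) \<le> exp (\<mu> * (c0 * real k ^ 4))" using \<mu> by simp
    from mult_right_mono[OF this less_imp_le[OF \<delta>0]] have "exp (\<mu> * (v2 * real S)) * \<delta> \<le> 1 / (4 * K)"
      using cost by linarith
    then have "\<delta> * exp (\<mu> * v2 * real S) \<le> 1 / (4 * K)" by (simp only: mult_ac)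
    then have "K * exp (- \<mu> * (height z - v2 * real S)) + \<delta> * exp (\<mu> * v2 * real S) \<le> 1"
      using gain[OF h] quarter by linarith
    from block_lower[OF 1 \<mu> KS this] have "lower_speed v'"
      using LS \<mu> vs by (intro lower_speedI_blocks[of S \<mu> v2]) auto
    then show ?thesis ..
  next
    case 2
    have "v3 * real L - v1 * real L = 2 * (\<theta> * real k ^ 4)"
      by (simp add: LS v3_def v1_def \<theta>_def algebra_simps)
    then have h: "\<theta> * real k ^ 4 \<le> v3 * real L - height z" using z k by linarith
    have "2 * real (radius * L) - v3 * real L \<le> 2 * real radius * real j * real k ^ 4"
      using vs by (simp add: LS)
    also have "\<dots> \<le> c0 * real k ^ 4" using k4 vs j0 by (intro mult_right_mono) (auto simp: c0_def)
    finally have "exp (\<mu> * (2 * real (radius * L) - v3 * real L)) \<le> exp (\<mu> * (c0 * real k ^ 4))"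
      using \<mu> by simp
    from mult_right_mono[OF this less_imp_le[OF \<delta>0]]
    have "exp (\<mu> * (2 * real (radius * L) - v3 * real L)) * \<delta> \<le> 1 / (4 * K)"
      using cost by linarith
    from mult_left_mono[OF this, of K] have "\<delta> * K * exp (\<mu> * (2 * real (radius * L) - v3 * real L)) \<le> 1 / 4"
      using K1 by (simp add: mult_ac)
    then have "K * exp (- \<mu> * (v3 * real L - height z))
        + \<delta> * K * exp (\<mu> * (2 * real (radius * L) - v3 * real L)) \<le> 1"
      using gain[OF h] by linarith
    from block_upper[OF 2 \<mu> KL this] have "upper_speed v"
      using LS \<mu> vs by (intro upper_speedI_blocks[of L \<mu> v3]) auto
    then show ?thesis ..
  qed
qed

lemma lower_speed_mono: "lower_speed v \<Longrightarrow> v' \<le> v \<Longrightarrow> lower_speed v'"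
  unfolding lower_speed_def by (meson mult_right_mono of_nat_0_le_iff order_trans)

text \<open>Spreading alone gives a positive speed: a site of height up to \<open>v * t\<close> is
  within distance of that order from a seeded site of \<open>H 0\<close>.\<close>

lemma ex_positive_lower_speed: "\<exists>v>0. lower_speed v"
proof -
  obtain r where seeds: "\<And>B x. reach (H 0) B \<Longrightarrow> x \<in> B \<Longrightarrow> seeded r x B"
    using seeds_exist by blast
  obtain m \<rho> where m: "m > 0" and \<rho>: "0 < \<rho>" "\<rho> < 1"
    and spread: "\<And>B x z n k. \<lbrakk>seeded r x B; z \<in> square x n\<rbrakk>
      \<Longrightarrow> 1 - occ (m * k) z B \<le> exp (real n + 1) * \<rho> ^ k"
    using spread[of r] by blast
  define \<kappa> where "\<kappa> = - ln \<rho>"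
  have \<kappa>: "\<kappa> > 0" using \<rho> by (simp add: \<kappa>_def)
  have \<rho>_pow: "\<rho> ^ k = exp (- \<kappa> * real k)" for k
    using \<rho> by (simp add: \<kappa>_def exp_of_nat2_mult)
  \<comment> \<open>Half of the decay rate \<open>\<kappa> / m\<close> pays for the distance; the
    other half remains.\<close>
  define v where "v = \<kappa> / (2 * real m)"
  have v: "v > 0" using \<kappa> m by (simp add: v_def)
  have "1 - occ t x (H 0) \<le> exp (4 + \<kappa>) * exp (- v * real t)" if x: "height x \<le> v * real t" for t x
  proof (cases "height x \<le> 0")
    case True
    then show ?thesis by (simp add: occ_occupied)
  next
    case False
    define n where "n = nat \<lceil>height x\<rceil> + 2"
    obtain z where z: "height x \<le> height z" "z \<in> square 0 n"
      using site_at_height[of "height x"] False unfolding n_def by (metis abs_of_pos not_le)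
    have "x - z \<in> H 0" using z by (simp add: height_diff)
    then have "seeded r (x - z) (H 0)" using seeds reach_refl by blast
    moreover have "x \<in> square (x - z) n" using z by (auto simp: square_def)
    ultimately have s: "1 - occ (m * (t div m)) x (H 0) \<le> exp (real n + 1) * \<rho> ^ (t div m)"
      by (rule spread)
    have "real n \<le> v * real t + 3" using x False by (simp add: n_def) linarith
    moreover have "real t / real m - 1 \<le> real (t div m)"
    proof -
      have "real t \<le> real (m * (t div m) + m)"
        unfolding of_nat_le_iff using m by (metis add.commute dividend_less_times_div less_imp_le)
      then show ?thesis using m by (simp add: field_simps)
    qed
    then have "\<kappa> * (real t / real m - 1) \<le> \<kappa> * real (t div m)" using \<kappa> by (intro mult_left_mono) auto
    moreover have "\<kappa> * (real t / real m - 1) = 2 * v * real t - \<kappa>" using m by (simp add: v_def field_simps)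
    ultimately have "(real n + 1) + - \<kappa> * real (t div m) \<le> (4 + \<kappa>) + - v * real t" by simp
    then have "exp ((real n + 1) + - \<kappa> * real (t div m)) \<le> exp ((4 + \<kappa>) + - v * real t)" by simp
    moreover have "occ (m * (t div m)) x (H 0) \<le> occ t x (H 0)" by (rule occ_time_mono) simp
    ultimately show ?thesis using s by (simp only: exp_add \<rho>_pow)
  qed
  then show ?thesis unfolding lower_speed_def using v by blast
qed

text \<open>A faster half-space would contain, at a large time, a site outside the light cone of
  \<open>T\<close>, where occupation has probability zero.\<close>

lemma lower_speed_le_CA_velocity:
  assumes "lower_speed v" shows "v \<le> CA_velocity"
proof (rule ccontr)
  assume v: "\<not> v \<le> CA_velocity"
  obtain C c where c: "c > 0" and bound: "\<And>t x. height x \<le> v * real t \<Longrightarrow> 1 - occ t x (H 0) \<le> C * exp (- c * real t)"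
    using assms unfolding lower_speed_def by blast
  have linear: "eventually (\<lambda>t::nat. d * real t > 2) at_top" if "d > 0" for d :: real
    using that by real_asymp
  have "((\<lambda>t::nat. C * exp (- c * real t)) \<longlongrightarrow> 0) at_top" using c by real_asymp
  then have "eventually (\<lambda>t::nat. C * exp (- c * real t) < 1) at_top"
    by (rule order_tendstoD) simp
  moreover have "eventually (\<lambda>t::nat. (v - CA_velocity) * real t > 2) at_top"
    using v by (intro linear) simp
  ultimately have "eventually (\<lambda>t::nat. C * exp (- c * real t) < 1 \<and> (v - CA_velocity) * real t > 2) at_top"
    by (rule eventually_conj)
  then obtain t :: nat where t: "C * exp (- c * real t) < 1" "(v - CA_velocity) * real t > 2"
    using eventually_happens'[OF sequentially_bot] by blast
  obtain x where x: "v * real t - 2 \<le> height x" "height x \<le> v * real t - 2 + 2" by (rule site_at_height)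
  have "x \<notin> (T ^^ t) (H 0)" unfolding T_pow_H using x(1) t(2) by (simp add: algebra_simps)
  then have "occ t x (H 0) \<le> 0" using occ_le_T_pow[of t x "H 0"] by simp
  then show False using bound[of x t] x(2) t(1) by simp
qed

section \<open>The velocity and exact advance with positive probability\<close>

definition velocity :: real where
  "velocity = Sup {v. lower_speed v}"

lemma bdd_above_lower_speeds: "bdd_above {v. lower_speed v}"
  using lower_speed_le_CA_velocity by (auto intro!: bdd_aboveI)

lemma velocity_pos: "velocity > 0"
proof -
  obtain v where v: "v > 0" "lower_speed v" using ex_positive_lower_speed by blast
  then have "v \<le> velocity" unfolding velocity_def by (intro cSup_upper bdd_above_lower_speeds) simp
  then show ?thesis using v by simp
qed

lemma velocity_le_CA_velocity: "velocity \<le> CA_velocity"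
  unfolding velocity_def using ex_positive_lower_speed lower_speed_le_CA_velocity
  by (intro cSup_least) auto

lemma lower_speed_below_velocity: "v < velocity \<Longrightarrow> lower_speed v"
  unfolding velocity_def using ex_positive_lower_speed
  by (subst (asm) less_cSup_iff[OF _ bdd_above_lower_speeds]) (auto intro: lower_speed_mono)

lemma lower_speed_le_velocity: "lower_speed v \<Longrightarrow> v \<le> velocity"
  unfolding velocity_def by (intro cSup_upper bdd_above_lower_speeds) simp

lemma upper_speed_above_velocity:
  assumes "velocity < v" shows "upper_speed v"
proof -
  \<comment> \<open>The midpoint already exceeds the supremum and leaves room for the dichotomy
    below \<open>v\<close>.\<close>
  have "\<not> lower_speed ((velocity + v) / 2)" using lower_speed_le_velocity assms by fastforce
  then show ?thesis using speed_dichotomy[of "(velocity + v) / 2" v] velocity_pos assms by auto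
qed

lemma prob_H_pos: "height x \<le> a + velocity \<Longrightarrow> prob (H a) x > 0"
  unfolding T_iff[symmetric] CA_velocity(2) using velocity_le_CA_velocity by simp

text \<open>If \<open>x\<close> were occupied deterministically from \<open>H a\<close>, then half-spaces would advance
  deterministically by \<open>height x - a\<close> in every step.\<close>
lemma prob_H_less_1:
  assumes "height x > a + velocity" shows "prob (H a) x < 1"
proof (rule ccontr)
  assume "\<not> prob (H a) x < 1"
  then have p1: "prob (H a) x = 1" using prob_bounds(2)[of "H a" x] by simp
  define s where "s = height x - a"
  have sure: "prob (H b) y = 1" if "height y \<le> b + s" for b y
  proof -
    have "(+) (y - x) ` H a \<subseteq> H b" unfolding H_shift using that by (intro H_mono) (simp add: s_def height_diff)
    from prob_mono[OF this, of y] show ?thesis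
      using prob_shift[of "y - x" "H a" x] p1 prob_bounds(2)[of "H b" y] by simp
  qed
  \<comment> \<open>The hypothesis on \<open>B\<close> is confined to the dependence square of
    \<open>y\<close>, because the windowed growth is frozen outside \<open>W\<close>.\<close>
  have reached: "1 \<le> steps W t (\<lambda>A. of_bool (y \<in> A)) B"
    if "finite W" "square y (radius * t) \<subseteq> W" "H b \<inter> square y (radius * t) \<subseteq> B" "height y \<le> b + real t * s"
    for W t y B b
    using that(2-)
  proof (induction t arbitrary: b B)
    case 0
    then have "y \<in> B" using centre_in_square[of y 0] by auto
    then show ?case by simp
  next
    case (Suc t)
    have sub: "square y (radius * t) \<subseteq> square y (radius * Suc t)" by (rule square_mono) simp
    have "step W (\<lambda>_. 1) B \<le> step W (steps W t (\<lambda>A. of_bool (y \<in> A))) B"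
    proof (rule step_mono[OF that(1)])
      fix B' assume B': "\<And>x. \<lbrakk>x \<in> W; prob B x = 1\<rbrakk> \<Longrightarrow> x \<in> B'"
      show "1 \<le> steps W t (\<lambda>A. of_bool (y \<in> A)) B'"
      proof (rule Suc.IH[where b = "b + s"])
        show "square y (radius * t) \<subseteq> W" using sub Suc.prems(1) by blast
        show "height y \<le> b + s + real t * s" using Suc.prems(3) by (simp add: algebra_simps)
        show "H (b + s) \<inter> square y (radius * t) \<subseteq> B'"
        proof
          fix x assume x: "x \<in> H (b + s) \<inter> square y (radius * t)"
          then have "square x radius \<subseteq> square y (radius * t + radius)" by (intro square_subset) auto
          then have "H b \<inter> square x radius \<subseteq> B" using Suc.prems(2) by (auto simp: algebra_simps)
          then have "(B \<union> H b) \<inter> square x radius = B \<inter> square x radius" by blast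
          then have "prob (B \<union> H b) x = prob B x" by (rule prob_local)
          moreover have "prob (H b) x \<le> prob (B \<union> H b) x" by (rule prob_mono) simp
          moreover have "prob (H b) x = 1" using x by (intro sure) simp
          ultimately have "prob B x = 1" using prob_bounds(2)[of B x] by simp
          then show "x \<in> B'" using x sub Suc.prems(1) by (intro B') auto
        qed
      qed
    qed
    then show ?case using that(1) by simp
  qed
  have "1 - occ t y (H 0) \<le> 1 * exp (- 1 * real t)" if "height y \<le> s * real t" for t y
  proof -
    have "1 \<le> occ t y (H 0)"
      unfolding occ_def using that by (intro reached[where b = 0]) (auto simp: mult.commute)
    then show ?thesis by (simp add: order_trans[OF _ exp_ge_zero])
  qed
  then have "lower_speed s" unfolding lower_speed_def by (intro exI[of _ 1] conjI) auto
  then show False using lower_speed_le_velocity assms by (fastforce simp: s_def)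
qed

text \<open>On a finite set, the pattern of the next half-space is a finite product of positive
  factors: sites behind the new front can be filled, sites ahead of it can stay vacant. Going back
  one step enlarges the set by \<open>radius\<close>.\<close>

lemma steady_advance_positive:
  "\<exists>q>0. \<forall>W. finite W \<longrightarrow> square 0 (r + radius * t) \<subseteq> W \<longrightarrow>
    q \<le> steps W t (\<lambda>A. of_bool (A \<inter> square 0 r = H (real t * velocity) \<inter> square 0 r)) (H 0)"
proof (induction t arbitrary: r)
  case 0
  show ?case by (intro exI[of _ 1]) auto
next
  case (Suc t)
  define F where "F = square (0::site) r"
  define G where "G = square (0::site) (r + radius)"
  define f :: "site set \<Rightarrow> real" where "f = (\<lambda>A. of_bool (A \<inter> F = H (real (Suc t) * velocity) \<inter> F))"
  define g :: "site set \<Rightarrow> real" where "g = (\<lambda>A. of_bool (A \<inter> G = H (real t * velocity) \<inter> G))"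
  \<comment> \<open>Probability of seeing exactly the advanced half-space on \<open>F\<close> one
    step after the half-space at time \<open>t\<close>.\<close>
  define q1 where "q1 = subset_weight F (prob (H (real t * velocity))) (H (real (Suc t) * velocity) \<inter> F)"
  have q1: "q1 > 0"
    unfolding q1_def subset_weight_def
    by (intro mult_pos_pos prod_pos) (auto intro!: prob_H_pos simp: algebra_simps prob_H_less_1)
  obtain q where q: "q > 0" "\<And>W. finite W \<Longrightarrow> square 0 (r + radius + radius * t) \<subseteq> W \<Longrightarrow> q \<le> steps W t g (H 0)"
    using Suc.IH[of "r + radius"] unfolding g_def G_def by blast
  have "q1 * q \<le> steps W (Suc t) f (H 0)"
    if W: "finite W" "square 0 (r + radius * Suc t) \<subseteq> W" for W
  proof -
    have FW: "F \<subseteq> W" using W(2) square_mono[of r "r + radius * Suc t" 0] by (auto simp: F_def)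
    have dep: "depends_on f F" unfolding depends_on_def f_def by simp
    have "q1 * g B \<le> step W f B" for B
    proof (cases "B \<inter> G = H (real t * velocity) \<inter> G")
      case True
      have "step W f B = step W f (H (real t * velocity))"
        using depends_on_step[OF W(1) dep[unfolded F_def]] True[unfolded G_def] by (rule depends_onD)
      also have "\<dots> = subset_mean F (prob (H (real t * velocity))) f"
        by (rule step_local[OF W(1) dep FW])
      also have "\<dots> = q1" unfolding f_def q1_def by (intro subset_mean_point) (auto simp: F_def)
      finally show ?thesis using True by (simp add: g_def)
    next
      case False
      have "step W (\<lambda>_. 0) B \<le> step W f B" using W(1) by (intro step_mono) (auto simp: f_def)
      then show ?thesis using False W(1) by (simp add: g_def)
    qed
    then have "steps W t (\<lambda>B. q1 * g B) (H 0) \<le> steps W t (step W f) (H 0)"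
      using W(1) by (intro steps_mono)
    moreover have "q \<le> steps W t g (H 0)" using W by (intro q(2)) (simp_all add: algebra_simps)
    then have "q1 * q \<le> q1 * steps W t g (H 0)" using q1 by simp
    ultimately show ?thesis by (simp add: steps_cmult funpow_swap1)
  qed
  then show ?case using q1 q(1) unfolding f_def F_def by (intro exI[of _ "q1 * q"]) simp
qed

section \<open>Probability of the two inclusions\<close>

definition good_shape :: "real \<Rightarrow> nat \<Rightarrow> site set \<Rightarrow> bool" where
  "good_shape \<epsilon> t A \<longleftrightarrow>
    H (real t * (velocity - \<epsilon>)) \<inter> lattice_ball (real t ^ 2) \<subseteq> A \<inter> lattice_ball (real t ^ 2) \<and>
    A \<inter> lattice_ball (real t ^ 2) \<subseteq> H (real t * (velocity + \<epsilon>)) \<inter> lattice_ball (real t ^ 2)"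

lemma lattice_ball_subset: "lattice_ball (real t ^ 2) \<subseteq> square 0 (t ^ 2)"
proof
  fix x assume "x \<in> lattice_ball (real t ^ 2)"
  then have "dist (to_plane x) (to_plane 0) \<le> real (t ^ 2)"
    by (simp add: lattice_ball_def to_plane_def flip: zero_prod_def)
  from in_square_if_dist[OF this] show "x \<in> square 0 (t ^ 2)" by (simp only: ceiling_of_nat nat_int)
qed

lemma depends_on_good_shape: "depends_on (\<lambda>A. of_bool (good_shape \<epsilon> t A) :: real) (square 0 (t ^ 2))"
  unfolding depends_on_def
proof (intro allI impI)
  fix A B assume "A \<inter> square 0 (t ^ 2) = B \<inter> square 0 (t ^ 2)"
  then have "A \<inter> lattice_ball (real t ^ 2) = B \<inter> lattice_ball (real t ^ 2)"
    using lattice_ball_subset by blast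
  then show "of_bool (good_shape \<epsilon> t A) = (of_bool (good_shape \<epsilon> t B) :: real)"
    by (simp add: good_shape_def)
qed

text \<open>Union bound over the order \<open>t^4\<close> sites of the square, each misplaced with
  exponentially small probability.\<close>

lemma good_shape_large_times:
  assumes "\<epsilon> > 0"
  shows "\<exists>C\<ge>0. \<exists>c>0. \<forall>t W. finite W \<longrightarrow> square 0 (t ^ 2 + radius * t) \<subseteq> W \<longrightarrow>
    1 - C * (2 * real t ^ 2 + 1)\<^sup>2 * exp (- c * real t) \<le> steps W t (\<lambda>A. of_bool (good_shape \<epsilon> t A)) (H 0)"
proof -
  have "lower_speed (velocity - \<epsilon>)" using assms by (intro lower_speed_below_velocity) simp
  then obtain C1 c1 where c1: "c1 > 0" "\<And>t x. height x \<le> (velocity - \<epsilon>) * real t \<Longrightarrow> 1 - occ t x (H 0) \<le> C1 * exp (- c1 * real t)"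
    unfolding lower_speed_def by blast
  have "upper_speed (velocity + \<epsilon>)" using assms by (intro upper_speed_above_velocity) simp
  then obtain C2 c2 where c2: "c2 > 0" "\<And>t x. (velocity + \<epsilon>) * real t \<le> height x \<Longrightarrow> occ t x (H 0) \<le> C2 * exp (- c2 * real t)"
    unfolding upper_speed_def by blast
  define C where "C = \<bar>C1\<bar> + \<bar>C2\<bar>"
  define c where "c = min c1 c2"
  have c: "c > 0" using c1 c2 by (simp add: c_def)
  have exp1: "C1 * exp (- c1 * real t) \<le> \<bar>C1\<bar> * exp (- c * real t)"
    and exp2: "C2 * exp (- c2 * real t) \<le> \<bar>C2\<bar> * exp (- c * real t)" for t
    by (intro mult_mono; simp add: c_def mult_right_mono)+
  have "1 - C * (2 * real t ^ 2 + 1)\<^sup>2 * exp (- c * real t) \<le> steps W t (\<lambda>A. of_bool (good_shape \<epsilon> t A)) (H 0)"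
    if W: "finite W" "square 0 (t ^ 2 + radius * t) \<subseteq> W" for t W
  proof -
    define Q where "Q = square (0::site) (t ^ 2)"
    define Y where "Y = {x \<in> Q. height x \<le> (velocity - \<epsilon>) * real t}"
    define Z where "Z = {x \<in> Q. (velocity + \<epsilon>) * real t < height x}"
    have finQ: "finite Q" and fin: "finite Y" "finite Z" by (simp_all add: Y_def Z_def Q_def)
    have sub: "lattice_ball (real t ^ 2) \<subseteq> Q" unfolding Q_def by (rule lattice_ball_subset)
    have pointwise: "1 - ((\<Sum>x\<in>Y. 1 - of_bool (x \<in> A)) + (\<Sum>x\<in>Z. of_bool (x \<in> A)))
        \<le> (of_bool (good_shape \<epsilon> t A) :: real)" for A
    proof -
      have nn: "0 \<le> (\<Sum>x\<in>Y. 1 - of_bool (x \<in> A) :: real)" "0 \<le> (\<Sum>x\<in>Z. of_bool (x \<in> A) :: real)"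
        by (auto intro: sum_nonneg)
      show ?thesis
      proof (cases "Y \<subseteq> A \<and> Z \<inter> A = {}")
        case True
        then have "good_shape \<epsilon> t A"
          unfolding good_shape_def using sub by (fastforce simp: Y_def Z_def mult.commute)
        then show ?thesis using nn by simp
      next
        case False
        from False consider y where "y \<in> Y" "y \<notin> A" | y where "y \<in> Z" "y \<in> A" by blast
        then have "1 \<le> (\<Sum>x\<in>Y. 1 - of_bool (x \<in> A) :: real) + (\<Sum>x\<in>Z. of_bool (x \<in> A))"
        proof cases
          case 1
          have "1 - of_bool (y \<in> A) \<le> (\<Sum>x\<in>Y. 1 - of_bool (x \<in> A) :: real)"
            using 1 fin by (intro member_le_sum[where f = "\<lambda>x. 1 - of_bool (x \<in> A)"]) auto
          then show ?thesis using 1 nn by simp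
        next
          case 2
          have "of_bool (y \<in> A) \<le> (\<Sum>x\<in>Z. of_bool (x \<in> A) :: real)"
            using 2 fin by (intro member_le_sum[where f = "\<lambda>x. of_bool (x \<in> A)"]) auto
          then show ?thesis using 2 nn by simp
        qed
        moreover have "0 \<le> (of_bool (good_shape \<epsilon> t A) :: real)" by simp
        ultimately show ?thesis by linarith
      qed
    qed
    have occ: "steps W t (\<lambda>A. of_bool (x \<in> A)) = occ t x" if "x \<in> Q" for x
    proof -
      have "square x (radius * t) \<subseteq> W" using square_subset[OF that[unfolded Q_def], of "radius * t"] W(2) by blast
      then show ?thesis by (rule steps_occ[OF W(1)])
    qed
    have "(\<Sum>x\<in>Y. 1 - occ t x (H 0)) \<le> (\<Sum>x\<in>Y. \<bar>C1\<bar> * exp (- c * real t))"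
      using order_trans[OF c1(2) exp1] by (intro sum_mono) (simp add: Y_def)
    also have "\<dots> \<le> real (card Q) * (\<bar>C1\<bar> * exp (- c * real t))"
      using finQ card_mono[of Q Y] by (simp add: Y_def mult_right_mono)
    finally have Y: "(\<Sum>x\<in>Y. 1 - occ t x (H 0)) \<le> real (card Q) * (\<bar>C1\<bar> * exp (- c * real t))" .
    have "(\<Sum>x\<in>Z. occ t x (H 0)) \<le> (\<Sum>x\<in>Z. \<bar>C2\<bar> * exp (- c * real t))"
      using order_trans[OF c2(2) exp2] by (intro sum_mono) (simp add: Z_def)
    also have "\<dots> \<le> real (card Q) * (\<bar>C2\<bar> * exp (- c * real t))"
      using finQ card_mono[of Q Z] by (simp add: Z_def mult_right_mono)
    finally have Z: "(\<Sum>x\<in>Z. occ t x (H 0)) \<le> real (card Q) * (\<bar>C2\<bar> * exp (- c * real t))" .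
    have card: "real (card Q) = (2 * real t ^ 2 + 1)\<^sup>2"
      by (simp add: Q_def card_square add.commute)
    have "1 - C * (2 * real t ^ 2 + 1)\<^sup>2 * exp (- c * real t)
        = 1 - (real (card Q) * (\<bar>C1\<bar> * exp (- c * real t)) + real (card Q) * (\<bar>C2\<bar> * exp (- c * real t)))"
      unfolding C_def card by (simp only: distrib_left distrib_right mult_ac)
    also have "\<dots> \<le> 1 - ((\<Sum>x\<in>Y. 1 - occ t x (H 0)) + (\<Sum>x\<in>Z. occ t x (H 0)))"
      using Y Z by linarith
    also have "\<dots> = 1 - ((\<Sum>x\<in>Y. 1 - steps W t (\<lambda>A. of_bool (x \<in> A)) (H 0))
        + (\<Sum>x\<in>Z. steps W t (\<lambda>A. of_bool (x \<in> A)) (H 0)))"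
      using occ by (simp add: Y_def Z_def)
    also have "\<dots> = steps W t (\<lambda>A. 1 - ((\<Sum>x\<in>Y. 1 - of_bool (x \<in> A)) + (\<Sum>x\<in>Z. of_bool (x \<in> A)))) (H 0)"
      by (simp only: steps_add steps_sum steps_diff steps_const[OF W(1)])
    also have "\<dots> \<le> steps W t (\<lambda>A. of_bool (good_shape \<epsilon> t A)) (H 0)"
      using W(1) pointwise by (rule steps_mono)
    finally show ?thesis .
  qed
  then show ?thesis using c by (intro exI[of _ C] exI[of _ c] conjI) (auto simp: C_def)
qed

text \<open>Halving the rate absorbs the polynomial prefactor from some time \<open>t0\<close> on.
  The finitely many earlier times are covered by exact advance, which has positive
  probability.\<close>

lemma good_shape_probability:
  assumes "\<epsilon> > 0"
  shows "\<exists>c>0. \<forall>t W. finite W \<longrightarrow> square 0 (t ^ 2 + radius * t) \<subseteq> W \<longrightarrow>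
    1 - exp (- c * real t) \<le> steps W t (\<lambda>A. of_bool (good_shape \<epsilon> t A)) (H 0)"
proof -
  obtain C c where C: "C \<ge> 0" "c > 0" and large: "\<And>t W. finite W \<Longrightarrow> square 0 (t ^ 2 + radius * t) \<subseteq> W \<Longrightarrow>
    1 - C * (2 * real t ^ 2 + 1)\<^sup>2 * exp (- c * real t) \<le> steps W t (\<lambda>A. of_bool (good_shape \<epsilon> t A)) (H 0)"
    using good_shape_large_times[OF assms] by blast
  have "((\<lambda>t::nat. C * (2 * real t ^ 2 + 1)\<^sup>2 * exp (- (c / 2) * real t)) \<longlongrightarrow> 0) at_top"
    using C(2) by real_asymp
  then have "eventually (\<lambda>t::nat. C * (2 * real t ^ 2 + 1)\<^sup>2 * exp (- (c / 2) * real t) < 1) at_top"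
    by (rule order_tendstoD) simp
  then obtain t0 where t0: "\<And>t::nat. t \<ge> t0 \<Longrightarrow> C * (2 * real t ^ 2 + 1)\<^sup>2 * exp (- (c / 2) * real t) < 1"
    unfolding eventually_at_top_linorder by blast
  have "\<exists>q>0. \<forall>W. finite W \<longrightarrow> square 0 (t ^ 2 + radius * t) \<subseteq> W \<longrightarrow>
    q \<le> steps W t (\<lambda>A. of_bool (good_shape \<epsilon> t A)) (H 0)" for t
  proof -
    obtain q where q: "q > 0" "\<And>W. finite W \<Longrightarrow> square 0 (t ^ 2 + radius * t) \<subseteq> W \<Longrightarrow>
      q \<le> steps W t (\<lambda>A. of_bool (A \<inter> square 0 (t ^ 2) = H (real t * velocity) \<inter> square 0 (t ^ 2))) (H 0)"
      using steady_advance_positive[of "t ^ 2" t] by blast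
    have "good_shape \<epsilon> t A" if A: "A \<inter> square 0 (t ^ 2) = H (real t * velocity) \<inter> square 0 (t ^ 2)" for A
    proof -
      have eq: "A \<inter> lattice_ball (real t ^ 2) = H (real t * velocity) \<inter> lattice_ball (real t ^ 2)"
        using A lattice_ball_subset by blast
      have "real t * (velocity - \<epsilon>) \<le> real t * velocity" "real t * velocity \<le> real t * (velocity + \<epsilon>)"
        using assms by (simp_all add: mult_left_mono)
      then show ?thesis unfolding good_shape_def eq using H_mono by blast
    qed
    then have le: "(of_bool (A \<inter> square 0 (t ^ 2) = H (real t * velocity) \<inter> square 0 (t ^ 2)) :: real)
        \<le> of_bool (good_shape \<epsilon> t A)" for A by auto
    have "q \<le> steps W t (\<lambda>A. of_bool (good_shape \<epsilon> t A)) (H 0)"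
      if W: "finite W" "square 0 (t ^ 2 + radius * t) \<subseteq> W" for W
      using q(2)[OF W] steps_mono[OF W(1) le] by (rule order_trans)
    then show ?thesis using q(1) by blast
  qed
  then obtain q where q: "\<And>t. q t > 0" "\<And>t W. finite W \<Longrightarrow> square 0 (t ^ 2 + radius * t) \<subseteq> W \<Longrightarrow>
    q t \<le> steps W t (\<lambda>A. of_bool (good_shape \<epsilon> t A)) (H 0)"
    by metis
  \<comment> \<open>For \<open>t < t0\<close> this gives
    \<open>1 - exp (- c' * t) \<le> c' * t \<le> q t\<close>; the denominator \<open>t + 1\<close>
    avoids dividing by zero.\<close>
  define c' where "c' = Min (insert (c / 2) ((\<lambda>t. q t / (real t + 1)) ` {..<t0}))"
  have c': "c' > 0" using C(2) q(1) by (auto simp: c'_def intro!: divide_pos_pos add_nonneg_pos)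
  have c'_le: "c' \<le> c / 2" "t < t0 \<Longrightarrow> c' \<le> q t / (real t + 1)" for t
    unfolding c'_def by (rule Min_le; simp)+
  have "1 - exp (- c' * real t) \<le> steps W t (\<lambda>A. of_bool (good_shape \<epsilon> t A)) (H 0)"
    if W: "finite W" "square 0 (t ^ 2 + radius * t) \<subseteq> W" for t W
  proof (cases "t < t0")
    case True
    have "1 - exp (- c' * real t) \<le> c' * real t" using exp_ge_add_one_self[of "- c' * real t"] by simp
    also have "\<dots> \<le> c' * (real t + 1)" using c' by simp
    also have "\<dots> \<le> q t" using c'_le(2)[OF True] by (simp add: pos_le_divide_eq)
    also have "\<dots> \<le> steps W t (\<lambda>A. of_bool (good_shape \<epsilon> t A)) (H 0)" by (rule q(2)[OF W])
    finally show ?thesis .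
  next
    case False
    have "exp (- c * real t) = exp (- (c / 2) * real t) * exp (- (c / 2) * real t)"
      by (simp flip: exp_add)
    then have "C * (2 * real t ^ 2 + 1)\<^sup>2 * exp (- c * real t)
        = (C * (2 * real t ^ 2 + 1)\<^sup>2 * exp (- (c / 2) * real t)) * exp (- (c / 2) * real t)"
      by (simp only: mult.assoc)
    also have "\<dots> \<le> 1 * exp (- (c / 2) * real t)"
      using t0[of t] False by (intro mult_right_mono) auto
    also have "\<dots> \<le> exp (- c' * real t)" using mult_right_mono[OF c'_le(1), of "real t"] by simp
    finally show ?thesis using large[OF W] by linarith
  qed
  then show ?thesis using c' by blast
qed

end

theorem theorem1:
  fixes N :: "site set" and \<pi> :: "site set \<Rightarrow> real" and p :: real
    and T :: "site set \<Rightarrow> site set" and u :: "real \<times> real"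
  assumes "perturbation N \<pi> p T"
    and "locally_regular T"
    and "supercritical T"
    and "norm u = 1"
  shows "\<exists>w>0. \<forall>\<epsilon>>0. \<exists>c>0. \<forall>(M :: 'w measure) A.
           growth_process N \<pi> (lattice_part (half_space u)) M A \<longrightarrow>
           (\<forall>t::nat.
              measure M {\<omega> \<in> space M.
                lattice_part (shifted_half_space u (real t * (w - \<epsilon>))) \<inter> lattice_ball (real t ^ 2)
                  \<subseteq> A t \<omega> \<inter> lattice_ball (real t ^ 2) \<and>
                A t \<omega> \<inter> lattice_ball (real t ^ 2)
                  \<subseteq> lattice_part (shifted_half_space u (real t * (w + \<epsilon>))) \<inter> lattice_ball (real t ^ 2)}
              \<ge> 1 - exp (- c * real t))"
proof -
  have T: "T = det_CA N \<pi>" and rule: "growth_rule N \<pi>"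
    using assms(1) by (simp_all add: perturbation_def)
  interpret half_space_growth N \<pi> u
    by standard (use assms rule in \<open>simp_all add: T\<close>)
  show ?thesis
    unfolding lattice_part_shifted lattice_part_half_space
  proof (rule exI[of _ velocity], unfold good_shape_def[symmetric], intro conjI velocity_pos allI impI)
    fix \<epsilon> :: real assume "\<epsilon> > 0"
    from good_shape_probability[OF this] obtain c where c: "c > 0"
      "\<And>t W. finite W \<Longrightarrow> square 0 (t ^ 2 + radius * t) \<subseteq> W \<Longrightarrow>
        1 - exp (- c * real t) \<le> steps W t (\<lambda>A. of_bool (good_shape \<epsilon> t A)) (H 0)" by blast
    \<comment> \<open>The constant \<open>c\<close> stems from finite sums that do not mention the
      probability space, so it serves every \<open>M\<close> and \<open>A\<close>.\<close>
    have "1 - exp (- c * real t) \<le> measure M {\<omega> \<in> space M. good_shape \<epsilon> t (A t \<omega>)}"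
      if process: "growth_process N \<pi> (H 0) M A" for M :: "'w measure" and A t
    proof -
      interpret P: prob_space M by (rule process_prob_space[OF process])
      define E where "E = {\<omega> \<in> space M. good_shape \<epsilon> t (A t \<omega>)}"
      have "1 - exp (- c * real t) \<le> steps (square 0 (t ^ 2 + radius * t)) t (\<lambda>A. of_bool (good_shape \<epsilon> t A)) (H 0)"
        by (rule c(2)) simp_all
      also have "\<dots> = (\<integral>\<omega>. of_bool (good_shape \<epsilon> t (A t \<omega>)) \<partial>M)"
        using process_steps[OF process finite_square order_refl depends_on_good_shape] by simp
      also have "\<dots> = (\<integral>\<omega>. indicat_real E \<omega> \<partial>M)"
        by (rule Bochner_Integration.integral_cong) (auto simp: E_def indicator_def)
      also have "\<dots> = measure M E"
        by (simp add: E_def Int_absorb2 Collect_restrict)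
      finally show ?thesis by (simp add: E_def)
    qed
    then show "\<exists>c>0. \<forall>(M :: 'w measure) A. growth_process N \<pi> (H 0) M A \<longrightarrow>
      (\<forall>t. 1 - exp (- c * real t) \<le> measure M {\<omega> \<in> space M. good_shape \<epsilon> t (A t \<omega>)})"
      using c(1) by blast
  qed
qed

end
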